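(* Let $k\ge 1$ be an integer, let $G=(V,E)$ be a finite $2k$-edge connected graph and let $u,v\in V$ be distinct vertices such that $E_u:=\{e\in E\mid e\text{ is incident to }u\}$ is a $u$-$v$-cut of minimal cardinality. Let $a$ and $b$ be vertices in the same component of $G-\{u,v\}$. Then there is a spanning tree packing $\mathcal T$ of cardinality $k$ of $G-u$ and two trees $T,T'\in\mathcal T$ such that $a$ and $b$ lie in the same component of $(T\cup T')-v$.
   Context: Graphs are multigraphs: parallel edges are allowed, loops are not. A graph is $m$-edge connected if it is connected and cannot be disconnected by removing fewer than $m$ edges. A $u$-$v$-cut is a set $S$ of edges such that there is no $u$-$v$-path in $G-S$; minimal cardinality means minimal among all $u$-$v$-cuts of $G$. A spanning tree packing of a graph is a set of pairwise edge disjoint spanning trees of it. The trees $T,T'$ are not required to be distinct (for $k\ge 2$ requiring distinctness gives an equivalent statement). *)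

theory Defs
  imports Main
begin

text \<open>
  An edge is an abstract object with a set of end vertices, so that parallel edges are distinct
  edges with the same ends. Outside the edge set, \<open>mends\<close> is unconstrained.
\<close>

record ('v, 'e) mgraph =
  mverts :: "'v set"
  medges :: "'e set"
  mends :: "'e \<Rightarrow> 'v set"

definition multigraph :: "('v, 'e) mgraph \<Rightarrow> bool" where
  "multigraph G \<longleftrightarrow> (\<forall>e \<in> medges G. mends G e \<subseteq> mverts G \<and> card (mends G e) = 2)"

definition finite_multigraph :: "('v, 'e) mgraph \<Rightarrow> bool" where
  "finite_multigraph G \<longleftrightarrow> multigraph G \<and> finite (mverts G) \<and> finite (medges G)"

text \<open>
  A subgraph shares the whole map \<open>mends\<close>, also outside its edge set. It is thus determined by its
  vertices and edges, and sets of subgraphs have the expected cardinality.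
\<close>

definition mg_subgraph :: "('v, 'e) mgraph \<Rightarrow> ('v, 'e) mgraph \<Rightarrow> bool" where
  "mg_subgraph H G \<longleftrightarrow>
     multigraph H \<and> mverts H \<subseteq> mverts G \<and> medges H \<subseteq> medges G \<and> mends H = mends G"

definition delete_edges :: "('v, 'e) mgraph \<Rightarrow> 'e set \<Rightarrow> ('v, 'e) mgraph" where
  "delete_edges G S = G\<lparr>medges := medges G - S\<rparr>"

definition delete_vertices :: "('v, 'e) mgraph \<Rightarrow> 'v set \<Rightarrow> ('v, 'e) mgraph" where
  "delete_vertices G X =
     G\<lparr>mverts := mverts G - X, medges := {e \<in> medges G. mends G e \<inter> X = {}}\<rparr>"

text \<open>Only meant for graphs with the same \<open>mends\<close>, such as two subgraphs of one graph.\<close>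

definition mg_union :: "('v, 'e) mgraph \<Rightarrow> ('v, 'e) mgraph \<Rightarrow> ('v, 'e) mgraph" where
  "mg_union H H' = H\<lparr>mverts := mverts H \<union> mverts H', medges := medges H \<union> medges H'\<rparr>"

text \<open>Walks are given by their vertex sequence \<open>xs\<close> and their edge sequence \<open>es\<close>.\<close>

definition mg_walk :: "('v, 'e) mgraph \<Rightarrow> 'v list \<Rightarrow> 'e list \<Rightarrow> bool" where
  "mg_walk G xs es \<longleftrightarrow>
     length xs = Suc (length es) \<and> set xs \<subseteq> mverts G \<and> set es \<subseteq> medges G \<and>
     (\<forall>i < length es. mends G (es ! i) = {xs ! i, xs ! Suc i})"

definition mg_path :: "('v, 'e) mgraph \<Rightarrow> 'v \<Rightarrow> 'v \<Rightarrow> 'v list \<Rightarrow> 'e list \<Rightarrow> bool" where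
  "mg_path G x y xs es \<longleftrightarrow> mg_walk G xs es \<and> distinct xs \<and> hd xs = x \<and> last xs = y"

text \<open>
  Distinctness of the edges excludes going back and forth along one edge; two parallel edges do
  form a cycle.
\<close>

definition mg_cycle :: "('v, 'e) mgraph \<Rightarrow> 'v list \<Rightarrow> 'e list \<Rightarrow> bool" where
  "mg_cycle G xs es \<longleftrightarrow>
     mg_walk G xs es \<and> es \<noteq> [] \<and> hd xs = last xs \<and> distinct (tl xs) \<and> distinct es"

definition mg_connected :: "('v, 'e) mgraph \<Rightarrow> bool" where
  "mg_connected G \<longleftrightarrow>
     mverts G \<noteq> {} \<and> (\<forall>x \<in> mverts G. \<forall>y \<in> mverts G. \<exists>xs es. mg_path G x y xs es)"

definition mg_edge_connected :: "nat \<Rightarrow> ('v, 'e) mgraph \<Rightarrow> bool" where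
  "mg_edge_connected m G \<longleftrightarrow>
     mg_connected G \<and>
     (\<forall>S \<subseteq> medges G. finite S \<and> card S < m \<longrightarrow> mg_connected (delete_edges G S))"

definition mg_component :: "('v, 'e) mgraph \<Rightarrow> ('v, 'e) mgraph \<Rightarrow> bool" where
  "mg_component C G \<longleftrightarrow>
     mg_subgraph C G \<and> mg_connected C \<and>
     (\<forall>H. mg_subgraph H G \<and> mg_connected H \<and> mg_subgraph C H \<longrightarrow> H = C)"

definition in_same_component :: "('v, 'e) mgraph \<Rightarrow> 'v \<Rightarrow> 'v \<Rightarrow> bool" where
  "in_same_component G a b \<longleftrightarrow> (\<exists>C. mg_component C G \<and> a \<in> mverts C \<and> b \<in> mverts C)"

definition incident_edges :: "('v, 'e) mgraph \<Rightarrow> 'v \<Rightarrow> 'e set" where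
  "incident_edges G u = {e \<in> medges G. u \<in> mends G e}"

definition separating_cut :: "('v, 'e) mgraph \<Rightarrow> 'v \<Rightarrow> 'v \<Rightarrow> 'e set \<Rightarrow> bool" where
  "separating_cut G u v S \<longleftrightarrow>
     S \<subseteq> medges G \<and> (\<nexists>xs es. mg_path (delete_edges G S) u v xs es)"

text \<open>Comparing cardinalities with \<open>card\<close> is meaningful for finite graphs only.\<close>

definition minimum_cut :: "('v, 'e) mgraph \<Rightarrow> 'v \<Rightarrow> 'v \<Rightarrow> 'e set \<Rightarrow> bool" where
  "minimum_cut G u v S \<longleftrightarrow>
     separating_cut G u v S \<and> (\<forall>S'. separating_cut G u v S' \<longrightarrow> card S \<le> card S')"

definition mg_tree :: "('v, 'e) mgraph \<Rightarrow> bool" where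
  "mg_tree T \<longleftrightarrow> multigraph T \<and> mg_connected T \<and> (\<nexists>xs es. mg_cycle T xs es)"

definition mg_spanning_tree :: "('v, 'e) mgraph \<Rightarrow> ('v, 'e) mgraph \<Rightarrow> bool" where
  "mg_spanning_tree T G \<longleftrightarrow> mg_subgraph T G \<and> mverts T = mverts G \<and> mg_tree T"

definition spanning_tree_packing :: "('v, 'e) mgraph set \<Rightarrow> ('v, 'e) mgraph \<Rightarrow> bool" where
  "spanning_tree_packing \<T> G \<longleftrightarrow>
     (\<forall>T \<in> \<T>. mg_spanning_tree T G) \<and>
     (\<forall>T \<in> \<T>. \<forall>T' \<in> \<T>. T \<noteq> T' \<longrightarrow> medges T \<inter> medges T' = {})"

end

theory Submission
  imports Defs
begin

text \<open>
  Write \<open>H = G - u\<close>. Counting the edges that leave the classes of a partition of \<open>H\<close> shows that \<open>H\<close>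
  satisfies the partition condition of Nash-Williams and Tutte. It follows that a path from \<open>a\<close> to
  \<open>b\<close> avoiding \<open>v\<close> extends to an edge set of size \<open>k (n - 1)\<close> in which every vertex set \<open>B\<close> induces
  at most \<open>k (|B| - 1)\<close> edges. Such a graph decomposes into \<open>k\<close> spanning trees, and whenever \<open>a\<close>
  and \<open>b\<close> are connected in it without \<open>v\<close>, the decomposition can be chosen such that two trees
  suffice. This is shown by induction on the number of vertices. Call a vertex set tight if equality
  holds in the above bound. Nontrivial tight sets are contracted, since decompositions inside the
  set and of the contracted graph fit together. If there are none, choose a vertex \<open>w \<noteq> v\<close> of degree
  less than \<open>2k\<close> and split it off. The absence of tight sets leaves the choice of the first pair of
  edges free, so the two edges in which a path from \<open>a\<close> to \<open>b\<close> passes through \<open>w\<close> can be paired.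
  When the splitting is undone, these two edges can be given to the two trees.
\<close>

section \<open>Sparse and tight edge sets\<close>

text \<open>In matroid terms, sparse edge sets are the independent sets of the union of k copies of
  the graphic matroid, and the partition condition says that its rank is k(n - 1). Passing to a
  basis has two effects: the degree sum 2k(n - 1) forces a vertex of degree below 2k, and k
  connected classes have no edge to spare, so they are trees by counting alone. A path is
  independent, hence part of some basis. A vertex \<open>w\<close> of degree d has k \<le> d < 2k,
  and d - k new edges in place of its d edges restore the count k(n - 2). Undoing this, a tree with
  m new edges falls into m + 1 pieces and needs m + 1 edges at \<open>w\<close>; over all trees
  these are (d - k) + k = d, so the supply is just enough. The obstacle is a linking path through
  \<open>w\<close>: its two edges at \<open>w\<close> must both land in the two chosen trees, so the
  splitting has to respect them. Tight sets are exactly what can forbid a prescribed pair, which is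
  why they are contracted beforehand. The two trees are fixed as the colours 0 and 1, and k = 1 is a
  separate easy case.\<close>

definition graph_on :: "'v set \<Rightarrow> 'e set \<Rightarrow> ('e \<Rightarrow> 'v set) \<Rightarrow> bool" where
  "graph_on V E en \<longleftrightarrow> finite V \<and> finite E \<and> (\<forall>e\<in>E. en e \<subseteq> V \<and> card (en e) = 2)"

definition induced :: "'e set \<Rightarrow> ('e \<Rightarrow> 'v set) \<Rightarrow> 'v set \<Rightarrow> 'e set" where
  "induced E en B = {e \<in> E. en e \<subseteq> B}"

text \<open>The bound |E(B)| \<le> k(|B| - 1), free of subtraction on natural numbers. The empty set
  violates it for \<open>k > 0\<close> and is excluded, which is why uncrossing needs sets that
  meet.\<close>

definition sparse :: "nat \<Rightarrow> 'v set \<Rightarrow> 'e set \<Rightarrow> ('e \<Rightarrow> 'v set) \<Rightarrow> bool" where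
  "sparse k V E en \<longleftrightarrow> (\<forall>B \<subseteq> V. B \<noteq> {} \<longrightarrow> card (induced E en B) + k \<le> k * card B)"

definition ktight :: "nat \<Rightarrow> 'v set \<Rightarrow> 'e set \<Rightarrow> ('e \<Rightarrow> 'v set) \<Rightarrow> bool" where
  "ktight k V E en \<longleftrightarrow>
     V \<noteq> {} \<and> graph_on V E en \<and> sparse k V E en \<and> card E + k = k * card V"

text \<open>Connectivity is phrased by cuts because contraction, gluing and undoing a splitting can
  each be checked for one vertex set \<open>B\<close> at a time.\<close>

definition cut_connected :: "'e set \<Rightarrow> ('e \<Rightarrow> 'v set) \<Rightarrow> 'v set \<Rightarrow> bool" where
  "cut_connected F en V \<longleftrightarrow>
     (\<forall>B \<subseteq> V. B \<noteq> {} \<longrightarrow> B \<noteq> V \<longrightarrow> (\<exists>e\<in>F. en e \<inter> B \<noteq> {} \<and> en e \<inter> (V - B) \<noteq> {}))"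

text \<open>A decomposition is a colouring. Only connectivity of the classes is demanded; for a
  \<open>ktight\<close> edge set, counting turns each class into a tree (\<open>class_card\<close>,
  \<open>tree_of_count\<close>).\<close>

definition packing :: "nat \<Rightarrow> 'v set \<Rightarrow> 'e set \<Rightarrow> ('e \<Rightarrow> 'v set) \<Rightarrow> ('e \<Rightarrow> nat) \<Rightarrow> bool" where
  "packing k V E en c \<longleftrightarrow>
     (\<forall>e\<in>E. c e < k) \<and> (\<forall>i<k. cut_connected {e \<in> E. c e = i} en V)"

text \<open>Both ends must lie in \<open>X\<close>, so taking \<open>V - {v}\<close> for
  \<open>X\<close> expresses deletion of \<open>v\<close> while the edge set is kept.\<close>

definition adj :: "'e set \<Rightarrow> ('e \<Rightarrow> 'v set) \<Rightarrow> 'v set \<Rightarrow> ('v \<times> 'v) set" where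
  "adj F en X = {(x, y). x \<in> X \<and> y \<in> X \<and> (\<exists>e\<in>F. en e = {x, y})}"

lemma sparseD:
  "sparse k V E en \<Longrightarrow> B \<subseteq> V \<Longrightarrow> B \<noteq> {} \<Longrightarrow> card (induced E en B) + k \<le> k * card B"
  by (simp add: sparse_def)

lemma card2_eq: "card S = 2 \<Longrightarrow> p \<in> S \<Longrightarrow> q \<in> S \<Longrightarrow> p \<noteq> q \<Longrightarrow> S = {p, q}"
  by (auto simp: card_2_iff)

lemma rtrancl_leave:
  "(a, b) \<in> R\<^sup>* \<Longrightarrow> a \<in> Q \<Longrightarrow> b \<notin> Q \<Longrightarrow> \<exists>x y. (x, y) \<in> R \<and> x \<in> Q \<and> y \<notin> Q"
  by (induction rule: rtrancl_induct) auto

lemma adj_reach_sym: "(x, y) \<in> (adj F en X)\<^sup>* \<Longrightarrow> (y, x) \<in> (adj F en X)\<^sup>*"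
proof -
  have "sym (adj F en X)"
    by (auto simp: sym_def adj_def insert_commute)
  then show "(x, y) \<in> (adj F en X)\<^sup>* \<Longrightarrow> (y, x) \<in> (adj F en X)\<^sup>*"
    by (meson sym_rtrancl symD)
qed

lemma adj_reach_mono:
  assumes "(x, y) \<in> (adj F en X)\<^sup>*" "X \<subseteq> Y" "\<And>e. e \<in> F \<Longrightarrow> en e \<subseteq> X \<Longrightarrow> e \<in> F' \<and> en' e = en e"
  shows "(x, y) \<in> (adj F' en' Y)\<^sup>*"
proof -
  have "adj F en X \<subseteq> adj F' en' Y"
    using assms(2,3) unfolding adj_def by fastforce
  then show ?thesis using assms(1) rtrancl_mono by blast
qed

lemma adj_reach_in: "(x, y) \<in> (adj F en X)\<^sup>* \<Longrightarrow> x \<in> X \<Longrightarrow> y \<in> X"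
  by (induction rule: rtrancl_induct) (auto simp: adj_def)

lemma cut_connected_reach:
  assumes "cut_connected F en V" "\<And>e. e \<in> F \<Longrightarrow> card (en e) = 2" "x \<in> V" "y \<in> V"
  shows "(x, y) \<in> (adj F en V)\<^sup>*"
proof (rule ccontr)
  assume ny: "(x, y) \<notin> (adj F en V)\<^sup>*"
  define Q where "Q = {z \<in> V. (x, z) \<in> (adj F en V)\<^sup>*}"
  have "Q \<subseteq> V" "Q \<noteq> {}" "Q \<noteq> V" using assms(3,4) ny by (auto simp: Q_def)
  then obtain e where e: "e \<in> F" "en e \<inter> Q \<noteq> {}" "en e \<inter> (V - Q) \<noteq> {}"
    using assms(1) unfolding cut_connected_def by blast
  then obtain p q where pq: "p \<in> en e" "p \<in> Q" "q \<in> en e" "q \<in> V" "q \<notin> Q" by blast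
  then have "en e = {p, q}" using card2_eq[of "en e" p q] assms(2)[OF e(1)] by blast
  then have "(p, q) \<in> adj F en V" using e(1) pq unfolding adj_def Q_def by auto
  then show False using pq unfolding Q_def by (auto intro: rtrancl_into_rtrancl)
qed

lemma finite_induced [simp]: "finite E \<Longrightarrow> finite (induced E en B)"
  by (simp add: induced_def)

text \<open>Supermodularity: an edge inside both sets lies inside their intersection, and an edge
  between \<open>B - C\<close> and \<open>C - B\<close> counts for the union only.\<close>

lemma card_induced_super:
  assumes "finite E"
  shows "card (induced E en B) + card (induced E en C)
    \<le> card (induced E en (B \<union> C)) + card (induced E en (B \<inter> C))"
proof -
  have "card (induced E en B) + card (induced E en C)
      = card (induced E en B \<union> induced E en C) + card (induced E en B \<inter> induced E en C)"
    by (rule card_Un_Int) (use assms in auto)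
  also have "induced E en B \<inter> induced E en C = induced E en (B \<inter> C)"
    by (auto simp: induced_def)
  also have "card (induced E en B \<union> induced E en C) \<le> card (induced E en (B \<union> C))"
    by (rule card_mono) (use assms in \<open>auto simp: induced_def\<close>)
  finally show ?thesis by simp
qed

lemma mult_card_Un_Int:
  assumes "finite B" "finite C"
  shows "(k::nat) * card B + k * card C = k * card (B \<union> C) + k * card (B \<inter> C)"
  using card_Un_Int[OF assms] by (metis distrib_left)

definition tight_set :: "nat \<Rightarrow> 'v set \<Rightarrow> 'e set \<Rightarrow> ('e \<Rightarrow> 'v set) \<Rightarrow> 'v set \<Rightarrow> bool" where
  "tight_set k V E en A \<longleftrightarrow> A \<subseteq> V \<and> A \<noteq> {} \<and> card (induced E en A) + k = k * card A"

text \<open>Uncrossing: the number of induced edges is supermodular and \<open>k * card\<close> is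
  modular, so the slacks of union and intersection add up to at most 0. The common vertex makes the
  sparsity bound available for the intersection.\<close>

lemma tight_set_Un:
  assumes "finite V" "finite E" "sparse k V E en" "tight_set k V E en A" "tight_set k V E en B"
    "A \<inter> B \<noteq> {}"
  shows "tight_set k V E en (A \<union> B)"
proof -
  have fin: "finite A" "finite B"
    using assms by (auto simp: tight_set_def intro: finite_subset)
  have sub: "A \<union> B \<subseteq> V" "A \<inter> B \<subseteq> V" using assms by (auto simp: tight_set_def)
  have "card (induced E en (A \<union> B)) + k \<le> k * card (A \<union> B)"
    "card (induced E en (A \<inter> B)) + k \<le> k * card (A \<inter> B)"
    using sparseD[OF assms(3) sub(1)] sparseD[OF assms(3) sub(2)] assms(6) by auto
  then show ?thesis
    using card_induced_super[OF assms(2), of en A B] mult_card_Un_Int[OF fin, of k] assms(4,5) sub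
    unfolding tight_set_def by auto
qed

text \<open>The state of splitting off a vertex: \<open>D\<close> are the remaining half edges, \<open>s\<close> gives their
  ends other than the vertex, and \<open>r\<close> pairs of half edges are still to be turned into edges.\<close>

definition split_state ::
  "nat \<Rightarrow> 'v set \<Rightarrow> 'e set \<Rightarrow> ('e \<Rightarrow> 'v set) \<Rightarrow> 'e set \<Rightarrow> ('e \<Rightarrow> 'v) \<Rightarrow> nat \<Rightarrow> bool" where
  "split_state k V L en D s r \<longleftrightarrow>
     V \<noteq> {} \<and> graph_on V L en \<and> finite D \<and> D \<inter> L = {} \<and> s ` D \<subseteq> V \<and> sparse k V L en \<and>
     r + card L + k = k * card V \<and> 2 * r \<le> card D \<and>
     (\<forall>B \<subseteq> V. B \<noteq> {} \<longrightarrow>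
        r + card (induced L en B) + k \<le> k * card B + card {d \<in> D. s d \<notin> B})"

text \<open>The strict inequalities say that no tight set contains both far ends, and that no set
  with equality in the last condition of \<open>split_state\<close> misses both. Apart from loops,
  only such sets can obstruct the new edge.\<close>

definition splittable ::
  "nat \<Rightarrow> 'v set \<Rightarrow> 'e set \<Rightarrow> ('e \<Rightarrow> 'v set) \<Rightarrow> 'e set \<Rightarrow> ('e \<Rightarrow> 'v) \<Rightarrow> nat \<Rightarrow> 'e \<Rightarrow> 'e \<Rightarrow> bool" where
  "splittable k V L en D s r p q \<longleftrightarrow>
     p \<in> D \<and> q \<in> D \<and> s p \<noteq> s q \<and>
     (\<forall>X \<subseteq> V. s p \<in> X \<and> s q \<in> X \<longrightarrow> card (induced L en X) + k < k * card X) \<and>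
     (\<forall>B \<subseteq> V. B \<noteq> {} \<and> s p \<notin> B \<and> s q \<notin> B \<longrightarrow>
        r + card (induced L en B) + k < k * card B + card {d \<in> D. s d \<notin> B})"

lemma ex_minimal_set:
  assumes "finite V" "P A" "\<And>A. P A \<Longrightarrow> A \<subseteq> V"
  shows "\<exists>M. P M \<and> (\<forall>B. P B \<and> B \<subseteq> M \<longrightarrow> B = M)"
proof -
  have "finite {A. P A}" using assms(1,3) by (auto intro: finite_subset[of _ "Pow V"])
  then show ?thesis
    using finite_has_minimal[of "{A. P A}"] assms(2) by (metis (no_types, lifting) empty_iff mem_Collect_eq)
qed

lemma ex_maximal_set:
  assumes "finite V" "P A" "\<And>A. P A \<Longrightarrow> A \<subseteq> V"
  shows "\<exists>M. P M \<and> A \<subseteq> M \<and> (\<forall>B. P B \<and> M \<subseteq> B \<longrightarrow> B = M)"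
proof -
  have "finite {A. P A}" using assms(1,3) by (auto intro: finite_subset[of _ "Pow V"])
  then show ?thesis
    using finite_has_maximal2[of "{A. P A}" A] assms(2) by (metis (no_types, lifting) mem_Collect_eq)
qed

text \<open>Call \<open>B\<close> co-tight if the last condition of \<open>split_state\<close> holds with equality. A co-tight set
  contains all but at most \<open>r\<close> of the at least \<open>2r\<close> half edges, so there are no three disjoint ones.
  Hence half edges at one or two disjoint minimal co-tight sets meet all of them.\<close>

lemma ex_splittable:
  assumes st: "split_state k V L en D s r" and r: "r \<ge> 1"
  shows "\<exists>p q. splittable k V L en D s r p q"
proof -
  define i where "i B = card (induced L en B)" for B
  define out where "out B = card {d \<in> D. s d \<notin> B}" for B
  define ins where "ins B = card {d \<in> D. s d \<in> B}" for B
  define cot where "cot B \<longleftrightarrow> B \<subseteq> V \<and> B \<noteq> {} \<and> r + i B + k = k * card B + out B" for B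
  have fV: "finite V" and fL: "finite L" and fD: "finite D" and sp: "sparse k V L en"
    and tot: "r + card L + k = k * card V" and D2: "2 * r \<le> card D" and sD: "s ` D \<subseteq> V"
    and LV: "\<And>e. e \<in> L \<Longrightarrow> en e \<subseteq> V \<and> card (en e) = 2" and V0: "V \<noteq> {}"
    using st unfolding split_state_def graph_on_def by auto
  have star: "r + i B + k \<le> k * card B + out B" if "B \<subseteq> V" "B \<noteq> {}" for B
    using st that unfolding split_state_def i_def out_def by blast
  have spi: "i B + k \<le> k * card B" if "B \<subseteq> V" "B \<noteq> {}" for B
    using sp that unfolding sparse_def i_def by blast
  have io: "ins B + out B = card D" for B
  proof -
    have "{d \<in> D. s d \<in> B} \<union> {d \<in> D. s d \<notin> B} = D" by auto
    then show ?thesis unfolding ins_def out_def using fD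
      by (metis (no_types, lifting) card_Un_disjoint disjoint_iff finite_Un mem_Collect_eq)
  qed
  have outm: "out B + out C = out (B \<union> C) + out (B \<inter> C)" for B C
  proof -
    have "{d \<in> D. s d \<notin> B} \<union> {d \<in> D. s d \<notin> C} = {d \<in> D. s d \<notin> B \<inter> C}"
      "{d \<in> D. s d \<notin> B} \<inter> {d \<in> D. s d \<notin> C} = {d \<in> D. s d \<notin> B \<union> C}" by auto
    then show ?thesis unfolding out_def
      using card_Un_Int[of "{d \<in> D. s d \<notin> B}" "{d \<in> D. s d \<notin> C}"] fD by simp
  qed
  have cot_int: "cot (B \<inter> C)" if "cot B" "cot C" "B \<inter> C \<noteq> {}" for B C
  proof -
    have sub: "B \<union> C \<subseteq> V" "B \<inter> C \<subseteq> V" "B \<union> C \<noteq> {}" using that by (auto simp: cot_def)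
    have fin: "finite B" "finite C" using that fV by (auto simp: cot_def intro: finite_subset)
    show ?thesis
      using star[OF sub(1,3)] star[OF sub(2) that(3)] card_induced_super[OF fL, of en B C]
        mult_card_Un_Int[OF fin, of k] outm[of B C] that sub
      unfolding cot_def i_def by auto
  qed
  \<comment> \<open>Subtract sparsity of \<open>B\<close> from the equality in
    \<open>cot B\<close>.\<close>
  have cot_out: "out B \<le> r" if "cot B" for B
    using that spi[of B] unfolding cot_def by auto
  have cot_ins: "card D \<le> ins B + r" if "cot B" for B
    using cot_out[OF that] io[of B] by auto
  have ins_ex: "\<exists>d\<in>D. s d \<in> B" if "cot B" for B
  proof -
    have "ins B > 0" using cot_ins[OF that] D2 r by auto
    then show ?thesis unfolding ins_def by (metis (mono_tags, lifting) Collect_empty_eq card.empty less_irrefl)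
  qed
  have ins_dis: "ins B + ins C = ins (B \<union> C)" if "B \<inter> C = {}" for B C
  proof -
    have "{d \<in> D. s d \<in> B \<union> C} = {d \<in> D. s d \<in> B} \<union> {d \<in> D. s d \<in> C}" by auto
    then show ?thesis unfolding ins_def using fD that
      by (subst card_Un_disjoint[symmetric]) auto
  qed
  have ins_le: "ins B \<le> card D" for B using io[of B] by simp
  \<comment> \<open>The counterpart of \<open>cot_out\<close>: a tight set misses at least
    \<open>r\<close> half edges, a co-tight one at most \<open>r\<close>.\<close>
  have tight_out: "r \<le> out X" if "tight_set k V L en X" for X
    using star[of X] that unfolding tight_set_def i_def by auto
  have indV: "induced L en V = L" using LV by (auto simp: induced_def)
  have "out V = 0" unfolding out_def using sD by (auto simp: card_eq_0_iff)
  then have cotV: "cot V" unfolding cot_def i_def using tot indV V0 by simp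
  obtain Y0 where Y0: "cot Y0" "\<And>B. cot B \<Longrightarrow> B \<subseteq> Y0 \<Longrightarrow> B = Y0"
    using ex_minimal_set[OF fV, of cot V] cotV cot_def by metis
  obtain p where p: "p \<in> D" "s p \<in> Y0" using ins_ex[OF Y0(1)] by blast
  \<comment> \<open>\<open>B \<inter> Y0\<close> is co-tight, hence all of \<open>Y0\<close> by
    minimality. So one half edge at \<open>Y0\<close> serves every co-tight set that meets
    \<open>Y0\<close>.\<close>
  have hitY0: "s p \<in> B" if "cot B" "B \<inter> Y0 \<noteq> {}" for B
    using cot_int[OF that(1) Y0(1) that(2)] Y0(2)[of "B \<inter> Y0"] p by auto
  have single: "tight_set k V L en {x}" if "x \<in> V" for x
  proof -
    have "induced L en {x} = {}"
    proof (rule ccontr)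
      assume "induced L en {x} \<noteq> {}"
      then obtain e where "e \<in> L" "en e \<subseteq> {x}" by (auto simp: induced_def)
      then show False using LV[of e] card_mono[of "{x}" "en e"] by simp
    qed
    then show ?thesis using that by (simp add: tight_set_def)
  qed
  have spV: "s d \<in> V" if "d \<in> D" for d using sD that by auto
  have fin: "\<exists>p q. splittable k V L en D s r p q"
    if q: "q \<in> D" and T: "\<And>X. tight_set k V L en X \<Longrightarrow> s p \<in> X \<Longrightarrow> s q \<in> X \<Longrightarrow> False"
      and C: "\<And>B. cot B \<Longrightarrow> s p \<notin> B \<Longrightarrow> s q \<notin> B \<Longrightarrow> False" for q
  proof -
    have "s p \<noteq> s q" using T[OF single[OF spV[OF p(1)]]] by auto
    moreover have "card (induced L en X) + k < k * card X" if "X \<subseteq> V" "s p \<in> X" "s q \<in> X" for X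
    proof -
      have "X \<noteq> {}" using that by auto
      then show ?thesis
        using T[of X] that spi[of X] unfolding tight_set_def i_def by (metis le_neq_implies_less)
    qed
    moreover have "r + card (induced L en B) + k < k * card B + card {d \<in> D. s d \<notin> B}"
      if "B \<subseteq> V" "B \<noteq> {}" "s p \<notin> B" "s q \<notin> B" for B
      using C[of B] that star[of B] unfolding cot_def i_def out_def by (metis le_neq_implies_less)
    ultimately have "splittable k V L en D s r p q" unfolding splittable_def using p q by blast
    then show ?thesis by blast
  qed
  show ?thesis
  proof (cases "\<exists>Y. cot Y \<and> Y \<inter> Y0 = {}")
    case True
    then obtain Y1 where Y1: "cot Y1" "Y1 \<inter> Y0 = {}"
      "\<And>B. cot B \<Longrightarrow> B \<inter> Y0 = {} \<Longrightarrow> B \<subseteq> Y1 \<Longrightarrow> B = Y1"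
      using ex_minimal_set[OF fV, of "\<lambda>Y. cot Y \<and> Y \<inter> Y0 = {}"] cot_def by metis
    obtain q where q: "q \<in> D" "s q \<in> Y1" using ins_ex[OF Y1(1)] by blast
    have ins2: "ins Y0 + ins Y1 = ins (Y0 \<union> Y1)" using ins_dis[of Y0 Y1] Y1(2) by auto
    \<comment> \<open>Each of the two disjoint sets holds at least \<open>card D - r \<ge> r\<close>
      half edges, and together they hold at most \<open>card D\<close>. So all these bounds are
      exact, and every half edge ends in \<open>Y0 \<union> Y1\<close>.\<close>
    have eq: "card D = 2 * r" "ins Y0 = r" "ins Y1 = r" "ins (Y0 \<union> Y1) = card D"
      using ins2 ins_le[of "Y0 \<union> Y1"] cot_ins[OF Y0(1)] cot_ins[OF Y1(1)] D2 by linarith+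
    \<comment> \<open>Now \<open>out Y = r\<close>, which turns the co-tight equality into
      tightness, so these sets can be merged with tight sets.\<close>
    have tY: "tight_set k V L en Y" if "cot Y" "ins Y = r" for Y
      using that io[of Y] eq(1) unfolding cot_def tight_set_def i_def by auto
    show ?thesis
    proof (rule fin[OF q(1)])
      \<comment> \<open>Joining \<open>X\<close> with both sets gives a tight set that misses no
        half edge, against \<open>tight_out\<close>.\<close>
      fix X assume X: "tight_set k V L en X" "s p \<in> X" "s q \<in> X"
      have 1: "tight_set k V L en (X \<union> Y0)"
        by (rule tight_set_Un[OF fV fL sp X(1) tY[OF Y0(1) eq(2)]]) (use X p in auto)
      have 2: "tight_set k V L en (X \<union> Y0 \<union> Y1)"
        by (rule tight_set_Un[OF fV fL sp 1 tY[OF Y1(1) eq(3)]]) (use X q in auto)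
      have "ins (Y0 \<union> Y1) \<le> ins (X \<union> Y0 \<union> Y1)"
        unfolding ins_def by (rule card_mono) (use fD in auto)
      then show False using tight_out[OF 2] io[of "X \<union> Y0 \<union> Y1"] eq r by auto
    next
      fix B assume B: "cot B" "s p \<notin> B" "s q \<notin> B"
      have B0: "B \<inter> Y0 = {}" using hitY0[OF B(1)] B by auto
      have B1: "B \<inter> Y1 = {}"
      proof (rule ccontr)
        assume "B \<inter> Y1 \<noteq> {}"
        then have "B \<inter> Y1 = Y1" using cot_int[OF B(1) Y1(1)] Y1(3)[of "B \<inter> Y1"] Y1(2) by auto
        then show False using q B by auto
      qed
      have "ins (Y0 \<union> Y1) + ins B = ins (Y0 \<union> Y1 \<union> B)" by (rule ins_dis) (use B0 B1 in auto)
      then show False using ins_le[of "Y0 \<union> Y1 \<union> B"] eq cot_ins[OF B(1)] r by auto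
    qed
  next
    case False
    \<comment> \<open>Every co-tight set now contains \<open>s p\<close>, so only tight sets matter.
      A largest one at \<open>s p\<close> misses some half edge, and any of those can serve as
      \<open>q\<close>.\<close>
    obtain X0 where X0: "tight_set k V L en X0" "{s p} \<subseteq> X0"
      "\<And>B. tight_set k V L en B \<Longrightarrow> X0 \<subseteq> B \<Longrightarrow> B = X0"
      using ex_maximal_set[OF fV, of "tight_set k V L en" "{s p}"] single[OF spV[OF p(1)]]
      by (metis tight_set_def)
    have "out X0 \<ge> 1" using tight_out[OF X0(1)] r by auto
    then have "{d \<in> D. s d \<notin> X0} \<noteq> {}" unfolding out_def by (metis card.empty not_one_le_zero)
    then obtain q where q: "q \<in> D" "s q \<notin> X0" by auto
    show ?thesis
    proof (rule fin[OF q(1)])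
      fix X assume X: "tight_set k V L en X" "s p \<in> X" "s q \<in> X"
      have "tight_set k V L en (X0 \<union> X)"
        by (rule tight_set_Un[OF fV fL sp X0(1) X(1)]) (use X X0 in auto)
      then show False using X0(3)[of "X0 \<union> X"] X q by auto
    next
      fix B assume "cot B" "s p \<notin> B"
      then show False using False hitY0 by auto
    qed
  qed
qed

section \<open>Splitting off a vertex\<close>

text \<open>\<open>N\<close> keeps one half edge of every pair and \<open>h\<close> names its
  partner, so a splitting uses up \<open>2 * card N\<close> half edges.\<close>

definition split_pairs :: "'e set \<Rightarrow> ('e \<Rightarrow> 'v) \<Rightarrow> 'e set \<Rightarrow> ('e \<Rightarrow> 'e) \<Rightarrow> bool" where
  "split_pairs D s N h \<longleftrightarrow>
     N \<subseteq> D \<and> h ` N \<subseteq> D \<and> inj_on h N \<and> N \<inter> h ` N = {} \<and> (\<forall>e\<in>N. s e \<noteq> s (h e))"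

text \<open>The edge that replaces the half edges \<open>e\<close> and \<open>h e\<close> keeps the name \<open>e\<close>.\<close>

definition split_ends ::
  "('e \<Rightarrow> 'v set) \<Rightarrow> ('e \<Rightarrow> 'v) \<Rightarrow> 'e set \<Rightarrow> ('e \<Rightarrow> 'e) \<Rightarrow> 'e \<Rightarrow> 'v set" where
  "split_ends en s N h e = (if e \<in> N then {s e, s (h e)} else en e)"

text \<open>Compare the last condition of \<open>split_state\<close> before and after. If both far
  ends lie in \<open>B\<close>, the new edge makes up for the loss in \<open>r\<close>; if exactly
  one does, both sides drop by 1; if none does, the right side drops by 2 and the strictness in
  \<open>splittable\<close> is used.\<close>

lemma split_update:
  assumes st: "split_state k V L en D s r" and r: "r \<ge> 1" and pq: "splittable k V L en D s r p q"
  shows "split_state k V (insert p L) (en(p := {s p, s q})) (D - {p, q}) s (r - 1)"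
proof -
  let ?L = "insert p L" and ?en = "en(p := {s p, s q})" and ?D = "D - {p, q}"
  have fV: "finite V" and fL: "finite L" and fD: "finite D" and sp: "sparse k V L en"
    and tot: "r + card L + k = k * card V" and D2: "2 * r \<le> card D" and sD: "s ` D \<subseteq> V"
    and LV: "\<And>e. e \<in> L \<Longrightarrow> en e \<subseteq> V \<and> card (en e) = 2" and V0: "V \<noteq> {}" and DL: "D \<inter> L = {}"
    and star: "\<And>B. B \<subseteq> V \<Longrightarrow> B \<noteq> {} \<Longrightarrow>
      r + card (induced L en B) + k \<le> k * card B + card {d \<in> D. s d \<notin> B}"
    using st unfolding split_state_def graph_on_def by auto
  have p: "p \<in> D" "q \<in> D" "s p \<noteq> s q" "p \<notin> L" "p \<noteq> q" "s p \<in> V" "s q \<in> V"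
    and T: "\<And>X. X \<subseteq> V \<Longrightarrow> s p \<in> X \<Longrightarrow> s q \<in> X \<Longrightarrow> card (induced L en X) + k < k * card X"
    and C: "\<And>B. B \<subseteq> V \<Longrightarrow> B \<noteq> {} \<Longrightarrow> s p \<notin> B \<Longrightarrow> s q \<notin> B \<Longrightarrow>
        r + card (induced L en B) + k < k * card B + card {d \<in> D. s d \<notin> B}"
    using pq DL sD unfolding splittable_def by auto
  have ind: "induced ?L ?en B = (if s p \<in> B \<and> s q \<in> B then insert p (induced L en B) else induced L en B)"
    for B using p(4) unfolding induced_def by auto
  have cind: "card (induced ?L ?en B) =
      card (induced L en B) + (if s p \<in> B \<and> s q \<in> B then 1 else 0)" for B
    using p(4) fL unfolding ind by (auto simp: induced_def)
  have out: "card {d \<in> D. s d \<notin> B} = card {d \<in> ?D. s d \<notin> B} +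
      (if s p \<in> B then 0 else 1) + (if s q \<in> B then 0 else 1)" for B
  proof -
    have "{d \<in> D. s d \<notin> B} = {d \<in> ?D. s d \<notin> B} \<union> ({p} \<inter> {d. s d \<notin> B}) \<union> ({q} \<inter> {d. s d \<notin> B})"
      using p by auto
    then show ?thesis using fD p(5) by (auto simp: card_insert_if)
  qed
  have "graph_on V ?L ?en" using fV fL LV p unfolding graph_on_def by auto
  moreover have "sparse k V ?L ?en"
    unfolding sparse_def cind using T sp[unfolded sparse_def] by (auto simp: Suc_le_eq)
  moreover have "r - 1 + card (induced ?L ?en B) + k \<le> k * card B + card {d \<in> ?D. s d \<notin> B}"
    if "B \<subseteq> V" "B \<noteq> {}" for B
    using star[OF that] C[OF that] r cind[of B] out[of B] by (auto split: if_splits)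
  moreover have "r - 1 + card ?L + k = k * card V" using tot r fL p by simp
  moreover have "2 * (r - 1) \<le> card ?D"
    using D2 p fD by (simp add: card_Diff_subset)
  moreover have "?D \<inter> ?L = {}" "s ` ?D \<subseteq> V" using DL sD by auto
  ultimately show ?thesis unfolding split_state_def using V0 fD by blast
qed

text \<open>Prefixes one pair to a splitting of the other half edges. It serves the induction in
  \<open>split_complete\<close> and also a first pair prescribed in advance.\<close>

lemma split_step:
  assumes "split_pairs (D - {p, q}) s N h" "sparse k V (insert p L \<union> N) (split_ends (en(p := {s p, s q})) s N h)"
    and "p \<in> D" "q \<in> D" "s p \<noteq> s q" "finite D"
  shows "split_pairs D s (insert p N) (h(p := q))" "card (insert p N) = Suc (card N)"
    "sparse k V (L \<union> insert p N) (split_ends en s (insert p N) (h(p := q)))"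
proof -
  have pN: "p \<notin> N" "N \<subseteq> D" "h ` N \<subseteq> D - {p, q}" using assms(1) by (auto simp: split_pairs_def)
  show "split_pairs D s (insert p N) (h(p := q))"
    using assms unfolding split_pairs_def inj_on_def by (auto split: if_splits)
  show "card (insert p N) = Suc (card N)" using pN assms(6) by (simp add: finite_subset)
  have "split_ends en s (insert p N) (h(p := q)) = split_ends (en(p := {s p, s q})) s N h"
    using pN by (auto simp: split_ends_def fun_eq_iff)
  then show "sparse k V (L \<union> insert p N) (split_ends en s (insert p N) (h(p := q)))"
    using assms(2) by simp
qed

lemma split_complete:
  "split_state k V L en D s r \<Longrightarrow>
   \<exists>N h. split_pairs D s N h \<and> card N = r \<and> sparse k V (L \<union> N) (split_ends en s N h)"
proof (induction r arbitrary: L en D)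
  case 0
  have "split_ends en s {} h = en" for h by (auto simp: split_ends_def)
  then show ?case
    using 0 unfolding split_state_def split_pairs_def by (intro exI[of _ "{}"]) auto
next
  case (Suc r)
  obtain p q where pq: "splittable k V L en D s (Suc r) p q" using ex_splittable[OF Suc.prems] by auto
  obtain N h where N: "split_pairs (D - {p, q}) s N h" "card N = r"
    "sparse k V (insert p L \<union> N) (split_ends (en(p := {s p, s q})) s N h)"
    using Suc.IH split_update[OF Suc.prems _ pq] by fastforce
  have "p \<in> D" "q \<in> D" "s p \<noteq> s q" "finite D"
    using pq Suc.prems unfolding splittable_def split_state_def by auto
  then show ?case using split_step[OF N(1,3)] N(2) by metis
qed

lemma split_ktight:
  assumes "graph_on V L en" "V \<noteq> {}" "D \<inter> L = {}" "finite D" "s ` D \<subseteq> V" "split_pairs D s N h"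
    "card N + card L + k = k * card V" "sparse k V (L \<union> N) (split_ends en s N h)"
  shows "ktight k V (L \<union> N) (split_ends en s N h)"
proof -
  have N: "N \<subseteq> D" "finite N" "L \<inter> N = {}"
    using assms(3,4,6) by (auto simp: split_pairs_def intro: finite_subset)
  have "graph_on V (L \<union> N) (split_ends en s N h)"
    unfolding graph_on_def
  proof (intro conjI ballI)
    fix e assume e: "e \<in> L \<union> N"
    have "s e \<in> V \<and> s (h e) \<in> V \<and> s e \<noteq> s (h e)" if "e \<in> N"
      using that assms(5,6) unfolding split_pairs_def by (meson image_subset_iff subsetD)
    moreover have "e \<notin> N \<Longrightarrow> en e \<subseteq> V \<and> card (en e) = 2" using e assms(1) by (auto simp: graph_on_def)
    ultimately show "split_ends en s N h e \<subseteq> V" "card (split_ends en s N h e) = 2"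
      by (auto simp: split_ends_def)
  qed (use assms(1) N in \<open>auto simp: graph_on_def\<close>)
  moreover have "card (L \<union> N) = card N + card L"
    using N assms(1) by (simp add: card_Un_disjoint graph_on_def)
  ultimately show ?thesis using assms unfolding ktight_def by simp
qed

section \<open>The edges at a vertex of degree below 2k\<close>

definition star :: "'e set \<Rightarrow> ('e \<Rightarrow> 'v set) \<Rightarrow> 'v \<Rightarrow> 'e set" where
  "star E en w = {e \<in> E. w \<in> en e}"

definition far_end :: "('e \<Rightarrow> 'v set) \<Rightarrow> 'v \<Rightarrow> 'e \<Rightarrow> 'v" where
  "far_end en w d = (SOME y. y \<in> en d \<and> y \<noteq> w)"

lemma far_end:
  assumes "graph_on V E en" "d \<in> star E en w"
  shows "en d = {w, far_end en w d}" "far_end en w d \<in> V - {w}"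
proof -
  have d: "en d \<subseteq> V" "card (en d) = 2" "w \<in> en d" using assms by (auto simp: graph_on_def star_def)
  then have "\<exists>y. y \<in> en d \<and> y \<noteq> w" by (auto simp: card_2_iff)
  then have "far_end en w d \<in> en d \<and> far_end en w d \<noteq> w" unfolding far_end_def by (rule someI_ex)
  then show "en d = {w, far_end en w d}" "far_end en w d \<in> V - {w}"
    using d card2_eq[of "en d"] by auto
qed

lemma card_induced_insert:
  assumes "graph_on V E en" "B \<subseteq> V - {w}"
  shows "card (induced E en (insert w B)) =
    card (induced (E - star E en w) en B) + card {d \<in> star E en w. far_end en w d \<in> B}"
proof -
  have "induced E en (insert w B) =
      induced (E - star E en w) en B \<union> {d \<in> star E en w. far_end en w d \<in> B}"
    (is "?l = ?r")
  proof (intro set_eqI)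
    fix e show "e \<in> ?l \<longleftrightarrow> e \<in> ?r"
    proof (cases "e \<in> star E en w")
      case True
      then show ?thesis using far_end[OF assms(1) True] by (auto simp: induced_def star_def)
    next
      case False
      then show ?thesis using assms(2) by (auto simp: induced_def star_def)
    qed
  qed
  moreover have "induced (E - star E en w) en B \<inter> {d \<in> star E en w. far_end en w d \<in> B} = {}"
    by (auto simp: induced_def)
  ultimately show ?thesis
    using assms(1) by (simp add: card_Un_disjoint graph_on_def star_def)
qed

text \<open>Sparsity of \<open>V - {w}\<close> gives degree at least \<open>k\<close>, and
  \<open>card D - k\<close> new edges restore the count once \<open>w\<close> is gone. Sparsity of
  \<open>insert w B\<close>, with the half edges divided into those ending inside and outside
  \<open>B\<close>, becomes the last condition of \<open>split_state\<close>; so \<open>B\<close> is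
  co-tight exactly if \<open>insert w B\<close> is tight.\<close>

lemma vertex_split:
  assumes kt: "ktight k V E en" and w: "w \<in> V" "V \<noteq> {w}" and deg: "card (star E en w) < 2 * k"
  defines "D \<equiv> star E en w" and "s \<equiv> far_end en w"
  shows "k \<le> card D" "split_state k (V - {w}) (E - D) en D s (card D - k)"
    "\<And>B. B \<subseteq> V - {w} \<Longrightarrow> B \<noteq> {} \<Longrightarrow> \<not> tight_set k V E en (insert w B) \<Longrightarrow>
      card D - k + card (induced (E - D) en B) + k < k * card B + card {d \<in> D. s d \<notin> B}"
proof -
  have g: "graph_on V E en" and sp: "sparse k V E en" and tot: "card E + k = k * card V"
    using kt by (auto simp: ktight_def)
  have fin: "finite V" "finite E" "finite D" "D \<subseteq> E" using g by (auto simp: graph_on_def D_def star_def)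
  have V': "V - {w} \<noteq> {}" using w by auto
  define m where "m = card (V - {w})"
  have cV: "card V = Suc m" using card_Suc_Diff1[OF fin(1) w(1)] by (simp add: m_def)
  have LV: "en e \<subseteq> V - {w} \<and> card (en e) = 2" if "e \<in> E - D" for e
    using that g by (auto simp: graph_on_def D_def star_def)
  have indL: "induced (E - D) en B = induced E en B" if "B \<subseteq> V - {w}" for B
    using that by (auto simp: induced_def D_def star_def)
  have "induced (E - D) en (V - {w}) = E - D" using LV by (auto simp: induced_def)
  then have L1: "card (E - D) + k \<le> k * m"
    using sparseD[OF sp _ V'] indL[of "V - {w}"] unfolding m_def by (metis Diff_subset order_refl)
  have cE: "card E = card (E - D) + card D"
    using fin by (metis card_Diff_subset card_mono le_add_diff_inverse2)
  show kD: "k \<le> card D" using L1 cE tot unfolding cV by simp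
  have sD: "s ` D \<subseteq> V - {w}" using far_end(2)[OF g] unfolding s_def D_def by auto
  have io: "card {d \<in> D. s d \<in> B} + card {d \<in> D. s d \<notin> B} = card D" for B
  proof -
    have "{d \<in> D. s d \<in> B} \<union> {d \<in> D. s d \<notin> B} = D" by auto
    then show ?thesis using fin(3)
      by (metis (no_types, lifting) card_Un_disjoint disjoint_iff finite_Un mem_Collect_eq)
  qed
  have ins: "card (induced E en (insert w B)) = card (induced (E - D) en B) + card {d \<in> D. s d \<in> B}"
    "card (insert w B) = Suc (card B)" "insert w B \<subseteq> V" if "B \<subseteq> V - {w}" for B
  proof -
    show "card (induced E en (insert w B)) = card (induced (E - D) en B) + card {d \<in> D. s d \<in> B}"
      using card_induced_insert[OF g that] by (simp add: D_def s_def)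
    have "finite B" "w \<notin> B" using that fin(1) by (auto intro: finite_subset)
    then show "card (insert w B) = Suc (card B)" by simp
    show "insert w B \<subseteq> V" using that w by auto
  qed
  have le: "card D - k + card (induced (E - D) en B) + k \<le> k * card B + card {d \<in> D. s d \<notin> B}"
    if "B \<subseteq> V - {w}" "B \<noteq> {}" for B
    using sparseD[OF sp ins(3)[OF that(1)]] ins(1,2)[OF that(1)] io[of B] kD by simp
  show "split_state k (V - {w}) (E - D) en D s (card D - k)"
    unfolding split_state_def
  proof (intro conjI allI impI)
    show "graph_on (V - {w}) (E - D) en" using fin LV by (simp add: graph_on_def)
    show "sparse k (V - {w}) (E - D) en"
      unfolding sparse_def
    proof (intro allI impI)
      fix B assume "B \<subseteq> V - {w}" "B \<noteq> {}"
      then show "card (induced (E - D) en B) + k \<le> k * card B"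
        using sparseD[OF sp, of B] indL[of B] by auto
    qed
    show "card D - k + card (E - D) + k = k * card (V - {w})"
      using kD cE tot unfolding cV m_def[symmetric] by simp
    show "2 * (card D - k) \<le> card D" using deg unfolding D_def by simp
  qed (use V' fin sD le in auto)
  show "card D - k + card (induced (E - D) en B) + k < k * card B + card {d \<in> D. s d \<notin> B}"
    if "B \<subseteq> V - {w}" "B \<noteq> {}" "\<not> tight_set k V E en (insert w B)" for B
  proof -
    have "card (induced E en (insert w B)) + k \<noteq> k * card (insert w B)"
      using that(3) ins(3)[OF that(1)] unfolding tight_set_def by auto
    then show ?thesis
      using sparseD[OF sp ins(3)[OF that(1)]] ins(1,2)[OF that(1)] io[of B] kD by simp
  qed
qed

text \<open>The degrees sum to 2k(n - 1), less than 2kn. If all vertices except \<open>v\<close> had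
  degree at least 2k, they alone would exhaust the sum and leave degree 0 for
  \<open>v\<close>.\<close>

lemma ex_low_degree:
  assumes g: "graph_on V E en" and tot: "card E + k = k * card V" and k: "k \<ge> 1"
  shows "\<exists>w\<in>V. card (star E en w) < 2 * k"
    and "v \<in> V \<Longrightarrow> card (star E en v) > 0 \<Longrightarrow> \<exists>w\<in>V - {v}. card (star E en w) < 2 * k"
proof -
  have fin: "finite V" "finite E" using g by (auto simp: graph_on_def)
  have sum: "(\<Sum>w\<in>V. card (star E en w)) = 2 * card E"
  proof -
    have "(\<Sum>w\<in>V. card (star E en w)) = (\<Sum>w\<in>V. \<Sum>e\<in>E. if w \<in> en e then 1 else 0)"
      unfolding star_def card_eq_sum by (intro sum.cong refl sum.inter_filter fin)
    also have "\<dots> = (\<Sum>e\<in>E. \<Sum>w\<in>V. if w \<in> en e then 1 else 0)" by (rule sum.swap)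
    also have "\<dots> = (\<Sum>e\<in>E. 2)"
    proof (rule sum.cong)
      fix e assume "e \<in> E"
      then have "{w \<in> V. w \<in> en e} = en e" "card (en e) = 2" using g by (auto simp: graph_on_def)
      moreover have "(\<Sum>w\<in>V. if w \<in> en e then 1 else 0) = card {w \<in> V. w \<in> en e}"
        unfolding card_eq_sum by (rule sum.inter_filter[OF fin(1), symmetric])
      ultimately show "(\<Sum>w\<in>V. if w \<in> en e then 1 else 0) = (2::nat)" by simp
    qed simp
    finally show ?thesis by simp
  qed
  show "\<exists>w\<in>V. card (star E en w) < 2 * k"
  proof (rule ccontr)
    assume "\<not> ?thesis"
    then have "(\<Sum>w\<in>V. 2 * k) \<le> (\<Sum>w\<in>V. card (star E en w))" by (intro sum_mono) force
    then show False using sum tot k by (simp add: mult.commute)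
  qed
  show "\<exists>w\<in>V - {v}. card (star E en w) < 2 * k" if v: "v \<in> V" "card (star E en v) > 0"
  proof (rule ccontr)
    assume "\<not> ?thesis"
    then have ge: "\<And>w. w \<in> V - {v} \<Longrightarrow> 2 * k \<le> card (star E en w)" by (meson not_less)
    define S where "S = (\<Sum>w\<in>V - {v}. card (star E en w))"
    define m where "m = card (V - {v})"
    have 1: "m * (2 * k) \<le> S"
      unfolding S_def m_def using sum_bounded_below[of "V - {v}" "2 * k", OF ge] by simp
    have 2: "2 * card E = card (star E en v) + S"
      using sum.remove[OF fin(1) v(1), of "\<lambda>w. card (star E en w)"] sum unfolding S_def by simp
    have 3: "card V = Suc m" using card_Suc_Diff1[OF fin(1) v(1)] unfolding m_def by simp
    have "card E = m * k" using tot unfolding 3 by (simp add: mult.commute)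
    then show False using 1 2 v(2) by simp
  qed
qed

section \<open>Undoing a splitting\<close>

text \<open>For subsets of \<open>V\<close>, closed means being a union of components of
  \<open>F\<close>. Thus \<open>hits\<close> below says that the half edges reach every component,
  without naming components.\<close>

definition closed_under :: "'e set \<Rightarrow> ('e \<Rightarrow> 'v set) \<Rightarrow> 'v set \<Rightarrow> 'v set \<Rightarrow> bool" where
  "closed_under F en V B \<longleftrightarrow> (\<forall>e\<in>F. en e \<inter> B = {} \<or> en e \<inter> (V - B) = {})"

definition hits :: "'e set \<Rightarrow> ('e \<Rightarrow> 'v set) \<Rightarrow> 'v set \<Rightarrow> ('e \<Rightarrow> 'v) \<Rightarrow> 'e set \<Rightarrow> bool" where
  "hits F en V s D \<longleftrightarrow>
     (\<forall>B \<subseteq> V. B \<noteq> {} \<longrightarrow> closed_under F en V B \<longrightarrow> (\<exists>d\<in>D. s d \<in> B))"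

text \<open>A tree that uses the \<open>m\<close> new edges in \<open>M\<close> falls into \<open>m + 1\<close> pieces when these are
  removed; one of the \<open>2 m\<close> half edges is chosen for each piece.\<close>

lemma ex_hitting_set:
  assumes "finite M"
  shows "cut_connected (F \<union> M) en V \<Longrightarrow> s p \<in> V \<Longrightarrow>
    (\<And>e. e \<in> M \<Longrightarrow> en e = {s e, s (h e)} \<and> en e \<subseteq> V) \<Longrightarrow>
    \<exists>D \<subseteq> insert p (M \<union> h ` M). p \<in> D \<and> card D \<le> card M + 1 \<and> hits F en V s D"
  using assms
proof (induction M arbitrary: F rule: finite_induct)
  case empty
  have "hits F en V s {p}" unfolding hits_def
  proof (intro allI impI)
    fix B assume B: "B \<subseteq> V" "B \<noteq> {}" "closed_under F en V B"
    then have "B = V"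
      using empty(1) unfolding cut_connected_def closed_under_def by (metis sup_bot.right_neutral)
    then show "\<exists>d\<in>{p}. s d \<in> B" using empty(2) by auto
  qed
  then show ?case by (intro exI[of _ "{p}"]) auto
next
  case (insert e M)
  have e: "en e = {s e, s (h e)}" "s e \<in> V" "s (h e) \<in> V" using insert.prems(3)[of e] by auto
  have "\<exists>D \<subseteq> insert p (M \<union> h ` M). p \<in> D \<and> card D \<le> card M + 1 \<and> hits (insert e F) en V s D"
    by (rule insert.IH) (use insert.prems in auto)
  then obtain D where D: "D \<subseteq> insert p (M \<union> h ` M)" "p \<in> D" "card D \<le> card M + 1"
    "hits (insert e F) en V s D" by blast
  have finD: "finite D" using D(1) insert.hyps(1) by (auto intro: finite_subset)
  \<comment> \<open>A set closed under \<open>F\<close> that does not separate the ends of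
    \<open>e\<close> is closed under \<open>insert e F\<close> too, so only separating sets still
    have to be met.\<close>
  have hitD: "\<exists>d\<in>D. s d \<in> B" if "B \<subseteq> V" "B \<noteq> {}" "closed_under F en V B" "s e \<in> B \<longleftrightarrow> s (h e) \<in> B" for B
  proof -
    have "closed_under (insert e F) en V B" using that e unfolding closed_under_def by auto
    then show ?thesis using D(4) that unfolding hits_def by blast
  qed
  show ?case
  \<comment> \<open>One of \<open>e\<close> and \<open>h e\<close> is added to \<open>D\<close>. If
    \<open>D\<close> meets every closed set that contains \<open>s e\<close> but not
    \<open>s (h e)\<close>, then \<open>h e\<close> is enough; otherwise a missed set
    \<open>C\<close> shows that \<open>e\<close> is.\<close>
  proof (cases "\<exists>B \<subseteq> V. closed_under F en V B \<and> s e \<in> B \<and> s (h e) \<notin> B \<and> (\<forall>d\<in>D. s d \<notin> B)")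
    case False
    have "hits F en V s (insert (h e) D)"
      unfolding hits_def using hitD False by (metis insertCI)
    moreover have "card (insert (h e) D) \<le> card (insert e M) + 1"
      using D(3) finD insert.hyps by (auto simp: card_insert_if)
    ultimately show ?thesis using D(1,2) by (intro exI[of _ "insert (h e) D"]) auto
  next
    case True
    then obtain C where C: "C \<subseteq> V" "closed_under F en V C" "s e \<in> C" "s (h e) \<notin> C"
      "\<forall>d\<in>D. s d \<notin> C" by blast
    have "hits F en V s (insert e D)" unfolding hits_def
    proof (intro allI impI)
      fix B assume B: "B \<subseteq> V" "B \<noteq> {}" "closed_under F en V B"
      consider "s e \<in> B" | "s e \<notin> B" "s (h e) \<notin> B" | "s e \<notin> B" "s (h e) \<in> B" by blast
      then show "\<exists>d\<in>insert e D. s d \<in> B"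
      proof cases
        case 3
        \<comment> \<open>\<open>B \<union> C\<close> no longer separates the ends of
          \<open>e\<close>, so \<open>D\<close> meets it; as \<open>D\<close> misses
          \<open>C\<close>, it meets \<open>B\<close>.\<close>
        have "closed_under F en V (B \<union> C)" using B(3) C(2) unfolding closed_under_def by blast
        then have "\<exists>d\<in>D. s d \<in> B \<union> C" using 3 C B(1) by (intro hitD) auto
        then show ?thesis using C(5) by blast
      qed (use hitD[OF B] in auto)
    qed
    moreover have "card (insert e D) \<le> card (insert e M) + 1"
      using D(3) finD insert.hyps by (auto simp: card_insert_if)
    ultimately show ?thesis using D(1,2) by (intro exI[of _ "insert e D"]) auto
  qed
qed

text \<open>A set that is not closed under \<open>F\<close> is crossed by an edge of
  \<open>F\<close>; a closed one contains the far end of some half edge, which leaves it towards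
  \<open>w\<close>. Sets containing \<open>w\<close> are replaced by their complements.\<close>

lemma cut_connected_insert:
  assumes "hits F en V s D" "w \<notin> V" "F \<union> D \<subseteq> E"
    and "\<And>e. e \<in> F \<Longrightarrow> en e \<subseteq> V" "\<And>d. d \<in> D \<Longrightarrow> en d = {w, s d}"
  shows "cut_connected E en (insert w V)"
proof -
  have key: "\<exists>e\<in>E. en e \<inter> B \<noteq> {} \<and> en e \<inter> (insert w V - B) \<noteq> {}" if B: "B \<subseteq> V" "B \<noteq> {}" for B
  proof (cases "closed_under F en V B")
    case True
    then obtain d where d: "d \<in> D" "s d \<in> B" using assms(1) B unfolding hits_def by blast
    then show ?thesis using assms(2,3) assms(5)[of d] B by (intro bexI[of _ d]) auto
  next
    case False
    then obtain e where "e \<in> F" "en e \<inter> B \<noteq> {}" "en e \<inter> (V - B) \<noteq> {}"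
      unfolding closed_under_def by blast
    then show ?thesis using assms(3) by (intro bexI[of _ e]) auto
  qed
  show ?thesis unfolding cut_connected_def
  proof (intro allI impI)
    fix B assume B: "B \<subseteq> insert w V" "B \<noteq> {}" "B \<noteq> insert w V"
    show "\<exists>e\<in>E. en e \<inter> B \<noteq> {} \<and> en e \<inter> (insert w V - B) \<noteq> {}"
    proof (cases "w \<in> B")
      case True
      have "insert w V - (insert w V - B) = B" using B by auto
      then show ?thesis using key[of "insert w V - B"] True B by fastforce
    next
      case False
      then show ?thesis using key[of B] B by blast
    qed
  qed
qed

text \<open>The half edges that make up the new edges of colour \<open>i\<close>. Colours draw on
  their own half edges first, which keeps the sets chosen for different colours apart.\<close>

definition natives :: "'e set \<Rightarrow> ('e \<Rightarrow> 'e) \<Rightarrow> ('e \<Rightarrow> nat) \<Rightarrow> nat \<Rightarrow> 'e set" where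
  "natives N h c i = {e \<in> N. c e = i} \<union> h ` {e \<in> N. c e = i}"

lemma natives_subset: "split_pairs D s N h \<Longrightarrow> natives N h c i \<subseteq> D"
  unfolding natives_def split_pairs_def by auto

lemma natives_disjoint: "split_pairs D s N h \<Longrightarrow> i \<noteq> j \<Longrightarrow> natives N h c i \<inter> natives N h c j = {}"
  unfolding natives_def split_pairs_def inj_on_def by blast

text \<open>The half edge \<open>p\<close> is arbitrary, and besides \<open>p\<close> the colour
  \<open>i\<close> draws only on its own half edges. This freedom allows a half edge to be moved to
  a colour of choice.\<close>

lemma ex_class_hitting_set:
  assumes "finite D" "D \<inter> L = {}" "s ` D \<subseteq> V" "split_pairs D s N h"
    and "packing k V (L \<union> N) (split_ends en s N h) c" and "i < k" "p \<in> D"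
  shows "\<exists>D' \<subseteq> insert p (natives N h c i). p \<in> D' \<and> card D' \<le> card {e \<in> N. c e = i} + 1 \<and>
      hits {e \<in> L. c e = i} en V s D'"
proof -
  let ?en = "split_ends en s N h" and ?M = "{e \<in> N. c e = i}"
  have ND: "N \<subseteq> D" "h ` N \<subseteq> D" using assms(4) by (auto simp: split_pairs_def)
  have enL: "?en e = en e" if "e \<in> L" for e using that ND(1) assms(2) by (auto simp: split_ends_def)
  have "{e \<in> L \<union> N. c e = i} = {e \<in> L. c e = i} \<union> ?M" by auto
  then have "cut_connected ({e \<in> L. c e = i} \<union> ?M) ?en V"
    using assms(5,6) unfolding packing_def by auto
  then have "\<exists>D' \<subseteq> insert p (?M \<union> h ` ?M). p \<in> D' \<and> card D' \<le> card ?M + 1 \<and>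
      hits {e \<in> L. c e = i} ?en V s D'"
  proof (rule ex_hitting_set[rotated])
    show "finite ?M" using finite_subset[OF ND(1) assms(1)] by simp
    show "s p \<in> V" using assms(3,7) by auto
    fix e assume "e \<in> ?M"
    then have "e \<in> N" "e \<in> D" "h e \<in> D" using ND by auto
    then show "?en e = {s e, s (h e)} \<and> ?en e \<subseteq> V" using assms(3) by (auto simp: split_ends_def)
  qed
  moreover have "hits {e \<in> L. c e = i} ?en V s D' = hits {e \<in> L. c e = i} en V s D'" for D'
    unfolding hits_def closed_under_def using enL by simp
  ultimately show ?thesis unfolding natives_def by simp
qed

text \<open>Colours outside \<open>J\<close> that are not used by any new edge receive a half edge left over by the
  other colours. There are enough of these since the colour \<open>i\<close> needs at most \<open>m i + 1\<close> half
  edges where \<open>m i\<close> is the number of new edges of colour \<open>i\<close>.\<close>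

lemma lift_packing_aux:
  fixes c :: "'e \<Rightarrow> nat"
  assumes w: "w \<notin> V" and L: "\<And>e. e \<in> L \<Longrightarrow> en e \<subseteq> V"
    and D: "finite D" "D \<inter> L = {}" "s ` D \<subseteq> V" "\<And>d. d \<in> D \<Longrightarrow> en d = {w, s d}"
    and N: "split_pairs D s N h"
    and c: "packing k V (L \<union> N) (split_ends en s N h) c"
    and cD: "k + card N \<le> card D" and k: "k \<ge> 1"
    and J: "J \<subseteq> {..<k}"
    and DJ: "\<And>i. i \<in> J \<Longrightarrow> DJ i \<subseteq> D \<and> card (DJ i) \<le> card {e \<in> N. c e = i} + 1 \<and>
        hits {e \<in> L. c e = i} en V s (DJ i)"
    and DJdis: "\<And>i j. i \<in> J \<Longrightarrow> j \<in> J \<Longrightarrow> i \<noteq> j \<Longrightarrow> DJ i \<inter> DJ j = {}"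
    and DJM: "\<And>i j. i \<in> J \<Longrightarrow> j \<notin> J \<Longrightarrow> DJ i \<inter> natives N h c j = {}"
  shows "\<exists>c'. packing k (insert w V) (L \<union> D) en c' \<and> (\<forall>e\<in>L. c' e = c e) \<and>
    (\<forall>i\<in>J. \<forall>e\<in>DJ i. c' e = i)"
proof -
  define M where "M i = {e \<in> N. c e = i}" for i
  have ND: "N \<subseteq> D" "h ` N \<subseteq> D" "inj_on h N" "N \<inter> h ` N = {}"
    using N by (auto simp: split_pairs_def)
  have finN: "finite N" using ND(1) D(1) finite_subset by blast
  note NatD = natives_subset[OF N, of c]
  note Natdis = natives_disjoint[OF N, of _ _ c]
  have ck: "\<And>e. e \<in> L \<union> N \<Longrightarrow> c e < k" using c by (auto simp: packing_def)
  note hit = ex_class_hitting_set[OF D(1-3) N c, folded M_def]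
  \<comment> \<open>The colours below \<open>k\<close> outside \<open>I\<close> contain no new edge,
    so their classes already span \<open>V\<close> and any single half edge is enough for
    each.\<close>
  define I where "I = J \<union> {i. i < k \<and> M i \<noteq> {}}"
  define good where "good i D' \<longleftrightarrow> D' \<subseteq> natives N h c i \<and> card D' \<le> card (M i) + 1 \<and>
      hits {e \<in> L. c e = i} en V s D'" for i D'
  define D2 where "D2 i = (SOME D'. good i D')" for i
  have D2: "good i (D2 i)" if i: "i \<in> I - J" for i
  proof -
    \<comment> \<open>With \<open>p\<close> taken from the half edges of colour \<open>i\<close>,
      the chosen set contains no foreign half edge.\<close>
    obtain p where p: "p \<in> M i" "i < k" using i by (auto simp: I_def)
    then have pN: "p \<in> natives N h c i" "p \<in> D" using ND(1) by (auto simp: natives_def M_def)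
    then have "\<exists>D'. good i D'"
      using hit[OF p(2) pN(2)] unfolding good_def insert_absorb[OF pN(1)] by blast
    then show ?thesis unfolding D2_def by (rule someI_ex)
  qed
  define D3 where "D3 i = (if i \<in> J then DJ i else D2 i)" for i
  have D3: "D3 i \<subseteq> D" "card (D3 i) \<le> card (M i) + 1" "hits {e \<in> L. c e = i} en V s (D3 i)"
    if "i \<in> I" for i
  proof -
    have "D3 i \<subseteq> D \<and> card (D3 i) \<le> card (M i) + 1 \<and> hits {e \<in> L. c e = i} en V s (D3 i)"
    proof (cases "i \<in> J")
      case True then show ?thesis using DJ[OF True] by (simp add: D3_def M_def)
    next
      case False
      then show ?thesis using D2[of i] that NatD[of i] by (auto simp: D3_def good_def)
    qed
    then show "D3 i \<subseteq> D" "card (D3 i) \<le> card (M i) + 1" "hits {e \<in> L. c e = i} en V s (D3 i)"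
      by auto
  qed
  have D3dis: "D3 i \<inter> D3 j = {}" if ij: "i \<in> I" "j \<in> I" "i \<noteq> j" for i j
  proof -
    have D2N: "D3 l \<subseteq> natives N h c l" if "l \<in> I" "l \<notin> J" for l using D2[of l] that by (simp add: D3_def good_def)
    consider "i \<in> J" "j \<in> J" | "i \<in> J" "j \<notin> J" | "i \<notin> J" "j \<in> J" | "i \<notin> J" "j \<notin> J" by blast
    then show ?thesis
    proof cases
      case 1 then show ?thesis using DJdis ij by (simp add: D3_def)
    next
      case 2 then show ?thesis using DJM[OF 2] D2N[of j] ij unfolding natives_def by (auto simp: D3_def)
    next
      case 3 then show ?thesis using DJM[OF 3(2,1)] D2N[of i] ij unfolding natives_def by (auto simp: D3_def)
    next
      case 4 then show ?thesis using D2N[of i] D2N[of j] Natdis[of i j] ij by blast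
    qed
  qed
  have Ik: "I \<subseteq> {..<k}" "finite I" using J finite_subset[OF J] by (auto simp: I_def)
  define U where "U = (\<Union>i\<in>I. D3 i)"
  define Z where "Z = {..<k} - I"
  have UD: "U \<subseteq> D" using D3(1) by (auto simp: U_def)
  have "card U \<le> (\<Sum>i\<in>I. card (D3 i))" unfolding U_def by (rule card_UN_le[OF Ik(2)])
  also have "\<dots> \<le> (\<Sum>i\<in>I. card (M i) + 1)" by (rule sum_mono) (use D3(2) in blast)
  also have "\<dots> = (\<Sum>i\<in>I. card (M i)) + card I"
    by (subst sum.distrib) simp
  also have "(\<Sum>i\<in>I. card (M i)) = card (\<Union>i\<in>I. M i)"
    by (rule card_UN_disjoint[symmetric]) (use Ik finN in \<open>auto simp: M_def\<close>)
  also have "\<dots> \<le> card N" by (rule card_mono) (use finN in \<open>auto simp: M_def\<close>)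
  finally have "card U \<le> card N + card I" by simp
  moreover have "card Z = k - card I" unfolding Z_def using Ik by (simp add: card_Diff_subset)
  moreover have "card I \<le> k" using card_mono[OF _ Ik(1)] by simp
  moreover have "card (D - U) = card D - card U"
    using UD D(1) by (simp add: card_Diff_subset finite_subset)
  ultimately have "card Z \<le> card (D - U)" using cD by simp
  then obtain g where g: "g ` Z \<subseteq> D - U" "inj_on g Z"
    using card_le_inj[of Z "D - U"] D(1) by (auto simp: Z_def)
  define D4 where "D4 i = (if i \<in> I then D3 i else {g i})" for i
  have D4D: "D4 i \<subseteq> D" if "i < k" for i using that D3(1) g by (auto simp: D4_def Z_def)
  have gi: "g i \<in> D - U" if "i < k" "i \<notin> I" for i using that g(1) by (auto simp: Z_def)
  have D4dis: "D4 i \<inter> D4 j = {}" if "i < k" "j < k" "i \<noteq> j" for i j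
  proof -
    have "g i \<noteq> g j" if "i \<notin> I" "j \<notin> I"
      using that \<open>i < k\<close> \<open>j < k\<close> \<open>i \<noteq> j\<close> g(2) by (auto simp: Z_def inj_on_def)
    then show ?thesis using that D3dis[of i j] gi[of i] gi[of j] unfolding D4_def U_def by auto
  qed
  have D4hit: "hits {e \<in> L. c e = i} en V s (D4 i)" if ik: "i < k" for i
  proof (cases "i \<in> I")
    case True then show ?thesis using D3(3) by (simp add: D4_def)
  next
    case False
    then have "natives N h c i = {}" using that by (auto simp: I_def natives_def M_def)
    then obtain D' where "D' \<subseteq> {g i}" "g i \<in> D'" "hits {e \<in> L. c e = i} en V s D'"
      using hit[OF ik, of "g i"] gi[OF ik False] by auto
    then have "D' = {g i}" "hits {e \<in> L. c e = i} en V s D'" by auto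
    then show ?thesis using False by (simp add: D4_def)
  qed
  \<comment> \<open>Half edges that no colour needs get colour 0: an additional edge cannot harm
    connectivity, and \<open>k \<ge> 1\<close> makes 0 a legal colour.\<close>
  define c' where "c' e = (if e \<in> D then (if \<exists>i<k. e \<in> D4 i then THE i. i < k \<and> e \<in> D4 i else 0) else c e)" for e
  have c'D4: "c' e = i" if "i < k" "e \<in> D4 i" for i e
  proof -
    have "(THE i. i < k \<and> e \<in> D4 i) = i"
      by (rule the_equality) (use that D4dis in blast)+
    then show ?thesis using that D4D unfolding c'_def by auto
  qed
  have c'L: "c' e = c e" if "e \<in> L" for e using that D(2) by (auto simp: c'_def)
  have "c' e < k" if "e \<in> L \<union> D" for e
  proof (cases "e \<in> D \<and> (\<exists>i<k. e \<in> D4 i)")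
    case True then show ?thesis using c'D4 by auto
  next
    case False then show ?thesis using that ck k c'L by (auto simp: c'_def)
  qed
  moreover have "cut_connected {e \<in> L \<union> D. c' e = i} en (insert w V)" if ik: "i < k" for i
  proof (rule cut_connected_insert[OF D4hit[OF ik] w])
    show "{e \<in> L. c e = i} \<union> D4 i \<subseteq> {e \<in> L \<union> D. c' e = i}"
      using D4D[OF ik] c'L c'D4[OF ik] by auto
    show "en d = {w, s d}" if "d \<in> D4 i" for d using D4D[OF ik] that D(4) by blast
  qed (use L in auto)
  ultimately have "packing k (insert w V) (L \<union> D) en c'" unfolding packing_def by blast
  moreover have "c' e = i" if "i \<in> J" "e \<in> DJ i" for i e
    using that J by (intro c'D4) (auto simp: D4_def I_def D3_def)
  ultimately show ?thesis using c'L by blast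
qed

text \<open>Such a half edge is unpaired or comes from a new edge of colour 0 or 1, so giving it to
  one of these two colours takes nothing from any other.\<close>

definition usable :: "'e set \<Rightarrow> ('e \<Rightarrow> 'e) \<Rightarrow> ('e \<Rightarrow> nat) \<Rightarrow> 'e \<Rightarrow> bool" where
  "usable N h c p \<longleftrightarrow> (\<forall>e\<in>N. p = e \<or> p = h e \<longrightarrow> c e < 2)"

text \<open>\<open>p\<close> is forced into the set of one low colour. If that set happens to
  contain \<open>q\<close>, both are settled; otherwise \<open>q\<close> is forced into the set of
  the other low colour, which works even if \<open>q\<close> stems from the first.\<close>

lemma lift_packing:
  fixes c :: "'e \<Rightarrow> nat"
  assumes w: "w \<notin> V" and L: "\<And>e. e \<in> L \<Longrightarrow> en e \<subseteq> V"
    and D: "finite D" "D \<inter> L = {}" "s ` D \<subseteq> V" "\<And>d. d \<in> D \<Longrightarrow> en d = {w, s d}"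
    and N: "split_pairs D s N h"
    and c: "packing k V (L \<union> N) (split_ends en s N h) c"
    and cD: "k + card N \<le> card D" and k: "k \<ge> 2"
    and pq: "p \<in> D" "q \<in> D" "usable N h c p" "usable N h c q"
  shows "\<exists>c'. packing k (insert w V) (L \<union> D) en c' \<and> (\<forall>e\<in>L. c' e = c e) \<and> c' p < 2 \<and> c' q < 2"
proof -
  define M where "M i = {e \<in> N. c e = i}" for i
  note NatD = natives_subset[OF N, of c]
  note Natdis = natives_disjoint[OF N, of _ _ c]
  note hit = ex_class_hitting_set[OF D(1-3) N c, folded M_def]
  have us: "x \<notin> natives N h c i" if "usable N h c x" "i \<ge> 2" for x i
    using that unfolding usable_def natives_def M_def by auto
  \<comment> \<open>The own colour of \<open>p\<close> if that is 1, otherwise 0; the latter suits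
    half edges of colour 0 and unpaired ones alike.\<close>
  define cp :: nat where "cp = (if p \<in> natives N h c 1 then 1 else 0)"
  define oc where "oc = 1 - cp"
  have col: "cp < 2" "oc < 2" "cp < k" "oc < k" "cp \<noteq> oc" "\<And>i. i \<noteq> cp \<Longrightarrow> i \<noteq> oc \<Longrightarrow> i \<ge> 2"
    using k by (auto simp: cp_def oc_def split: if_splits)
  have pcp: "p \<notin> natives N h c i" if i: "i \<noteq> cp" for i
  proof
    assume pi: "p \<in> natives N h c i"
    then have i2: "i < 2" using us[OF pq(3), of i] by (meson not_less)
    show False
    proof (cases "p \<in> natives N h c 1")
      case True
      then have "i \<noteq> 1" using i unfolding cp_def by simp
      then show False using Natdis[of i 1] pi True by blast
    next
      case False
      then have "i \<noteq> 0" using i unfolding cp_def by simp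
      then have "i = 1" using i2 by simp
      then show False using pi False by simp
    qed
  qed
  note aux = lift_packing_aux[OF w L D N c cD]
  obtain Dp where Dp: "Dp \<subseteq> insert p (natives N h c cp)" "p \<in> Dp" "card Dp \<le> card (M cp) + 1"
    "hits {e \<in> L. c e = cp} en V s Dp" using hit[OF col(3) pq(1)] by blast
  have DpD: "Dp \<subseteq> D" using Dp(1) NatD pq by blast
  have DpN: "Dp \<inter> natives N h c j = {}" if "j \<noteq> cp" for j using Dp(1) pcp[OF that] Natdis[of cp j] that by blast
  show ?thesis
  proof (cases "q \<in> Dp")
    case True
    have "\<exists>c'. packing k (insert w V) (L \<union> D) en c' \<and> (\<forall>e\<in>L. c' e = c e) \<and>
        (\<forall>i\<in>{cp}. \<forall>e\<in>Dp. c' e = i)"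
      by (rule aux) (use k col Dp DpD DpN in \<open>auto simp: M_def\<close>)
    then show ?thesis using col Dp(2) True by auto
  next
    case False
    obtain Dq where Dq: "Dq \<subseteq> insert q (natives N h c oc)" "q \<in> Dq" "card Dq \<le> card (M oc) + 1"
      "hits {e \<in> L. c e = oc} en V s Dq" using hit[OF col(4) pq(2)] by blast
    have DqD: "Dq \<subseteq> D" using Dq(1) NatD pq by blast
    have DqN: "Dq \<inter> natives N h c j = {}" if "j \<noteq> cp" "j \<noteq> oc" for j
      using Dq(1) us[OF pq(4) col(6)[OF that]] Natdis[of oc j] that by blast
    have dis: "Dp \<inter> Dq = {}" using Dq(1) False DpN[of oc] col(5) by auto
    let ?DJ = "\<lambda>i. if i = cp then Dp else Dq"
    have "\<exists>c'. packing k (insert w V) (L \<union> D) en c' \<and> (\<forall>e\<in>L. c' e = c e) \<and>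
        (\<forall>i\<in>{cp, oc}. \<forall>e\<in>?DJ i. c' e = i)"
    proof (rule aux)
      show "\<And>i j. i \<in> {cp, oc} \<Longrightarrow> j \<notin> {cp, oc} \<Longrightarrow>
           ?DJ i \<inter> natives N h c j = {}"
        using DpN DqN by (simp split: if_splits)
    qed (use k col Dp DpD Dq DqD dis in \<open>auto simp: M_def\<close>)
    then show ?thesis using col Dp(2) Dq(2) by auto
  qed
qed

section \<open>Decomposition into spanning trees and contraction\<close>

lemma split_off_ktight:
  assumes kt: "ktight k V E en" and w: "w \<in> V" "V \<noteq> {w}" and deg: "card (star E en w) < 2 * k"
    and N: "split_pairs (star E en w) (far_end en w) N h" "card N + k = card (star E en w)"
      "sparse k (V - {w}) (E - star E en w \<union> N) (split_ends en (far_end en w) N h)"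
  shows "ktight k (V - {w}) (E - star E en w \<union> N) (split_ends en (far_end en w) N h)"
proof (rule split_ktight[OF _ _ _ _ _ N(1) _ N(3)])
  note vs = vertex_split(2)[OF kt w deg]
  show "graph_on (V - {w}) (E - star E en w) en" "V - {w} \<noteq> {}" "finite (star E en w)"
    "star E en w \<inter> (E - star E en w) = {}" "far_end en w ` star E en w \<subseteq> V - {w}"
    "card N + card (E - star E en w) + k = k * card (V - {w})"
    using vs N(2) unfolding split_state_def by auto
qed

lemma lift_off:
  assumes kt: "ktight k V E en" and w: "w \<in> V" "V \<noteq> {w}"
    and N: "split_pairs (star E en w) (far_end en w) N h" "card N + k = card (star E en w)"
    and c: "packing k (V - {w}) (E - star E en w \<union> N) (split_ends en (far_end en w) N h) c"
    and k: "k \<ge> 2"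
  shows "\<exists>c'. packing k V E en c' \<and> (\<forall>e \<in> E - star E en w. c' e = c e)"
    and "p \<in> star E en w \<Longrightarrow> q \<in> star E en w \<Longrightarrow> usable N h c p \<Longrightarrow> usable N h c q \<Longrightarrow>
      \<exists>c'. packing k V E en c' \<and> (\<forall>e \<in> E - star E en w. c' e = c e) \<and> c' p < 2 \<and> c' q < 2"
proof -
  have g: "graph_on V E en" using kt by (simp add: ktight_def)
  have VE: "insert w (V - {w}) = V" "E - star E en w \<union> star E en w = E"
    using w by (auto simp: star_def)
  have L: "\<And>e. e \<in> E - star E en w \<Longrightarrow> en e \<subseteq> V - {w}" using g by (auto simp: graph_on_def star_def)
  have D: "finite (star E en w)" "star E en w \<inter> (E - star E en w) = {}"
    "far_end en w ` star E en w \<subseteq> V - {w}" using g far_end(2)[OF g] by (auto simp: graph_on_def star_def)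
  have D4: "\<And>d. d \<in> star E en w \<Longrightarrow> en d = {w, far_end en w d}" using far_end(1)[OF g] .
  have cD: "k + card N \<le> card (star E en w)" using N(2) by simp
  have "\<exists>c'. packing k (insert w (V - {w})) (E - star E en w \<union> star E en w) en c' \<and>
      (\<forall>e \<in> E - star E en w. c' e = c e) \<and> (\<forall>i\<in>{}. \<forall>e\<in>{}. c' e = i)"
    by (rule lift_packing_aux[OF _ L D D4 N(1) c cD]) (use k in auto)
  then show "\<exists>c'. packing k V E en c' \<and> (\<forall>e \<in> E - star E en w. c' e = c e)" unfolding VE by blast
  show "\<exists>c'. packing k V E en c' \<and> (\<forall>e \<in> E - star E en w. c' e = c e) \<and> c' p < 2 \<and> c' q < 2"
    if "p \<in> star E en w" "q \<in> star E en w" "usable N h c p" "usable N h c q"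
    using lift_packing[OF _ L D D4 N(1) c cD k that] unfolding VE by blast
qed

text \<open>No pair of half edges is prescribed here, so the splitting induction runs without
  contracting tight sets first.\<close>

lemma nash_williams:
  assumes "ktight k V E en" "k \<ge> 2"
  shows "\<exists>c. packing k V E en c"
  using assms
proof (induction "card V" arbitrary: V E en rule: less_induct)
  case less
  have g: "graph_on V E en" and tot: "card E + k = k * card V"
    using less.prems by (auto simp: ktight_def)
  obtain w where w: "w \<in> V" "card (star E en w) < 2 * k"
    using ex_low_degree(1)[OF g tot] less.prems(2) by auto
  show ?case
  proof (cases "V = {w}")
    case True
    have "E = {}"
    proof (rule ccontr)
      assume "E \<noteq> {}"
      then obtain e where "e \<in> E" by blast
      then have "en e \<subseteq> {w}" "card (en e) = 2" using g True by (auto simp: graph_on_def)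
      then show False using card_mono[of "{w}" "en e"] by simp
    qed
    then have "packing k V E en (\<lambda>_. 0)"
      using True by (auto simp: packing_def cut_connected_def subset_singleton_iff)
    then show ?thesis by blast
  next
    case False
    let ?D = "star E en w" and ?s = "far_end en w"
    note vs = vertex_split[OF less.prems(1) w(1) False w(2)]
    obtain N h where N: "split_pairs ?D ?s N h" "card N = card ?D - k"
      "sparse k (V - {w}) (E - ?D \<union> N) (split_ends en ?s N h)"
      using split_complete[OF vs(2)] by blast
    have cN: "card N + k = card ?D" using N(2) vs(1) by simp
    have kt: "ktight k (V - {w}) (E - ?D \<union> N) (split_ends en ?s N h)"
      by (rule split_off_ktight[OF less.prems(1) w(1) False w(2) N(1) cN N(3)])
    have "finite V" using g by (simp add: graph_on_def)
    then have "card (V - {w}) < card V" using w(1) by (rule card_Diff1_less)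
    then obtain c where "packing k (V - {w}) (E - ?D \<union> N) (split_ends en ?s N h) c"
      using less.hyps[OF _ kt less.prems(2)] by blast
    then show ?thesis using lift_off(1)[OF less.prems(1) w(1) False N(1) cN _ less.prems(2)] by blast
  qed
qed

definition interchange :: "nat \<Rightarrow> nat \<Rightarrow> nat \<Rightarrow> nat" where
  "interchange i j x = (if x = i then j else if x = j then i else x)"

lemma packing_interchange:
  assumes "packing k V E en c" "i < k" "j < k"
  shows "packing k V E en (\<lambda>e. interchange i j (c e))"
proof -
  have "{e \<in> E. interchange i j (c e) = l} = {e \<in> E. c e = interchange i j l}" for l
    by (auto simp: interchange_def)
  moreover have "interchange i j l < k" if "l < k" for l using that assms by (auto simp: interchange_def)
  ultimately show ?thesis using assms(1) unfolding packing_def by auto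
qed

lemma packing_recolour:
  assumes c: "packing k V E en c" and fg: "f \<in> E" "g \<in> E" and k: "k \<ge> 2"
  shows "\<exists>c'. packing k V E en c' \<and> c' f < 2 \<and> c' g < 2"
proof -
  define c1 where "c1 e = interchange (c f) 0 (c e)" for e
  \<comment> \<open>\<open>f\<close> has colour 0 by now. The second exchange is skipped if
    \<open>g\<close> shares that colour; otherwise it concerns nonzero colours only and leaves
    \<open>f\<close> alone.\<close>
  define c2 where "c2 e = (if c1 g = 0 then c1 e else interchange (c1 g) 1 (c1 e))" for e
  have "c f < k" using c fg by (auto simp: packing_def)
  then have c1: "packing k V E en c1" unfolding c1_def using packing_interchange[OF c] k by auto
  then have "c1 g < k" using fg by (auto simp: packing_def)
  then have "packing k V E en c2"
    using packing_interchange[OF c1, of "c1 g" 1] c1 k unfolding c2_def by (cases "c1 g = 0") auto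
  moreover have "c2 f < 2" "c2 g < 2" by (auto simp: c2_def c1_def interchange_def)
  ultimately show ?thesis by blast
qed

section \<open>Contraction of a tight set\<close>

text \<open>The contracted set is represented by one of its members \<open>z\<close>, so the vertex
  type stays the same; edges keep their names. Edges inside \<open>A\<close> would become loops and
  are removed from the edge set wherever this is used.\<close>

definition contract_ends :: "('e \<Rightarrow> 'v set) \<Rightarrow> 'v set \<Rightarrow> 'v \<Rightarrow> 'e \<Rightarrow> 'v set" where
  "contract_ends en A z e = (\<lambda>x. if x \<in> A then z else x) ` en e"

lemma induced_ktight:
  assumes "ktight k V E en" "tight_set k V E en A"
  shows "ktight k A (induced E en A) en"
proof -
  have A: "A \<subseteq> V" "A \<noteq> {}" "card (induced E en A) + k = k * card A"
    using assms(2) by (auto simp: tight_set_def)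
  have ii: "induced (induced E en A) en B = induced E en B" if "B \<subseteq> A" for B
    using that by (auto simp: induced_def)
  have sp: "sparse k V E en" using assms(1) by (simp add: ktight_def)
  have "sparse k A (induced E en A) en" unfolding sparse_def
  proof (intro allI impI)
    fix B assume "B \<subseteq> A" "B \<noteq> {}"
    then show "card (induced (induced E en A) en B) + k \<le> k * card B"
      using sparseD[OF sp, of B] ii[of B] A(1) by simp
  qed
  moreover have "graph_on A (induced E en A) en"
    using assms(1) finite_subset[OF A(1)] unfolding ktight_def graph_on_def induced_def by simp
  ultimately show ?thesis using A by (simp add: ktight_def)
qed

text \<open>For \<open>z \<in> B\<close>, subtract the exact edge count of \<open>A\<close> from the
  bound for \<open>B \<union> A\<close>, which has \<open>card B + card A - 1\<close> vertices. If
  \<open>z\<close> is not in \<open>B\<close>, the edges inside \<open>B\<close> are original edges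
  inside \<open>B\<close>.\<close>

lemma contract_ktight:
  assumes kt: "ktight k V E en" and A: "tight_set k V E en A" and z: "z \<in> A"
  shows "ktight k (insert z (V - A)) (E - induced E en A) (contract_ends en A z)"
proof -
  let ?E = "E - induced E en A" and ?en = "contract_ends en A z"
  have fin: "finite V" "finite E" "finite A" and AV: "A \<subseteq> V" "A \<noteq> {}"
    and cA: "card (induced E en A) + k = k * card A"
    and g: "\<And>e. e \<in> E \<Longrightarrow> en e \<subseteq> V \<and> card (en e) = 2" and sp: "sparse k V E en"
    and tot: "card E + k = k * card V"
    using kt A unfolding ktight_def graph_on_def tight_set_def by (blast intro: finite_subset)+
  have cd: "card (induced E en A) \<le> card E" by (rule card_mono) (use fin in \<open>auto simp: induced_def\<close>)
  have cE: "card ?E = card E - card (induced E en A)"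
    using fin by (intro card_Diff_subset) (auto simp: induced_def)
  have cV: "card V = card (V - A) + card A"
    using fin AV by (metis card_Diff_subset card_mono le_add_diff_inverse2)
  have "graph_on (insert z (V - A)) ?E ?en" unfolding graph_on_def
  proof (intro conjI ballI)
    fix e assume e: "e \<in> ?E"
    then obtain x y where xy: "en e = {x, y}" "x \<noteq> y" using g[of e] by (auto simp: card_2_iff)
    then have "x \<notin> A \<or> y \<notin> A" "x \<in> V" "y \<in> V" using e g[of e] by (auto simp: induced_def)
    moreover have "?en e = {if x \<in> A then z else x, if y \<in> A then z else y}"
      unfolding contract_ends_def xy(1) by (simp only: image_insert image_empty)
    moreover have "(if x \<in> A then z else x) \<noteq> (if y \<in> A then z else y)"
      using calculation(1) xy(2) z by auto
    ultimately show "?en e \<subseteq> insert z (V - A)" "card (?en e) = 2" by auto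
  qed (use fin in auto)
  moreover have "sparse k (insert z (V - A)) ?E ?en" unfolding sparse_def
  proof (intro allI impI)
    fix B assume B: "B \<subseteq> insert z (V - A)" "B \<noteq> {}"
    show "card (induced ?E ?en B) + k \<le> k * card B"
    proof (cases "z \<in> B")
      case False
      have "induced ?E ?en B \<subseteq> induced E en B"
      proof
        fix e assume "e \<in> induced ?E ?en B"
        then have "e \<in> E" "?en e \<subseteq> B" by (auto simp: induced_def)
        then show "e \<in> induced E en B" using False by (force simp: induced_def contract_ends_def)
      qed
      then have "card (induced ?E ?en B) \<le> card (induced E en B)" using fin by (intro card_mono) auto
      moreover have "B \<subseteq> V" using B(1) AV z by blast
      ultimately show ?thesis using sparseD[OF sp, of B] B(2) by linarith
    next
      case True
      have sub: "induced ?E ?en B \<subseteq> induced E en (B \<union> A) - induced E en A"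
      proof
        fix e assume "e \<in> induced ?E ?en B"
        then have "e \<in> E" "e \<notin> induced E en A" "?en e \<subseteq> B" by (auto simp: induced_def)
        then show "e \<in> induced E en (B \<union> A) - induced E en A"
          by (force simp: induced_def contract_ends_def)
      qed
      have "card (induced ?E ?en B) \<le> card (induced E en (B \<union> A) - induced E en A)"
        using fin sub by (intro card_mono) auto
      also have "\<dots> = card (induced E en (B \<union> A)) - card (induced E en A)"
        using fin by (intro card_Diff_subset) (auto simp: induced_def)
      finally have 1: "card (induced ?E ?en B) \<le> card (induced E en (B \<union> A)) - card (induced E en A)" .
      have 2: "card (induced E en A) \<le> card (induced E en (B \<union> A))"
        using fin by (intro card_mono) (auto simp: induced_def)
      have 3: "card (induced E en (B \<union> A)) + k \<le> k * card (B \<union> A)"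
        by (rule sparseD[OF sp]) (use B AV z in auto)
      have finB: "finite B" using B(1) fin(1) by (meson finite_Diff finite_insert finite_subset)
      have "B \<inter> A = {z}" using B True z by auto
      then have "k * card B + k * card A = k * card (B \<union> A) + k"
        using mult_card_Un_Int[OF finB fin(3), of k] by simp
      then show ?thesis using 1 2 3 cA by linarith
    qed
  qed
  moreover have "card ?E + k = k * card (insert z (V - A))"
  proof -
    have "card (insert z (V - A)) = Suc (card (V - A))" using fin z by simp
    moreover have "k * card V = k * card (V - A) + k * card A" unfolding cV by (rule distrib_left)
    ultimately show ?thesis using cE cd cA tot by simp
  qed
  ultimately show ?thesis by (simp add: ktight_def)
qed

text \<open>A vertex set that cuts through \<open>A\<close> is crossed by an edge of the given
  colour inside \<open>A\<close>; one that contains or avoids \<open>A\<close> corresponds to a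
  vertex set of the contraction and is crossed there.\<close>

lemma packing_combine:
  assumes z: "z \<in> A" "A \<subseteq> V" and E: "\<And>e. e \<in> E \<Longrightarrow> en e \<subseteq> V"
    and c1: "packing k A (induced E en A) en c1"
    and c2: "packing k (insert z (V - A)) (E - induced E en A) (contract_ends en A z) c2"
  shows "packing k V E en (\<lambda>e. if en e \<subseteq> A then c1 e else c2 e)"
proof -
  let ?c = "\<lambda>e. if en e \<subseteq> A then c1 e else c2 e"
  have "?c e < k" if "e \<in> E" for e using that c1 c2 by (auto simp: packing_def induced_def)
  moreover have "cut_connected {e \<in> E. ?c e = i} en V" if i: "i < k" for i
    unfolding cut_connected_def
  proof (intro allI impI)
    fix B assume B: "B \<subseteq> V" "B \<noteq> {}" "B \<noteq> V"
    show "\<exists>e\<in>{e \<in> E. ?c e = i}. en e \<inter> B \<noteq> {} \<and> en e \<inter> (V - B) \<noteq> {}"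
    proof (cases "B \<inter> A \<noteq> {} \<and> \<not> A \<subseteq> B")
      case True
      have "cut_connected {e \<in> induced E en A. c1 e = i} en A" using c1 i by (auto simp: packing_def)
      moreover have "B \<inter> A \<subseteq> A" "B \<inter> A \<noteq> {}" "B \<inter> A \<noteq> A" using True by auto
      ultimately obtain e where "e \<in> induced E en A" "c1 e = i" "en e \<inter> (B \<inter> A) \<noteq> {}"
          "en e \<inter> (A - B \<inter> A) \<noteq> {}"
        unfolding cut_connected_def by blast
      then show ?thesis using z(2) by (intro bexI[of _ e]) (auto simp: induced_def)
    next
      case False
      let ?B = "if A \<subseteq> B then insert z (B - A) else B"
      have cc: "cut_connected {e \<in> E - induced E en A. c2 e = i} (contract_ends en A z) (insert z (V - A))"
        using c2 i by (auto simp: packing_def)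
      have "?B \<subseteq> insert z (V - A)" "?B \<noteq> {}" "?B \<noteq> insert z (V - A)"
        using False B z by (auto split: if_splits)
      then obtain e where e: "e \<in> E - induced E en A" "c2 e = i"
        "contract_ends en A z e \<inter> ?B \<noteq> {}" "contract_ends en A z e \<inter> (insert z (V - A) - ?B) \<noteq> {}"
        using cc unfolding cut_connected_def by blast
      have iff: "(if x \<in> A then z else x) \<in> ?B \<longleftrightarrow> x \<in> B" if "x \<in> V" for x
        using False z that by (auto split: if_splits)
      obtain x y where "x \<in> en e" "y \<in> en e" "(if x \<in> A then z else x) \<in> ?B"
        "(if y \<in> A then z else y) \<notin> ?B" using e(3,4) unfolding contract_ends_def by blast
      moreover have "en e \<subseteq> V" using E e(1) by auto
      ultimately have "x \<in> en e \<inter> B" "y \<in> en e \<inter> (V - B)" using iff by blast+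
      then show ?thesis using e(1,2) by (intro bexI[of _ e]) (auto simp: induced_def)
    qed
  qed
  ultimately show ?thesis by (simp add: packing_def)
qed

section \<open>Connecting two vertices by two trees\<close>

text \<open>An optional prescribed edge is coded as a set with at most one element.\<close>

definition root_edge :: "'e set \<Rightarrow> ('e \<Rightarrow> 'v set) \<Rightarrow> 'v \<Rightarrow> 'v \<Rightarrow> 'e set \<Rightarrow> bool" where
  "root_edge E en v a F \<longleftrightarrow> F = {} \<or> (\<exists>f\<in>E. en f = {v, a} \<and> F = {f})"

text \<open>The two trees of the theorem are the colours 0 and 1; by symmetry of the colours nothing
  is lost.\<close>

abbreviation low :: "'e set \<Rightarrow> ('e \<Rightarrow> nat) \<Rightarrow> 'e set" where
  "low E c \<equiv> {e \<in> E. c e < 2}"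

definition linked_packing where
  "linked_packing k V E en v a b F c \<longleftrightarrow>
     packing k V E en c \<and> (\<forall>f\<in>F. c f < 2) \<and> (a, b) \<in> (adj (low E c) en (V - {v}))\<^sup>*"

text \<open>The prescribed edges at the root make the statement strong enough for an induction: if a
  path leaves a tight set containing the root, its crossing edges become such edges after the
  contraction of the set to the root.\<close>

definition linkable :: "nat \<Rightarrow> 'v set \<Rightarrow> 'e set \<Rightarrow> ('e \<Rightarrow> 'v set) \<Rightarrow> bool" where
  "linkable k V E en \<longleftrightarrow>
     (\<forall>v a b Fa Fb. v \<in> V \<longrightarrow> a \<in> V - {v} \<longrightarrow> b \<in> V - {v} \<longrightarrow>
        (a, b) \<in> (adj E en (V - {v}))\<^sup>* \<longrightarrow> root_edge E en v a Fa \<longrightarrow> root_edge E en v b Fb \<longrightarrow>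
        (\<exists>c. linked_packing k V E en v a b (Fa \<union> Fb) c))"

lemma linkableD:
  "linkable k V E en \<Longrightarrow> v \<in> V \<Longrightarrow> a \<in> V - {v} \<Longrightarrow> b \<in> V - {v} \<Longrightarrow>
    (a, b) \<in> (adj E en (V - {v}))\<^sup>* \<Longrightarrow> root_edge E en v a Fa \<Longrightarrow> root_edge E en v b Fb \<Longrightarrow>
    \<exists>c. linked_packing k V E en v a b (Fa \<union> Fb) c"
  unfolding linkable_def by blast

lemma linked_packing_swap:
  "linked_packing k V E en v a b (Fa \<union> Fb) c \<Longrightarrow> linked_packing k V E en v b a (Fb \<union> Fa) c"
  unfolding linked_packing_def by (auto intro: adj_reach_sym)

lemma adjI: "e \<in> F \<Longrightarrow> en e = {x, y} \<Longrightarrow> x \<in> X \<Longrightarrow> y \<in> X \<Longrightarrow> (x, y) \<in> (adj F en X)\<^sup>*"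
  by (rule r_into_rtrancl) (auto simp: adj_def)

text \<open>For \<open>a = b\<close> only the prescribed edges matter; there are at most two, so
  renaming colours suffices.\<close>

lemma linked_packing_same:
  assumes "ktight k V E en" "k \<ge> 2" "root_edge E en v a Fa" "root_edge E en v b Fb"
  shows "\<exists>c. linked_packing k V E en v a a (Fa \<union> Fb) c"
proof -
  obtain c where c: "packing k V E en c" using nash_williams[OF assms(1,2)] by blast
  have "\<exists>c. packing k V E en c \<and> (\<forall>f\<in>Fa \<union> Fb. c f < 2)"
  proof (cases "Fa \<union> Fb = {}")
    case False
    obtain f g where fg: "f \<in> E" "g \<in> E" "Fa \<union> Fb \<subseteq> {f, g}"
      using assms(3,4) False unfolding root_edge_def by blast
    show ?thesis using packing_recolour[OF c fg(1,2) assms(2)] fg(3) by blast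
  qed (use c in auto)
  then show ?thesis unfolding linked_packing_def by blast
qed

text \<open>Every colour spans \<open>A\<close> and \<open>v\<close> lies outside, so colour 0 alone
  joins all vertices of \<open>A\<close> within \<open>V - {v}\<close>. Hence a linking path of the
  contraction lifts, no matter where it enters and leaves \<open>A\<close>.\<close>

lemma contract_linked:
  assumes kt: "ktight k V E en" and A: "tight_set k V E en A" "v \<notin> A" "z \<in> A" and k: "k \<ge> 2"
    and IH: "linkable k (insert z (V - A)) (E - induced E en A) (contract_ends en A z)"
    and v: "v \<in> V" and ab: "a \<in> V - {v}" "b \<in> V - {v}" "(a, b) \<in> (adj E en (V - {v}))\<^sup>*"
    and F: "root_edge E en v a Fa" "root_edge E en v b Fb"
  shows "\<exists>c. linked_packing k V E en v a b (Fa \<union> Fb) c"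
proof -
  let ?E = "E - induced E en A" and ?en = "contract_ends en A z" and ?V = "insert z (V - A)"
  define \<pi> where "\<pi> x = (if x \<in> A then z else x)" for x
  have g: "\<And>e. e \<in> E \<Longrightarrow> en e \<subseteq> V \<and> card (en e) = 2" using kt by (simp add: ktight_def graph_on_def)
  have AV: "A \<subseteq> V" using A(1) by (simp add: tight_set_def)
  have en: "?en e = \<pi> ` en e" for e by (simp add: contract_ends_def \<pi>_def)
  have \<pi>V: "\<pi> x \<in> ?V - {v}" if "x \<in> V - {v}" for x using that A by (auto simp: \<pi>_def)
  have "(\<pi> a, \<pi> y) \<in> (adj ?E ?en (?V - {v}))\<^sup>*" if "(a, y) \<in> (adj E en (V - {v}))\<^sup>*" for y
    using that
  proof (induction rule: rtrancl_induct)
    case (step y y')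
    then obtain e where e: "e \<in> E" "en e = {y, y'}" "y \<in> V - {v}" "y' \<in> V - {v}"
      by (auto simp: adj_def)
    show ?case
    proof (cases "en e \<subseteq> A")
      case True then show ?thesis using e step by (simp add: \<pi>_def)
    next
      case False
      then have "(\<pi> y, \<pi> y') \<in> (adj ?E ?en (?V - {v}))\<^sup>*"
        using e \<pi>V en by (intro adjI[of e]) (auto simp: induced_def)
      then show ?thesis using step by simp
    qed
  qed simp
  then have reach: "(\<pi> a, \<pi> b) \<in> (adj ?E ?en (?V - {v}))\<^sup>*" using ab(3) .
  have re: "root_edge ?E ?en v (\<pi> x) F" if xF: "root_edge E en v x F" for x F
  proof (cases "F = {}")
    case False
    then obtain f where "f \<in> E" "en f = {v, x}" "F = {f}" using xF unfolding root_edge_def by blast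
    moreover then have "\<not> en f \<subseteq> A" using A(2) by auto
    moreover have "\<pi> v = v" using A(2) by (simp add: \<pi>_def)
    ultimately show ?thesis using en[of f] unfolding root_edge_def by (auto simp: induced_def)
  qed (simp add: root_edge_def)
  obtain c2 where c2: "linked_packing k ?V ?E ?en v (\<pi> a) (\<pi> b) (Fa \<union> Fb) c2"
    using linkableD[OF IH _ \<pi>V[OF ab(1)] \<pi>V[OF ab(2)] reach re[OF F(1)] re[OF F(2)]] v A(2) by blast
  obtain c1 where c1: "packing k A (induced E en A) en c1"
    using nash_williams[OF induced_ktight[OF kt A(1)] k] by blast
  let ?c = "\<lambda>e. if en e \<subseteq> A then c1 e else c2 e"
  have c: "packing k V E en ?c"
    using packing_combine[OF A(3) AV _ c1] c2 g unfolding linked_packing_def by blast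
  have "?c f < 2" if "f \<in> Fa \<union> Fb" for f
  proof -
    have "v \<in> en f" using that F by (auto simp: root_edge_def)
    then show ?thesis using that c2 A(2) by (auto simp: linked_packing_def)
  qed
  moreover have "(a, b) \<in> (adj (low E ?c) en (V - {v}))\<^sup>*"
  proof -
    let ?R = "(adj (low E ?c) en (V - {v}))\<^sup>*"
    have inA: "(x, y) \<in> ?R" if xy: "x \<in> A" "y \<in> A" for x y
    proof -
      have "cut_connected {e \<in> induced E en A. c1 e = 0} en A" using c1 k by (auto simp: packing_def)
      then have "(x, y) \<in> (adj {e \<in> induced E en A. c1 e = 0} en A)\<^sup>*"
        by (rule cut_connected_reach) (use g xy in \<open>auto simp: induced_def\<close>)
      then show ?thesis by (rule adj_reach_mono) (use A(2) AV in \<open>auto simp: induced_def\<close>)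
    qed
    have same: "(x, y) \<in> ?R" if "\<pi> x = \<pi> y" for x y
    proof (cases "x = y")
      case False
      then have "x \<in> A" "y \<in> A" using that A(3) by (auto simp: \<pi>_def split: if_splits)
      then show ?thesis by (rule inA)
    qed simp
    \<comment> \<open>The claim covers all preimages \<open>y\<close>, since the path may enter and
      leave the contracted vertex at different vertices of \<open>A\<close>.\<close>
    have "\<forall>y. \<pi> y = z' \<longrightarrow> (a, y) \<in> ?R" if "(\<pi> a, z') \<in> (adj (low ?E c2) ?en (?V - {v}))\<^sup>*" for z'
      using that
    proof (induction rule: rtrancl_induct)
      case base
      show ?case
      proof (intro allI impI)
        fix y assume "\<pi> y = \<pi> a"
        then show "(a, y) \<in> ?R" using same[of a y] by simp
      qed
    next
      case (step y0 y1)
      then obtain e where e: "e \<in> E" "c2 e < 2" "\<not> en e \<subseteq> A" "?en e = {y0, y1}" "y0 \<noteq> v" "y1 \<noteq> v"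
        by (auto simp: adj_def induced_def)
      obtain p where p: "p \<in> en e" "\<pi> p = y0" using e(4) en[of e] by (metis imageE insertI1)
      obtain q where q: "q \<in> en e" "\<pi> q = y1" using e(4) en[of e] by (metis imageE insertI1 insert_commute)
      have pv: "p \<noteq> v" "q \<noteq> v" using p q e A(2) by (auto simp: \<pi>_def)
      have pqV: "p \<in> V - {v}" "q \<in> V - {v}" using pv p q g[OF e(1)] by auto
      have pq: "(p, q) \<in> ?R"
      proof (cases "p = q")
        case False
        then have "en e = {p, q}" using card2_eq[of "en e" p q] g[OF e(1)] p q by blast
        then show ?thesis using e pqV by (intro adjI[of e]) auto
      qed simp
      have "(a, p) \<in> ?R" using step.IH p by blast
      then have "(a, q) \<in> ?R" using pq by (rule rtrancl_trans)
      show ?case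
      proof (intro allI impI)
        fix y assume "\<pi> y = y1"
        then have "(q, y) \<in> ?R" using same[of q y] q(2) by simp
        with \<open>(a, q) \<in> ?R\<close> show "(a, y) \<in> ?R" by (rule rtrancl_trans)
      qed
    qed
    then show ?thesis using c2 unfolding linked_packing_def by blast
  qed
  ultimately show ?thesis using c unfolding linked_packing_def by blast
qed

section \<open>Tight sets containing the root\<close>

text \<open>The edges divide between two sides that share only \<open>v\<close>. The two sparsity
  bounds add up to the exact number of edges, so both hold with equality.\<close>

lemma cut_vertex_tight:
  assumes kt: "ktight k A E en" and v: "v \<in> A" and Q: "Q \<subseteq> A - {v}"
    and E: "\<And>e. e \<in> E \<Longrightarrow> en e \<subseteq> insert v Q \<or> en e \<inter> Q = {}"
  shows "tight_set k A E en (insert v Q)" "tight_set k A E en (A - Q)"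
proof -
  have fin: "finite A" "finite E" and g: "\<And>e. e \<in> E \<Longrightarrow> en e \<subseteq> A \<and> card (en e) = 2"
    and sp: "sparse k A E en" and tot: "card E + k = k * card A"
    using kt by (auto simp: ktight_def graph_on_def)
  have finQ: "finite Q" using Q fin finite_subset by blast
  have "induced E en (insert v Q) \<inter> induced E en (A - Q) = {}"
  proof (rule ccontr)
    assume "\<not> ?thesis"
    then obtain e where "e \<in> E" "en e \<subseteq> insert v Q" "en e \<subseteq> A - Q" by (auto simp: induced_def)
    then have "en e \<subseteq> {v}" "card (en e) = 2" using g by auto
    then show False using card_mono[of "{v}" "en e"] by simp
  qed
  moreover have "E = induced E en (insert v Q) \<union> induced E en (A - Q)"
    using E g by (auto simp: induced_def)
  ultimately have cE: "card E = card (induced E en (insert v Q)) + card (induced E en (A - Q))"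
    using fin by (metis card_Un_disjoint finite_induced)
  have "v \<notin> Q" using Q by blast
  then have "card (insert v Q) = Suc (card Q)" using finQ by simp
  moreover have "card A = card (A - Q) + card Q"
    using fin Q by (metis Diff_subset card_Diff_subset card_mono finQ le_add_diff_inverse2 subset_trans)
  ultimately have cA: "k * card (insert v Q) + k * card (A - Q) = k * card A + k"
    by (simp add: distrib_left)
  have sub: "insert v Q \<subseteq> A" "insert v Q \<noteq> {}" "A - Q \<subseteq> A" "A - Q \<noteq> {}" using v Q by auto
  have "card (induced E en (insert v Q)) + k = k * card (insert v Q)"
    "card (induced E en (A - Q)) + k = k * card (A - Q)"
    using sparseD[OF sp sub(1,2)] sparseD[OF sp sub(3,4)] cE cA tot by linarith+
  then show "tight_set k A E en (insert v Q)" "tight_set k A E en (A - Q)"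
    using sub by (simp_all add: tight_set_def)
qed

lemma cut_connectedD:
  "cut_connected F en V \<Longrightarrow> B \<subseteq> V \<Longrightarrow> B \<noteq> {} \<Longrightarrow> B \<noteq> V \<Longrightarrow>
    \<exists>e\<in>F. en e \<inter> B \<noteq> {} \<and> en e \<inter> (V - B) \<noteq> {}"
  unfolding cut_connected_def by blast

text \<open>Both blocks contain \<open>v\<close>, so a set that cuts neither of them contains both
  or misses both.\<close>

lemma packing_glue:
  assumes A: "A1 \<inter> A2 = {v}" and E: "\<And>e. e \<in> E \<Longrightarrow> en e \<subseteq> A1 \<or> en e \<subseteq> A2" "\<And>e. e \<in> E \<Longrightarrow> card (en e) = 2"
    and c1: "packing k A1 (induced E en A1) en c1" and c2: "packing k A2 (induced E en A2) en c2"
  shows "packing k (A1 \<union> A2) E en (\<lambda>e. if en e \<subseteq> A1 then c1 e else c2 e)"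
proof -
  let ?c = "\<lambda>e. if en e \<subseteq> A1 then c1 e else c2 e"
  have c12: "?c e = c2 e" if "e \<in> E" "en e \<subseteq> A2" for e
  proof -
    have "\<not> en e \<subseteq> A1"
    proof
      assume "en e \<subseteq> A1"
      then have "en e \<subseteq> {v}" using that A by blast
      then show False using card_mono[of "{v}" "en e"] E(2)[OF that(1)] by simp
    qed
    then show ?thesis by simp
  qed
  have "?c e < k" if "e \<in> E" for e using that E(1)[OF that] c1 c2 by (auto simp: packing_def induced_def)
  moreover have "cut_connected {e \<in> E. ?c e = i} en (A1 \<union> A2)" if i: "i < k" for i
    unfolding cut_connected_def
  proof (intro allI impI)
    fix B assume B: "B \<subseteq> A1 \<union> A2" "B \<noteq> {}" "B \<noteq> A1 \<union> A2"
    have cc: "cut_connected {e \<in> induced E en A1. c1 e = i} en A1"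
      "cut_connected {e \<in> induced E en A2. c2 e = i} en A2"
      using c1 c2 i by (auto simp: packing_def)
    have "(B \<inter> A1 \<noteq> {} \<and> B \<inter> A1 \<noteq> A1) \<or> (B \<inter> A2 \<noteq> {} \<and> B \<inter> A2 \<noteq> A2)" using B A by blast
    then show "\<exists>e\<in>{e \<in> E. ?c e = i}. en e \<inter> B \<noteq> {} \<and> en e \<inter> (A1 \<union> A2 - B) \<noteq> {}"
    proof
      assume "B \<inter> A1 \<noteq> {} \<and> B \<inter> A1 \<noteq> A1"
      then obtain e where "e \<in> induced E en A1" "c1 e = i" "en e \<inter> (B \<inter> A1) \<noteq> {}" "en e \<inter> (A1 - B \<inter> A1) \<noteq> {}"
        using cut_connectedD[OF cc(1), of "B \<inter> A1"] by blast
      then show ?thesis by (intro bexI[of _ e]) (auto simp: induced_def)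
    next
      assume "B \<inter> A2 \<noteq> {} \<and> B \<inter> A2 \<noteq> A2"
      then obtain e where "e \<in> induced E en A2" "c2 e = i" "en e \<inter> (B \<inter> A2) \<noteq> {}" "en e \<inter> (A2 - B \<inter> A2) \<noteq> {}"
        using cut_connectedD[OF cc(2), of "B \<inter> A2"] by blast
      then show ?thesis using c12[of e] by (intro bexI[of _ e]) (auto simp: induced_def)
    qed
  qed
  ultimately show ?thesis by (simp add: packing_def)
qed

lemma reach_restrict:
  assumes "(a, x) \<in> (adj F en X)\<^sup>*"
  shows "(a, x) \<in> (adj F en {z. (a, z) \<in> (adj F en X)\<^sup>*})\<^sup>*"
  using assms
proof (induction rule: rtrancl_induct)
  case (step y z)
  then have "(a, z) \<in> (adj F en X)\<^sup>*" by auto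
  then have "(y, z) \<in> adj F en {z. (a, z) \<in> (adj F en X)\<^sup>*}" using step unfolding adj_def by auto
  then show ?case using step.IH by (rule rtrancl_into_rtrancl[rotated])
qed simp

lemma reach_closed:
  assumes "\<And>e. e \<in> E \<Longrightarrow> card (en e) = 2" "a \<in> X" "e \<in> E"
    "p \<in> en e" "(a, p) \<in> (adj E en X)\<^sup>*" "q \<in> en e" "q \<in> X"
  shows "(a, q) \<in> (adj E en X)\<^sup>*"
proof (cases "p = q")
  case False
  have "en e = {p, q}" using card2_eq[of "en e" p q] assms False by blast
  then have "(p, q) \<in> (adj E en X)\<^sup>*" using assms adj_reach_in[OF assms(5,2)] by (intro adjI[of e]) auto
  then show ?thesis using assms(5) by (rule rtrancl_trans[rotated])
qed (use assms in simp)

text \<open>\<open>linkable\<close> treats a single pair, but here \<open>a\<close> is to be linked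
  to \<open>x\<close> and simultaneously \<open>b\<close> to \<open>y\<close>. As \<open>v\<close>
  separates \<open>a\<close> from \<open>b\<close>, the pairs lie in two tight blocks that meet in
  \<open>v\<close>, and each block takes one pair together with its root edge.\<close>

lemma two_blocks_linked:
  assumes kt: "ktight k A E en" and v: "v \<in> A" and ab: "a \<in> A - {v}" "b \<in> A - {v}"
    and nab: "(a, b) \<notin> (adj E en (A - {v}))\<^sup>*"
    and xy: "(a, x) \<in> (adj E en (A - {v}))\<^sup>*" "(b, y) \<in> (adj E en (A - {v}))\<^sup>*"
    and F: "root_edge E en v a Fa" "root_edge E en v b Fb"
    and IH: "\<And>B. tight_set k A E en B \<Longrightarrow> linkable k B (induced E en B) en"
  shows "\<exists>c. packing k A E en c \<and> (\<forall>f\<in>Fa \<union> Fb. c f < 2) \<and>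
    (a, x) \<in> (adj (low E c) en (A - {v}))\<^sup>* \<and> (b, y) \<in> (adj (low E c) en (A - {v}))\<^sup>*"
proof -
  define Q where "Q = {z. (a, z) \<in> (adj E en (A - {v}))\<^sup>*}"
  define Y where "Y = {z. (b, z) \<in> (adj E en (A - {v}))\<^sup>*}"
  have g: "\<And>e. e \<in> E \<Longrightarrow> en e \<subseteq> A \<and> card (en e) = 2" using kt by (simp add: ktight_def graph_on_def)
  have QA: "Q \<subseteq> A - {v}" unfolding Q_def using adj_reach_in ab(1) by fast
  have YA: "Y \<subseteq> A - {v}" unfolding Y_def using adj_reach_in ab(2) by fast
  have YQ: "Y \<inter> Q = {}"
  proof (rule ccontr)
    assume "Y \<inter> Q \<noteq> {}"
    then obtain z where "(a, z) \<in> (adj E en (A - {v}))\<^sup>*" "(b, z) \<in> (adj E en (A - {v}))\<^sup>*"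
      by (auto simp: Q_def Y_def)
    then show False using nab adj_reach_sym rtrancl_trans by metis
  qed
  have E: "en e \<subseteq> insert v Q \<or> en e \<inter> Q = {}" if e: "e \<in> E" for e
  proof (cases "en e \<inter> Q = {}")
    case False
    then obtain p where p: "p \<in> en e" "(a, p) \<in> (adj E en (A - {v}))\<^sup>*" by (auto simp: Q_def)
    have "q \<in> insert v Q" if "q \<in> en e" for q
      using reach_closed[OF _ ab(1) e p that] g g[OF e] that by (auto simp: Q_def)
    then show ?thesis by blast
  qed simp
  note t = cut_vertex_tight[OF kt v QA E]
  have aQ: "a \<in> Q" "x \<in> Q" "b \<in> Y" "y \<in> Y" using xy by (auto simp: Q_def Y_def)
  have r1: "(a, x) \<in> (adj (induced E en (insert v Q)) en (insert v Q - {v}))\<^sup>*"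
    by (rule adj_reach_mono[OF reach_restrict[OF xy(1), folded Q_def]]) (use QA in \<open>auto simp: induced_def\<close>)
  have r2: "(b, y) \<in> (adj (induced E en (A - Q)) en (A - Q - {v}))\<^sup>*"
    by (rule adj_reach_mono[OF reach_restrict[OF xy(2), folded Y_def]])
      (use YA YQ in \<open>auto simp: induced_def\<close>)
  have F1: "root_edge (induced E en (insert v Q)) en v a Fa"
    using F(1) aQ unfolding root_edge_def by (auto simp: induced_def)
  have bA: "b \<in> A - Q" using aQ YQ ab by auto
  have F2: "root_edge (induced E en (A - Q)) en v b Fb"
    using F(2) bA v QA unfolding root_edge_def by (auto simp: induced_def)
  have no: "root_edge E' en v z {}" for E' z by (simp add: root_edge_def)
  obtain c1 where c1: "linked_packing k (insert v Q) (induced E en (insert v Q)) en v a x (Fa \<union> {}) c1"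
    using linkableD[OF IH[OF t(1)] _ _ _ r1 F1 no] aQ QA by blast
  have "y \<in> A - Q - {v}" using aQ YQ YA by blast
  then obtain c2 where c2: "linked_packing k (A - Q) (induced E en (A - Q)) en v b y (Fb \<union> {}) c2"
    using linkableD[OF IH[OF t(2)] _ _ _ r2 F2 no] bA v QA ab by blast
  let ?c = "\<lambda>e. if en e \<subseteq> insert v Q then c1 e else c2 e"
  have "insert v Q \<inter> (A - Q) = {v}" "insert v Q \<union> (A - Q) = A" using v QA by auto
  moreover have "en e \<subseteq> insert v Q \<or> en e \<subseteq> A - Q" if "e \<in> E" for e using E[OF that] g[OF that] by auto
  ultimately have c: "packing k A E en ?c"
    using packing_glue[of "insert v Q" "A - Q" v E en k c1 c2] c1 c2 g
    unfolding linked_packing_def by auto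
  have c2e: "?c e = c2 e" if "e \<in> E" "en e \<subseteq> A - Q" for e
  proof -
    have "\<not> en e \<subseteq> insert v Q"
    proof
      assume "en e \<subseteq> insert v Q"
      then have "en e \<subseteq> {v}" using that by blast
      then show False using card_mono[of "{v}" "en e"] g[OF that(1)] by simp
    qed
    then show ?thesis by simp
  qed
  have "?c f < 2" if "f \<in> Fa \<union> Fb" for f
  proof (cases "f \<in> Fa")
    case True
    then have "en f \<subseteq> insert v Q" using F1 by (auto simp: root_edge_def induced_def)
    then show ?thesis using c1 True by (simp add: linked_packing_def)
  next
    case False
    then have "f \<in> Fb" using that by blast
    then have "en f \<subseteq> A - Q" "f \<in> E" using F2 by (auto simp: root_edge_def induced_def)
    then show ?thesis using c2 \<open>f \<in> Fb\<close> c2e[of f] by (simp add: linked_packing_def)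
  qed
  moreover have "(a, x) \<in> (adj (low E ?c) en (A - {v}))\<^sup>*"
  proof -
    have "(a, x) \<in> (adj (low (induced E en (insert v Q)) c1) en (insert v Q - {v}))\<^sup>*"
      using c1 by (simp add: linked_packing_def)
    then show ?thesis by (rule adj_reach_mono) (use QA in \<open>auto simp: induced_def\<close>)
  qed
  moreover have "(b, y) \<in> (adj (low E ?c) en (A - {v}))\<^sup>*"
  proof -
    have "(b, y) \<in> (adj (low (induced E en (A - Q)) c2) en (A - Q - {v}))\<^sup>*"
      using c2 by (simp add: linked_packing_def)
    then show ?thesis
    proof (rule adj_reach_mono)
      fix e assume "e \<in> low (induced E en (A - Q)) c2"
      then have "e \<in> E" "en e \<subseteq> A - Q" "c2 e < 2" by (auto simp: induced_def)
      then show "e \<in> low E ?c \<and> en e = en e" using c2e[of e] by simp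
    qed auto
  qed
  ultimately show ?thesis using c by blast
qed

text \<open>If \<open>V - A\<close> had a component \<open>Q\<close> other than itself, then
  \<open>A \<union> Q\<close> and \<open>V - Q\<close> would meet in \<open>A\<close> and together
  induce all edges. Counting would make \<open>A \<union> Q\<close> tight, strictly between
  \<open>A\<close> and \<open>V\<close>.\<close>

lemma outside_connected:
  assumes kt: "ktight k V E en" and A: "tight_set k V E en A"
    and max: "\<And>B. tight_set k V E en B \<Longrightarrow> A \<subseteq> B \<Longrightarrow> B = A \<or> B = V"
    and xy: "x \<in> V - A" "y \<in> V - A"
  shows "(x, y) \<in> (adj E en (V - A))\<^sup>*"
proof (rule ccontr)
  assume ny: "(x, y) \<notin> (adj E en (V - A))\<^sup>*"
  define Q where "Q = {z. (x, z) \<in> (adj E en (V - A))\<^sup>*}"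
  have QV: "Q \<subseteq> V - A" unfolding Q_def using adj_reach_in xy(1) by fast
  have fin: "finite V" "finite E" and g: "\<And>e. e \<in> E \<Longrightarrow> en e \<subseteq> V \<and> card (en e) = 2"
    and sp: "sparse k V E en" and tot: "card E + k = k * card V"
    using kt by (auto simp: ktight_def graph_on_def)
  have AV: "A \<subseteq> V" "A \<noteq> {}" "card (induced E en A) + k = k * card A"
    using A by (auto simp: tight_set_def)
  let ?B1 = "A \<union> Q" and ?B2 = "V - Q"
  have "en e \<subseteq> ?B1 \<or> en e \<subseteq> ?B2" if e: "e \<in> E" for e
  proof (cases "en e \<inter> Q = {}")
    case True then show ?thesis using g[OF e] by auto
  next
    case False
    then obtain p where p: "p \<in> en e" "(x, p) \<in> (adj E en (V - A))\<^sup>*" by (auto simp: Q_def)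
    have "q \<in> A \<union> Q" if "q \<in> en e" for q
      using reach_closed[OF _ xy(1) e p that] g g[OF e] that by (auto simp: Q_def)
    then show ?thesis by blast
  qed
  then have "induced E en ?B1 \<union> induced E en ?B2 = E" by (auto simp: induced_def)
  moreover have "induced E en ?B1 \<inter> induced E en ?B2 = induced E en A"
    using QV AV by (auto simp: induced_def)
  ultimately have cE: "card (induced E en ?B1) + card (induced E en ?B2) = card E + card (induced E en A)"
    using card_Un_Int[of "induced E en ?B1" "induced E en ?B2"] fin by simp
  have sub: "?B1 \<subseteq> V" "?B1 \<noteq> {}" "?B2 \<subseteq> V" "?B2 \<noteq> {}" using AV QV by auto
  have "?B1 \<union> ?B2 = V" "?B1 \<inter> ?B2 = A" using QV AV by auto
  then have cV: "k * card ?B1 + k * card ?B2 = k * card V + k * card A"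
    using mult_card_Un_Int[OF finite_subset[OF sub(1) fin(1)] finite_subset[OF sub(3) fin(1)], of k]
    by simp
  have "card (induced E en ?B1) + k = k * card ?B1"
    using sparseD[OF sp sub(1,2)] sparseD[OF sp sub(3,4)] cE cV tot AV(3) by linarith
  then have "tight_set k V E en ?B1" using sub by (simp add: tight_set_def)
  then have "?B1 = A \<or> ?B1 = V" using max by blast
  moreover have "x \<in> Q" "y \<notin> Q" using ny by (auto simp: Q_def)
  ultimately show False using xy by blast
qed

text \<open>\<open>A\<close> is contracted to the root. If \<open>a\<close> and \<open>b\<close> are
  not already joined inside \<open>A - {v}\<close>, a path starting in \<open>A\<close> leaves its
  component of \<open>A - {v}\<close> by an edge to the outside. In the contraction this is a root
  edge, and prescribing it puts it into a low colour. The outer ends can be linked there because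
  \<open>V - A\<close> is connected.\<close>

lemma root_tight_linked:
  fixes V :: "'v set" and E :: "'e set"
  assumes kt: "ktight k V E en" and k: "k \<ge> 2"
    and A: "tight_set k V E en A" "v \<in> A" "A \<noteq> {v}" "A \<noteq> V"
    and max: "\<And>B. tight_set k V E en B \<Longrightarrow> A \<subseteq> B \<Longrightarrow> B = A \<or> B = V"
    and IH: "\<And>(V' :: 'v set) (E' :: 'e set) en'. card V' < card V \<Longrightarrow> ktight k V' E' en' \<Longrightarrow> linkable k V' E' en'"
    and ab: "a \<in> V - {v}" "b \<in> V - {v}" "(a, b) \<in> (adj E en (V - {v}))\<^sup>*"
    and F: "root_edge E en v a Fa" "root_edge E en v b Fb"
  shows "\<exists>c. linked_packing k V E en v a b (Fa \<union> Fb) c"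
proof -
  let ?EA = "induced E en A" and ?E = "E - induced E en A" and ?en = "contract_ends en A v"
    and ?V = "insert v (V - A)"
  have fin: "finite V" "finite E" and g: "\<And>e. e \<in> E \<Longrightarrow> en e \<subseteq> V \<and> card (en e) = 2"
    using kt by (auto simp: ktight_def graph_on_def)
  have AV: "A \<subseteq> V" "A \<noteq> {}" using A by (auto simp: tight_set_def)
  have ktA: "ktight k A ?EA en" by (rule induced_ktight[OF kt A(1)])
  have ktC: "ktight k ?V ?E ?en" by (rule contract_ktight[OF kt A(1,2)])
  have "A \<subset> V" using AV A by blast
  then have cA: "card A < card V" using fin by (simp add: psubset_card_mono)
  have cC: "card ?V < card V"
  proof -
    have "?V \<subset> V" using A AV by blast
    then show ?thesis using fin by (simp add: psubset_card_mono)
  qed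
  have lA: "linkable k A ?EA en" by (rule IH[OF cA ktA])
  have lC: "linkable k ?V ?E ?en" by (rule IH[OF cC ktC])
  have VC: "?V - {v} = V - A" using A(2) by auto
  have out: "?en e = en e" if "?en e \<subseteq> V - A" for e
  proof -
    have "en e \<inter> A = {}" using that A(2) by (auto simp: contract_ends_def split: if_splits)
    then show ?thesis by (auto simp: contract_ends_def)
  qed
  have comb: "packing k V E en (\<lambda>e. if en e \<subseteq> A then c1 e else c2 e)"
    if "packing k A ?EA en c1" "packing k ?V ?E ?en c2" for c1 c2
    by (rule packing_combine[OF A(2) AV(1) _ that]) (use g in blast)
  have FA: "root_edge ?EA en v t F'" if "t \<in> A" "root_edge E en v t F'" for t F'
    using that A(2) by (auto simp: root_edge_def induced_def)
  have no: "root_edge E' en' v t {}" for E' en' t by (simp add: root_edge_def)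
  have AtoV: "(s, t) \<in> (adj (low E (\<lambda>e. if en e \<subseteq> A then c1 e else c2 e)) en (V - {v}))\<^sup>*"
    if "(s, t) \<in> (adj (low ?EA c1) en (A - {v}))\<^sup>*" for s t c1 and c2 :: "'e \<Rightarrow> nat"
    by (rule adj_reach_mono[OF that]) (use AV in \<open>auto simp: induced_def\<close>)
  show ?thesis
  proof (cases "a \<in> A \<and> b \<in> A \<and> (a, b) \<in> (adj ?EA en (A - {v}))\<^sup>*")
    case True
    then obtain c1 where c1: "linked_packing k A ?EA en v a b (Fa \<union> Fb) c1"
      using linkableD[OF lA A(2) _ _ _ FA FA] ab F by blast
    obtain c2 where c2: "packing k ?V ?E ?en c2" using nash_williams[OF ktC k] by blast
    have "en f \<subseteq> A" if "f \<in> Fa \<union> Fb" for f using that F True A(2) by (auto simp: root_edge_def)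
    then show ?thesis
      using comb[OF _ c2, of c1] AtoV[of a b c1 c2] c1 unfolding linked_packing_def by auto
  next
    case False
    \<comment> \<open>One end \<open>t\<close> at a time: for \<open>t\<close> in \<open>A\<close>
      the exit edge \<open>{x, y}\<close> is prescribed in the contraction; otherwise
      \<open>t\<close> keeps its own root edge and \<open>y = t\<close>.\<close>
    have ex: "\<exists>y F' x. y \<in> V - A \<and> root_edge ?E ?en v y F' \<and>
        (if t \<in> A then x \<in> A - {v} \<and> (t, x) \<in> (adj ?EA en (A - {v}))\<^sup>* \<and>
           (\<exists>p\<in>E. en p = {x, y} \<and> F' = {p}) else y = t \<and> F' = F0)"
      if t: "t \<in> V - {v}" "root_edge E en v t F0" "(t, t') \<in> (adj E en (V - {v}))\<^sup>*"
        "t \<in> A \<Longrightarrow> (t, t') \<notin> (adj ?EA en (A - {v}))\<^sup>*" for t t' F0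
    proof (cases "t \<in> A")
      case tA: True
      define Q where "Q = {z. (t, z) \<in> (adj ?EA en (A - {v}))\<^sup>*}"
      have tQ: "t \<in> Q" "t' \<notin> Q" using t(4) tA by (auto simp: Q_def)
      obtain x y where xy: "(x, y) \<in> adj E en (V - {v})" "x \<in> Q" "y \<notin> Q"
        using rtrancl_leave[OF t(3) tQ] by blast
      then obtain p where p: "p \<in> E" "en p = {x, y}" "x \<noteq> v" "y \<noteq> v" "y \<in> V" by (auto simp: adj_def)
      have xQ: "(t, x) \<in> (adj ?EA en (A - {v}))\<^sup>*" using xy(2) by (simp add: Q_def)
      have xA: "x \<in> A - {v}" using adj_reach_in[OF xQ] tA t(1) by simp
      have yA: "y \<notin> A"
      proof
        assume "y \<in> A"
        then have "(x, y) \<in> (adj ?EA en (A - {v}))\<^sup>*"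
          using p xA by (intro adjI[of p]) (auto simp: induced_def)
        then show False using xQ xy(3) unfolding Q_def by (metis mem_Collect_eq rtrancl_trans)
      qed
      have "?en p = {v, y}" using p xA yA by (auto simp: contract_ends_def)
      then have "root_edge ?E ?en v y {p}" using p yA by (auto simp: root_edge_def induced_def)
      then show ?thesis using tA p xQ xA yA by auto
    next
      case tA: False
      have "root_edge ?E ?en v t F0"
      proof (cases "F0 = {}")
        case False
        then obtain f where f: "f \<in> E" "en f = {v, t}" "F0 = {f}" using t(2) unfolding root_edge_def by blast
        have "?en f = {v, t}" using f tA A(2) by (auto simp: contract_ends_def)
        then show ?thesis using f tA by (auto simp: root_edge_def induced_def)
      qed (simp add: no)
      then show ?thesis using tA t(1) by auto
    qed
    have na: "(a, b) \<notin> (adj ?EA en (A - {v}))\<^sup>*" if "a \<in> A"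
      using False that adj_reach_in[of a b ?EA en "A - {v}"] ab by auto
    have nb: "(b, a) \<notin> (adj ?EA en (A - {v}))\<^sup>*" if "b \<in> A"
      using False that adj_reach_in[of b a ?EA en "A - {v}"] adj_reach_sym[of b a ?EA en "A - {v}"] ab by auto
    obtain ya Fa' xa where a': "ya \<in> V - A" "root_edge ?E ?en v ya Fa'"
      "if a \<in> A then xa \<in> A - {v} \<and> (a, xa) \<in> (adj ?EA en (A - {v}))\<^sup>* \<and>
           (\<exists>p\<in>E. en p = {xa, ya} \<and> Fa' = {p}) else ya = a \<and> Fa' = Fa"
      using ex[OF ab(1) F(1) ab(3) na] by blast
    obtain yb Fb' xb where b': "yb \<in> V - A" "root_edge ?E ?en v yb Fb'"
      "if b \<in> A then xb \<in> A - {v} \<and> (b, xb) \<in> (adj ?EA en (A - {v}))\<^sup>* \<and>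
           (\<exists>p\<in>E. en p = {xb, yb} \<and> Fb' = {p}) else yb = b \<and> Fb' = Fb"
      using ex[OF ab(2) F(2) adj_reach_sym[OF ab(3)] nb] by blast
    have yy: "(ya, yb) \<in> (adj ?E ?en (?V - {v}))\<^sup>*"
      unfolding VC
    proof (rule adj_reach_mono[OF outside_connected[OF kt A(1) max a'(1) b'(1)]])
      fix e assume e: "e \<in> E" "en e \<subseteq> V - A"
      have "en e \<noteq> {}" using g[OF e(1)] by auto
      then show "e \<in> ?E \<and> ?en e = en e" using e by (auto simp: induced_def contract_ends_def)
    qed auto
    have "ya \<in> ?V - {v}" "yb \<in> ?V - {v}" using a'(1) b'(1) A(2) by auto
    then obtain c2 where c2: "linked_packing k ?V ?E ?en v ya yb (Fa' \<union> Fb') c2"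
      using linkableD[OF lC _ _ _ yy a'(2) b'(2)] by blast
    have "\<exists>c. packing k A ?EA en c \<and>
        (a \<in> A \<longrightarrow> (\<forall>f\<in>Fa. c f < 2) \<and> (a, xa) \<in> (adj (low ?EA c) en (A - {v}))\<^sup>*) \<and>
        (b \<in> A \<longrightarrow> (\<forall>f\<in>Fb. c f < 2) \<and> (b, xb) \<in> (adj (low ?EA c) en (A - {v}))\<^sup>*)"
    proof -
      have xa: "xa \<in> A - {v}" "(a, xa) \<in> (adj ?EA en (A - {v}))\<^sup>*" if "a \<in> A" using a'(3) that by auto
      have xb: "xb \<in> A - {v}" "(b, xb) \<in> (adj ?EA en (A - {v}))\<^sup>*" if "b \<in> A" using b'(3) that by auto
      consider "a \<in> A" "b \<in> A" | "a \<in> A" "b \<notin> A" | "a \<notin> A" "b \<in> A" | "a \<notin> A" "b \<notin> A" by blast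
      then show ?thesis
      proof cases
        case 1
        have "\<exists>c. packing k A ?EA en c \<and> (\<forall>f\<in>Fa \<union> Fb. c f < 2) \<and>
            (a, xa) \<in> (adj (low ?EA c) en (A - {v}))\<^sup>* \<and> (b, xb) \<in> (adj (low ?EA c) en (A - {v}))\<^sup>*"
        proof (rule two_blocks_linked[OF ktA A(2) _ _ na[OF 1(1)] xa(2)[OF 1(1)] xb(2)[OF 1(2)]
              FA[OF 1(1) F(1)] FA[OF 1(2) F(2)]])
          fix B assume B: "tight_set k A ?EA en B"
          then have "B \<subseteq> A" by (simp add: tight_set_def)
          then have "card B \<le> card A" using fin AV finite_subset card_mono by metis
          then show "linkable k B (induced ?EA en B) en"
            using cA by (intro IH induced_ktight[OF ktA B]) simp
        qed (use 1 ab in auto)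
        then show ?thesis by blast
      next
        case 2
        obtain c where "linked_packing k A ?EA en v a xa (Fa \<union> {}) c"
          using linkableD[OF lA A(2) _ xa(1) xa(2) FA[OF 2(1) F(1)] no] 2 ab by blast
        then show ?thesis using 2 unfolding linked_packing_def by auto
      next
        case 3
        obtain c where "linked_packing k A ?EA en v b xb (Fb \<union> {}) c"
          using linkableD[OF lA A(2) _ xb(1) xb(2) FA[OF 3(2) F(2)] no] 3 ab by blast
        then show ?thesis using 3 unfolding linked_packing_def by auto
      next
        case 4
        then show ?thesis using nash_williams[OF ktA k] by blast
      qed
    qed
    then obtain c1 where c1: "packing k A ?EA en c1"
      "a \<in> A \<Longrightarrow> (\<forall>f\<in>Fa. c1 f < 2) \<and> (a, xa) \<in> (adj (low ?EA c1) en (A - {v}))\<^sup>*"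
      "b \<in> A \<Longrightarrow> (\<forall>f\<in>Fb. c1 f < 2) \<and> (b, xb) \<in> (adj (low ?EA c1) en (A - {v}))\<^sup>*" by blast
    define c where "c e = (if en e \<subseteq> A then c1 e else c2 e)" for e
    let ?R = "(adj (low E c) en (V - {v}))\<^sup>*"
    have pc: "packing k V E en c"
      using comb[OF c1(1), of c2] c2 unfolding linked_packing_def c_def[abs_def] by blast
    have tR: "(\<forall>f\<in>F0. c f < 2) \<and> (t, y) \<in> ?R"
      if F0: "root_edge E en v t F0" and y: "y \<in> V - A" and F': "\<forall>f\<in>F'. c2 f < 2"
        and t': "if t \<in> A then x \<in> A - {v} \<and> (t, x) \<in> (adj ?EA en (A - {v}))\<^sup>* \<and>
           (\<exists>p\<in>E. en p = {x, y} \<and> F' = {p}) else y = t \<and> F' = F0"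
        and tA: "t \<in> A \<Longrightarrow> (\<forall>f\<in>F0. c1 f < 2) \<and> (t, x) \<in> (adj (low ?EA c1) en (A - {v}))\<^sup>*"
      for t y x F0 F'
    proof (cases "t \<in> A")
      case True
      then obtain p where p: "p \<in> E" "en p = {x, y}" "F' = {p}" "x \<in> A - {v}" using t' by auto
      have 1: "(t, x) \<in> ?R" using AtoV[of t x c1 c2] tA[OF True] unfolding c_def by blast
      have "c p < 2" using p y F' by (auto simp: c_def)
      then have "(x, y) \<in> ?R" using p y A(2) AV by (intro adjI[of p]) auto
      then have "(t, y) \<in> ?R" using 1 by (rule rtrancl_trans[rotated])
      moreover have "c f < 2" if "f \<in> F0" for f
      proof -
        have "en f \<subseteq> A" using that F0 True A(2) by (auto simp: root_edge_def)
        then show ?thesis using tA[OF True] that by (simp add: c_def)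
      qed
      ultimately show ?thesis by blast
    next
      case False
      have "c f < 2" if "f \<in> F0" for f
      proof -
        have "t \<in> en f" using that F0 by (auto simp: root_edge_def)
        then show ?thesis using False t' F' that by (auto simp: c_def)
      qed
      then show ?thesis using False t' by auto
    qed
    have c2F: "\<forall>f\<in>Fa'. c2 f < 2" "\<forall>f\<in>Fb'. c2 f < 2" using c2 by (auto simp: linked_packing_def)
    have ra: "(\<forall>f\<in>Fa. c f < 2) \<and> (a, ya) \<in> ?R" by (rule tR[OF F(1) a'(1) c2F(1) a'(3) c1(2)])
    have rb: "(\<forall>f\<in>Fb. c f < 2) \<and> (b, yb) \<in> ?R" by (rule tR[OF F(2) b'(1) c2F(2) b'(3) c1(3)])
    have "(ya, yb) \<in> (adj (low ?E c2) ?en (V - A))\<^sup>*" using c2 VC by (simp add: linked_packing_def)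
    then have "(ya, yb) \<in> ?R"
    proof (rule adj_reach_mono)
      fix e assume e: "e \<in> low ?E c2" "?en e \<subseteq> V - A"
      then show "e \<in> low E c \<and> en e = ?en e" using out[OF e(2)] by (auto simp: c_def induced_def)
    qed (use A(2) in auto)
    from rtrancl_trans[OF conjunct2[OF ra] this] adj_reach_sym[OF conjunct2[OF rb]]
    have "(a, b) \<in> ?R" by (rule rtrancl_trans)
    then show ?thesis using pc ra rb unfolding linked_packing_def by blast
  qed
qed

section \<open>Splitting that respects the linking path\<close>

lemma split_reach_cases:
  assumes N: "split_pairs D s N h" and DL: "D \<inter> L = {}"
    and xy: "(x, y) \<in> (adj (low (L \<union> N) c) (split_ends en s N h) X)\<^sup>*"
  shows "(x, y) \<in> (adj (low L c) en X)\<^sup>* \<or>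
    (\<exists>p\<in>D. \<exists>q\<in>D. usable N h c p \<and> usable N h c q \<and> s p \<in> X \<and> s q \<in> X \<and>
      (x, s p) \<in> (adj (low L c) en X)\<^sup>* \<and> (s q, y) \<in> (adj (low L c) en X)\<^sup>*)"
  using xy
proof (induction rule: rtrancl_induct)
  case (step y z)
  have ND: "N \<subseteq> D" "h ` N \<subseteq> D" "inj_on h N" "N \<inter> h ` N = {}"
    using N by (auto simp: split_pairs_def)
  obtain e where e: "e \<in> L \<union> N" "c e < 2" "split_ends en s N h e = {y, z}" "y \<in> X" "z \<in> X"
    using step(2) by (auto simp: adj_def)
  show ?case
  proof (cases "e \<in> N")
    case False
    then have "e \<in> low L c" "en e = {y, z}" using e by (auto simp: split_ends_def)
    then have "(y, z) \<in> (adj (low L c) en X)\<^sup>*" using e(4,5) by (rule adjI)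
    then show ?thesis using step.IH by (meson rtrancl_trans)
  next
    case True
    have u1: "usable N h c e" using True e(2) ND(4) unfolding usable_def by auto
    have u2: "usable N h c (h e)" using True e(2) ND(3,4) unfolding usable_def inj_on_def by auto
    have eD: "e \<in> D" "h e \<in> D" using True ND by auto
    have "{s e, s (h e)} = {y, z}" using e(3) True by (simp add: split_ends_def)
    then obtain d d' where d: "d \<in> D" "d' \<in> D" "usable N h c d" "usable N h c d'" "s d = y" "s d' = z"
      using u1 u2 eD by (metis doubleton_eq_iff)
    from step.IH show ?thesis
    proof
      assume "(x, y) \<in> (adj (low L c) en X)\<^sup>*"
      then show ?thesis using d e(4,5) by blast
    next
      assume "\<exists>p\<in>D. \<exists>q\<in>D. usable N h c p \<and> usable N h c q \<and> s p \<in> X \<and> s q \<in> X \<and>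
        (x, s p) \<in> (adj (low L c) en X)\<^sup>* \<and> (s q, y) \<in> (adj (low L c) en X)\<^sup>*"
      then show ?thesis using d e(5) by blast
    qed
  qed
qed simp

text \<open>Take an edge by which the walk leaves the component of \<open>a\<close> in the graph
  without \<open>v\<close> and \<open>w\<close>: its other end can only be \<open>w\<close>.\<close>

lemma reach_to_vertex:
  assumes g: "graph_on V E en" and a: "a \<in> V - {v}" "a \<noteq> w"
    and ab: "(a, b) \<in> (adj E en (V - {v}))\<^sup>*"
    and nab: "(a, b) \<notin> (adj (E - star E en w) en (V - {w} - {v}))\<^sup>*"
  shows "\<exists>p\<in>star E en w. far_end en w p \<in> V - {w} - {v} \<and>
    (a, far_end en w p) \<in> (adj (E - star E en w) en (V - {w} - {v}))\<^sup>*"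
proof -
  let ?L = "E - star E en w" and ?X = "V - {w} - {v}"
  define Q where "Q = {z. (a, z) \<in> (adj ?L en ?X)\<^sup>*}"
  have "a \<in> Q" "b \<notin> Q" using nab by (auto simp: Q_def)
  then obtain x y where xy: "(x, y) \<in> adj E en (V - {v})" "x \<in> Q" "y \<notin> Q"
    using rtrancl_leave[OF ab] by blast
  then obtain e where e: "e \<in> E" "en e = {x, y}" "y \<in> V - {v}" by (auto simp: adj_def)
  have xQ: "(a, x) \<in> (adj ?L en ?X)\<^sup>*" using xy(2) by (simp add: Q_def)
  have xX: "x \<in> ?X" using adj_reach_in[OF xQ] a by simp
  have "y = w"
  proof (rule ccontr)
    assume "y \<noteq> w"
    then have "(x, y) \<in> (adj ?L en ?X)\<^sup>*" using e xX by (intro adjI[of e]) (auto simp: star_def)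
    then show False using xQ xy(3) unfolding Q_def by (metis mem_Collect_eq rtrancl_trans)
  qed
  then have "e \<in> star E en w" using e by (auto simp: star_def)
  moreover then have "far_end en w e = x"
    using far_end(1)[OF g, of e w] e(2) xX \<open>y = w\<close> by (auto simp: doubleton_eq_iff)
  ultimately show ?thesis using xQ xX by blast
qed

text \<open>The condition on \<open>card N\<close> makes the split graph \<open>ktight\<close> again
  and provides exactly the half edges required to undo the splitting.\<close>

definition complete_splitting where
  "complete_splitting k V E en w N h \<longleftrightarrow>
     split_pairs (star E en w) (far_end en w) N h \<and> card N + k = card (star E en w) \<and>
     sparse k (V - {w}) (E - star E en w \<union> N) (split_ends en (far_end en w) N h)"

lemma ex_complete_splitting:
  assumes kt: "ktight k V E en" and w: "w \<in> V" "V \<noteq> {w}" and deg: "card (star E en w) < 2 * k"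
  shows "\<exists>N h. complete_splitting k V E en w N h"
  using split_complete[OF vertex_split(2)[OF kt w deg]] vertex_split(1)[OF kt w deg]
  unfolding complete_splitting_def by fastforce

text \<open>Both strict inequalities of \<open>splittable\<close> concern tight sets of the original
  graph: sets with both far ends but without \<open>w\<close>, and sets \<open>insert w B\<close>
  without the far ends. Each has at least two vertices and is not \<open>V\<close>, so it is not
  tight.\<close>

lemma ex_splitting_pair:
  assumes kt: "ktight k V E en" and w: "w \<in> V" "V \<noteq> {w}" and deg: "card (star E en w) < 2 * k"
    and nt: "\<And>B. tight_set k V E en B \<Longrightarrow> B = V \<or> card B = 1"
    and pq: "p \<in> star E en w" "q \<in> star E en w" "far_end en w p \<noteq> far_end en w q"
  shows "\<exists>N h. complete_splitting k V E en w N h \<and> p \<in> N \<and> h p = q"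
proof -
  let ?D = "star E en w" and ?s = "far_end en w" and ?V = "V - {w}" and ?L = "E - star E en w"
  let ?r = "card ?D - k"
  note vs = vertex_split[OF kt w deg]
  have g: "graph_on V E en" using kt by (simp add: ktight_def)
  have fin: "finite V" "finite ?D" using g by (auto simp: graph_on_def star_def)
  have sp: "sparse k ?V ?L en" and tot: "?r + card ?L + k = k * card ?V"
    using vs(2) by (auto simp: split_state_def)
  have sV: "?s p \<in> ?V" "?s q \<in> ?V" using far_end(2)[OF g] pq by auto
  have ind: "induced ?L en X = induced E en X" if "X \<subseteq> ?V" for X
    using that by (auto simp: induced_def star_def)
  have T: "card (induced ?L en X) + k < k * card X" if X: "X \<subseteq> ?V" "?s p \<in> X" "?s q \<in> X" for X
  proof -
    have "card X \<noteq> 1" using X(2,3) pq(3) by (metis card_1_singletonE singletonD)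
    moreover have "X \<noteq> V" using X(1) w by auto
    ultimately have "\<not> tight_set k V E en X" using nt by blast
    then have "card (induced ?L en X) + k \<noteq> k * card X"
      using X ind[OF X(1)] unfolding tight_set_def by auto
    moreover have "card (induced ?L en X) + k \<le> k * card X" using sparseD[OF sp X(1)] X(2) by blast
    ultimately show ?thesis by simp
  qed
  have "induced ?L en ?V = ?L" using g by (auto simp: induced_def graph_on_def star_def)
  \<comment> \<open>Strictness for \<open>V - {w}\<close> itself shows that at least one pair is
    due.\<close>
  then have r: "?r \<ge> 1" using T[of ?V] sV tot by simp
  have "splittable k ?V ?L en ?D ?s ?r p q" unfolding splittable_def
  proof (intro conjI allI impI)
    fix B assume B: "B \<subseteq> ?V" "B \<noteq> {} \<and> ?s p \<notin> B \<and> ?s q \<notin> B"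
    have "insert w B \<noteq> V" using B sV by auto
    moreover have "card (insert w B) \<noteq> 1" using B by (auto simp: card_1_singleton_iff)
    ultimately have "\<not> tight_set k V E en (insert w B)" using nt by blast
    then show "?r + card (induced ?L en B) + k < k * card B + card {d \<in> ?D. ?s d \<notin> B}"
      using vs(3) B by blast
  qed (use pq T in auto)
  then have "split_state k ?V (insert p ?L) (en(p := {?s p, ?s q})) (?D - {p, q}) ?s (?r - 1)"
    by (rule split_update[OF vs(2) r])
  then obtain N h where N: "split_pairs (?D - {p, q}) ?s N h" "card N = ?r - 1"
    "sparse k ?V (insert p ?L \<union> N) (split_ends (en(p := {?s p, ?s q})) ?s N h)"
    using split_complete by blast
  note S = split_step[OF N(1,3) pq fin(2)]
  have "card (insert p N) + k = card ?D" using S(2) N(2) r vs(1) by simp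
  then have "complete_splitting k V E en w (insert p N) (h(p := q))"
    using S(1,3) unfolding complete_splitting_def by blast
  then show ?thesis by (metis fun_upd_same insertI1)
qed

text \<open>Withholding \<open>p\<close> costs the last condition of \<open>split_state\<close> at
  most 1. There is slack for every \<open>B\<close> except \<open>V - {w}\<close>, and no half edge
  ends outside that set. The degree bound leaves a half edge to spare.\<close>

lemma ex_splitting_avoiding:
  assumes kt: "ktight k V E en" and w: "w \<in> V" "V \<noteq> {w}" and deg: "card (star E en w) < 2 * k"
    and nt: "\<And>B. tight_set k V E en B \<Longrightarrow> B = V \<or> card B = 1"
    and p: "p \<in> star E en w"
  shows "\<exists>N h. complete_splitting k V E en w N h \<and> p \<notin> N \<and> p \<notin> h ` N"
proof -
  let ?D = "star E en w" and ?s = "far_end en w" and ?V = "V - {w}" and ?L = "E - star E en w"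
  let ?r = "card ?D - k"
  note vs = vertex_split[OF kt w deg]
  have st: "?V \<noteq> {}" "graph_on ?V ?L en" "finite ?D" "?D \<inter> ?L = {}" "?s ` ?D \<subseteq> ?V" "sparse k ?V ?L en"
    "?r + card ?L + k = k * card ?V" using vs(2) by (auto simp: split_state_def)
  have out: "card {d \<in> ?D. ?s d \<notin> B} \<le> card {d \<in> ?D - {p}. ?s d \<notin> B} + 1" for B
  proof -
    have "card {d \<in> ?D. ?s d \<notin> B} \<le> card (insert p {d \<in> ?D - {p}. ?s d \<notin> B})"
      by (rule card_mono) (use st(3) in auto)
    then show ?thesis using st(3) by (simp add: card_insert_if split: if_splits)
  qed
  have "?r + card (induced ?L en B) + k \<le> k * card B + card {d \<in> ?D - {p}. ?s d \<notin> B}"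
    if B: "B \<subseteq> ?V" "B \<noteq> {}" for B
  proof (cases "B = ?V")
    case True
    have "induced ?L en ?V = ?L" using st(2) by (auto simp: induced_def graph_on_def)
    then show ?thesis using st(7) True by simp
  next
    case False
    have "insert w B \<noteq> V" using B False by auto
    moreover have "card (insert w B) \<noteq> 1" using B by (auto simp: card_1_singleton_iff)
    ultimately have "\<not> tight_set k V E en (insert w B)" using nt by blast
    then show ?thesis using vs(3)[OF B] out[of B] by simp
  qed
  moreover have "2 * ?r \<le> card (?D - {p})" using p st(3) deg by (simp add: card_Diff_singleton)
  ultimately have "split_state k ?V ?L en (?D - {p}) ?s ?r"
    unfolding split_state_def using st by blast
  then obtain N h where N: "split_pairs (?D - {p}) ?s N h" "card N = ?r"
    "sparse k ?V (?L \<union> N) (split_ends en ?s N h)" using split_complete by blast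
  have "split_pairs ?D ?s N h" "p \<notin> N" "p \<notin> h ` N" using N(1) by (auto simp: split_pairs_def)
  then show ?thesis using N(2,3) vs(1) unfolding complete_splitting_def by fastforce
qed

lemma root_edge_split:
  assumes N: "complete_splitting k V E en w N h" and w: "w \<noteq> v" "w \<noteq> t" and F: "root_edge E en v t F"
  shows "root_edge (E - star E en w \<union> N) (split_ends en (far_end en w) N h) v t F"
    "F \<subseteq> E - star E en w"
proof -
  have "f \<in> E - star E en w \<and> f \<notin> N" if "f \<in> F" for f
    using that N w F unfolding root_edge_def complete_splitting_def split_pairs_def star_def by auto
  then show "root_edge (E - star E en w \<union> N) (split_ends en (far_end en w) N h) v t F"
    "F \<subseteq> E - star E en w" using F unfolding root_edge_def split_ends_def by auto
qed

text \<open>If the linking path uses new edges, the stretch from the first to the last of them is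
  replaced by a detour over \<open>w\<close>, whose two edges can be given low colours.\<close>

lemma splitting_at_inner_vertex:
  assumes kt: "ktight k V E en" and k: "k \<ge> 2" and w: "w \<in> V" "V \<noteq> {w}" "w \<noteq> v" "w \<noteq> a" "w \<noteq> b"
    and v: "v \<in> V" and ab: "a \<in> V - {v}" "b \<in> V - {v}"
    and F: "root_edge E en v a Fa" "root_edge E en v b Fb"
    and N: "complete_splitting k V E en w N h"
    and lk: "linkable k (V - {w}) (E - star E en w \<union> N) (split_ends en (far_end en w) N h)"
    and reach: "(a, b) \<in> (adj (E - star E en w \<union> N) (split_ends en (far_end en w) N h) (V - {w} - {v}))\<^sup>*"
  shows "\<exists>c. linked_packing k V E en v a b (Fa \<union> Fb) c"
proof -
  let ?D = "star E en w" and ?s = "far_end en w" and ?V = "V - {w}" and ?L = "E - star E en w"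
  let ?en = "split_ends en ?s N h"
  have g: "graph_on V E en" using kt by (simp add: ktight_def)
  have N': "split_pairs ?D ?s N h" "card N + k = card ?D" using N by (auto simp: complete_splitting_def)
  obtain c where c: "linked_packing k ?V (?L \<union> N) ?en v a b (Fa \<union> Fb) c"
    using linkableD[OF lk _ _ _ reach root_edge_split(1)[OF N w(3,4) F(1)] root_edge_split(1)[OF N w(3,5) F(2)]]
      v ab w by blast
  have pc: "packing k ?V (?L \<union> N) ?en c" and rc: "(a, b) \<in> (adj (low (?L \<union> N) c) ?en (?V - {v}))\<^sup>*"
    and Fc: "\<forall>f \<in> Fa \<union> Fb. c f < 2" using c by (auto simp: linked_packing_def)
  note lift = lift_off[OF kt w(1,2) N' pc k]
  have FL: "Fa \<union> Fb \<subseteq> ?L" using root_edge_split(2)[OF N w(3,4) F(1)] root_edge_split(2)[OF N w(3,5) F(2)] by auto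
  have mono: "(x, y) \<in> (adj (low E c') en (V - {v}))\<^sup>*"
    if "(x, y) \<in> (adj (low ?L c) en (?V - {v}))\<^sup>*" "\<forall>e\<in>?L. c' e = c e" for x y c'
    by (rule adj_reach_mono[OF that(1)]) (use that(2) in auto)
  have "?D \<inter> ?L = {}" by auto
  from split_reach_cases[OF N'(1) this rc] show ?thesis
  proof
    assume r: "(a, b) \<in> (adj (low ?L c) en (?V - {v}))\<^sup>*"
    obtain c' where c': "packing k V E en c'" "\<forall>e\<in>?L. c' e = c e" using lift(1) by blast
    then show ?thesis using mono[OF r c'(2)] FL Fc unfolding linked_packing_def by (metis subsetD)
  next
    assume "\<exists>p\<in>?D. \<exists>q\<in>?D. usable N h c p \<and> usable N h c q \<and> ?s p \<in> ?V - {v} \<and> ?s q \<in> ?V - {v} \<and>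
      (a, ?s p) \<in> (adj (low ?L c) en (?V - {v}))\<^sup>* \<and> (?s q, b) \<in> (adj (low ?L c) en (?V - {v}))\<^sup>*"
    then obtain p q where p: "p \<in> ?D" "q \<in> ?D" "usable N h c p" "usable N h c q" "?s p \<in> ?V - {v}"
      "?s q \<in> ?V - {v}" "(a, ?s p) \<in> (adj (low ?L c) en (?V - {v}))\<^sup>*"
      "(?s q, b) \<in> (adj (low ?L c) en (?V - {v}))\<^sup>*" by blast
    obtain c' where c': "packing k V E en c'" "\<forall>e\<in>?L. c' e = c e" "c' p < 2" "c' q < 2"
      using lift(2)[OF p(1-4)] by blast
    have pE: "p \<in> E" "q \<in> E" using p by (auto simp: star_def)
    have 1: "(?s p, w) \<in> (adj (low E c') en (V - {v}))\<^sup>*"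
      using far_end(1)[OF g p(1)] pE p(5) c' w by (intro adjI[of p]) auto
    have 2: "(w, ?s q) \<in> (adj (low E c') en (V - {v}))\<^sup>*"
      using far_end(1)[OF g p(2)] pE p(6) c' w by (intro adjI[of q]) auto
    have "(a, b) \<in> (adj (low E c') en (V - {v}))\<^sup>*"
      using rtrancl_trans[OF rtrancl_trans[OF mono[OF p(7) c'(2)] 1] rtrancl_trans[OF 2 mono[OF p(8) c'(2)]]] .
    then show ?thesis using c' FL Fc unfolding linked_packing_def by (metis subsetD)
  qed
qed

text \<open>Here \<open>w\<close> itself is linked. The path starts with \<open>p\<close>, or with
  the half edge behind the last new edge if it uses one. \<open>g\<close> stands for the prescribed
  root edge and may coincide with \<open>p\<close> if there is none, so at most two half edges must
  become low.\<close>

lemma splitting_at_end_vertex: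
  assumes kt: "ktight k V E en" and k: "k \<ge> 2" and w: "w \<in> V" "V \<noteq> {w}" "w \<noteq> v" "w \<noteq> b"
    and F: "Fa \<subseteq> {g}" "root_edge E en v b Fb"
    and N: "complete_splitting k V E en w N h"
    and p: "p \<in> star E en w" "g \<in> star E en w" "far_end en w p \<noteq> v" "usable N h c p" "usable N h c g"
    and c: "linked_packing k (V - {w}) (E - star E en w \<union> N) (split_ends en (far_end en w) N h) v
      (far_end en w p) b (F' \<union> Fb) c"
  shows "\<exists>c. linked_packing k V E en v w b (Fa \<union> Fb) c"
proof -
  let ?D = "star E en w" and ?s = "far_end en w" and ?V = "V - {w}" and ?L = "E - star E en w"
  let ?en = "split_ends en ?s N h"
  have g: "graph_on V E en" using kt by (simp add: ktight_def)
  have N': "split_pairs ?D ?s N h" "card N + k = card ?D" using N by (auto simp: complete_splitting_def)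
  have pc: "packing k ?V (?L \<union> N) ?en c" and rc: "(?s p, b) \<in> (adj (low (?L \<union> N) c) ?en (?V - {v}))\<^sup>*"
    and Fc: "\<forall>f \<in> Fb. c f < 2" using c by (auto simp: linked_packing_def)
  have FL: "Fb \<subseteq> ?L" using root_edge_split(2)[OF N w(3,4) F(2)] .
  have fin: ?thesis if q: "q \<in> ?D" "usable N h c q" "?s q \<noteq> v"
    and r: "(?s q, b) \<in> (adj (low ?L c) en (?V - {v}))\<^sup>*" for q
  proof -
    obtain c' where c': "packing k V E en c'" "\<forall>e\<in>?L. c' e = c e" "c' g < 2" "c' q < 2"
      using lift_off(2)[OF kt w(1,2) N' pc k p(2) q(1) p(5) q(2)] by blast
    have "(w, ?s q) \<in> (adj (low E c') en (V - {v}))\<^sup>*"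
      using far_end[OF g q(1)] q c' w by (intro adjI[of q]) (auto simp: star_def)
    moreover have "(?s q, b) \<in> (adj (low E c') en (V - {v}))\<^sup>*"
      by (rule adj_reach_mono[OF r]) (use c' in auto)
    ultimately have "(w, b) \<in> (adj (low E c') en (V - {v}))\<^sup>*" by (rule rtrancl_trans)
    then show ?thesis using c' F(1) FL Fc unfolding linked_packing_def
      by (metis Un_iff singletonD subsetD)
  qed
  have "?D \<inter> ?L = {}" by auto
  from split_reach_cases[OF N'(1) this rc] show ?thesis
    using fin[OF p(1,4,3)] fin by blast
qed

text \<open>For \<open>w\<close> other than \<open>a\<close>, the two edges leading to
  \<open>w\<close> from \<open>a\<close> and from \<open>b\<close> are paired if the path cannot
  avoid \<open>w\<close>. For \<open>w = a\<close> without a root edge, a half edge \<open>p\<close>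
  towards \<open>b\<close> stays unpaired and can therefore get a low colour. With a root edge
  \<open>f\<close>, the pair \<open>f\<close>, \<open>p\<close> becomes a root edge of the far end
  of \<open>p\<close>; prescribing it makes both usable.\<close>

lemma no_tight_linked:
  fixes V :: "'v set" and E :: "'e set"
  assumes kt: "ktight k V E en" and k: "k \<ge> 2"
    and nt: "\<And>B. tight_set k V E en B \<Longrightarrow> B = V \<or> card B = 1"
    and IH: "\<And>(V' :: 'v set) (E' :: 'e set) en'. card V' < card V \<Longrightarrow> ktight k V' E' en' \<Longrightarrow> linkable k V' E' en'"
    and v: "v \<in> V" and ab: "a \<in> V - {v}" "b \<in> V - {v}" "a \<noteq> b" "(a, b) \<in> (adj E en (V - {v}))\<^sup>*"
    and F: "root_edge E en v a Fa" "root_edge E en v b Fb"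
    and w: "w \<in> V - {v}" "card (star E en w) < 2 * k" "w \<noteq> b"
  shows "\<exists>c. linked_packing k V E en v a b (Fa \<union> Fb) c"
proof -
  let ?D = "star E en w" and ?s = "far_end en w" and ?V = "V - {w}" and ?L = "E - star E en w"
  have g: "graph_on V E en" and fV: "finite V" using kt by (auto simp: ktight_def graph_on_def)
  have w': "w \<in> V" "V \<noteq> {w}" "w \<noteq> v" using w v by auto
  have cV: "card ?V < card V" using fV w'(1) by (rule card_Diff1_less)
  have lk: "linkable k ?V (?L \<union> N) (split_ends en ?s N h)" if "complete_splitting k V E en w N h" for N h
    using that unfolding complete_splitting_def
    by (intro IH[OF cV] split_off_ktight[OF kt w'(1,2) w(2)]) auto
  have mono: "(x, y) \<in> (adj (?L \<union> N) (split_ends en ?s N h) (?V - {v}))\<^sup>*"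
    if "(x, y) \<in> (adj ?L en (?V - {v}))\<^sup>*" "complete_splitting k V E en w N h" for x y N h
    by (rule adj_reach_mono[OF that(1)])
      (use that(2) in \<open>auto simp: split_ends_def complete_splitting_def split_pairs_def\<close>)
  show ?thesis
  proof (cases "w = a")
    case False
    note inner = splitting_at_inner_vertex[OF kt k w' False w(3) v ab(1,2) F]
    show ?thesis
    proof (cases "(a, b) \<in> (adj ?L en (?V - {v}))\<^sup>*")
      case True
      obtain N h where N: "complete_splitting k V E en w N h"
        using ex_complete_splitting[OF kt w'(1,2) w(2)] by blast
      show ?thesis by (rule inner[OF N lk[OF N] mono[OF True N]])
    next
      case nab: False
      then have nba: "(b, a) \<notin> (adj ?L en (?V - {v}))\<^sup>*" using adj_reach_sym by metis
      obtain p where p: "p \<in> ?D" "?s p \<in> ?V - {v}" "(a, ?s p) \<in> (adj ?L en (?V - {v}))\<^sup>*"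
        using reach_to_vertex[OF g ab(1) not_sym[OF False] ab(4) nab] by blast
      obtain q where q: "q \<in> ?D" "?s q \<in> ?V - {v}" "(b, ?s q) \<in> (adj ?L en (?V - {v}))\<^sup>*"
        using reach_to_vertex[OF g ab(2) not_sym[OF w(3)] adj_reach_sym[OF ab(4)] nba] by blast
      have "?s p \<noteq> ?s q"
        using rtrancl_trans[OF p(3)] adj_reach_sym[OF q(3)] nab by metis
      then obtain N h where N: "complete_splitting k V E en w N h" "p \<in> N" "h p = q"
        using ex_splitting_pair[OF kt w'(1,2) w(2) nt p(1) q(1)] by blast
      have "(?s p, ?s q) \<in> (adj (?L \<union> N) (split_ends en ?s N h) (?V - {v}))\<^sup>*"
        using p q N by (intro adjI[of p]) (auto simp: split_ends_def)
      then have "(a, b) \<in> (adj (?L \<union> N) (split_ends en ?s N h) (?V - {v}))\<^sup>*"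
        using mono[OF p(3) N(1)] adj_reach_sym[OF mono[OF q(3) N(1)]] by (meson rtrancl_trans)
      then show ?thesis by (rule inner[OF N(1) lk[OF N(1)]])
    qed
  next
    case wa: True
    have "(b, a) \<notin> (adj ?L en (?V - {v}))\<^sup>*"
      using adj_reach_in[of b a ?L en "?V - {v}"] ab w wa by auto
    then obtain p where p: "p \<in> ?D" "?s p \<in> ?V - {v}" "(b, ?s p) \<in> (adj ?L en (?V - {v}))\<^sup>*"
      using reach_to_vertex[OF g ab(2) not_sym[OF w(3)] adj_reach_sym[OF ab(4)]] by blast
    have vV: "v \<in> ?V" "b \<in> ?V - {v}" using v w' ab w by auto
    show ?thesis
    proof (cases "Fa = {}")
      case True
      obtain N h where N: "complete_splitting k V E en w N h" "p \<notin> N" "p \<notin> h ` N"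
        using ex_splitting_avoiding[OF kt w'(1,2) w(2) nt p(1)] by blast
      have up: "usable N h c p" for c using N by (auto simp: usable_def)
      have re: "root_edge (?L \<union> N) (split_ends en ?s N h) v (?s p) {}" by (simp add: root_edge_def)
      obtain c where c: "linked_packing k ?V (?L \<union> N) (split_ends en ?s N h) v (?s p) b ({} \<union> Fb) c"
        using linkableD[OF lk[OF N(1)] vV(1) p(2) vV(2) adj_reach_sym[OF mono[OF p(3) N(1)]] re
            root_edge_split(1)[OF N(1) w'(3) w(3) F(2)]] by blast
      show ?thesis unfolding wa[symmetric]
        by (rule splitting_at_end_vertex[OF kt k w' w(3) _ F(2) N(1) p(1) p(1) _ up up c])
          (use True p in auto)
    next
      case False
      then obtain f where f: "f \<in> E" "en f = {v, a}" "Fa = {f}" using F(1) unfolding root_edge_def by blast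
      have fD: "f \<in> ?D" using f wa by (auto simp: star_def)
      have "?s f = v" using far_end[OF g fD] f(2) wa w' by (auto simp: doubleton_eq_iff)
      then have "?s f \<noteq> ?s p" using p(2) by auto
      then obtain N h where N: "complete_splitting k V E en w N h" "f \<in> N" "h f = p"
        using ex_splitting_pair[OF kt w'(1,2) w(2) nt fD p(1)] by blast
      have re: "root_edge (?L \<union> N) (split_ends en ?s N h) v (?s p) {f}"
        using N \<open>?s f = v\<close> by (auto simp: root_edge_def split_ends_def)
      obtain c where c: "linked_packing k ?V (?L \<union> N) (split_ends en ?s N h) v (?s p) b ({f} \<union> Fb) c"
        using linkableD[OF lk[OF N(1)] vV(1) p(2) vV(2) adj_reach_sym[OF mono[OF p(3) N(1)]] re
            root_edge_split(1)[OF N(1) w'(3) w(3) F(2)]] by blast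
      have "c f < 2" using c by (simp add: linked_packing_def)
      then have "usable N h c f" "usable N h c p"
        using N unfolding usable_def complete_splitting_def split_pairs_def inj_on_def by auto
      then show ?thesis unfolding wa[symmetric]
        using splitting_at_end_vertex[OF kt k w' w(3) _ F(2) N(1) p(1) fD _ _ _ c, of Fa] p(2) f(3) by auto
    qed
  qed
qed

lemma ktight_linkable:
  assumes "ktight k V E en" "k \<ge> 2"
  shows "linkable k V E en"
  using assms
proof (induction "card V" arbitrary: V E en rule: less_induct)
  case less
  note kt = less.prems(1) and k = less.prems(2)
  have IH: "linkable k V' E' en'" if "card V' < card V" "ktight k V' E' en'" for V' E' and en' :: "'b \<Rightarrow> 'a set"
    using less.hyps[OF that k] .
  have fin: "finite V" "finite E" and g: "graph_on V E en" and sp: "sparse k V E en"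
    and tot: "card E + k = k * card V" using kt by (auto simp: ktight_def graph_on_def)
  show ?case unfolding linkable_def
  proof (intro allI impI)
    fix v a b Fa Fb
    assume v: "v \<in> V" and ab: "a \<in> V - {v}" "b \<in> V - {v}" "(a, b) \<in> (adj E en (V - {v}))\<^sup>*"
      and F: "root_edge E en v a Fa" "root_edge E en v b Fb"
    show "\<exists>c. linked_packing k V E en v a b (Fa \<union> Fb) c"
    proof (cases "a = b")
      case True
      then show ?thesis using linked_packing_same[OF kt k F] by simp
    next
      case anb: False
      \<comment> \<open>A tight set without \<open>v\<close> is never \<open>V\<close>, so
        \<open>card A \<noteq> 1\<close> already makes it nontrivial.\<close>
      consider (out) A where "tight_set k V E en A" "v \<notin> A" "card A \<noteq> 1"
        | (root) A where "tight_set k V E en A" "v \<in> A" "A \<noteq> {v}" "A \<noteq> V"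
        | (none) "\<And>B. tight_set k V E en B \<Longrightarrow> B = V \<or> card B = 1"
        by (metis card_1_singletonE is_singletonI is_singleton_altdef singletonD)
      then show ?thesis
      proof cases
        case out
        then obtain z where z: "z \<in> A" by (auto simp: tight_set_def)
        have AV: "A \<subseteq> V" "finite A" using out fin by (auto simp: tight_set_def intro: finite_subset)
        have "card (insert z (V - A)) < card V"
        proof -
          have "A \<noteq> {z}" using out(3) by auto
          then have "insert z (V - A) \<subset> V" using z AV by blast
          then show ?thesis using fin by (simp add: psubset_card_mono)
        qed
        then have "linkable k (insert z (V - A)) (E - induced E en A) (contract_ends en A z)"
          by (rule IH) (rule contract_ktight[OF kt out(1) z])
        then show ?thesis by (rule contract_linked[OF kt out(1,2) z k _ v ab F])
      next
        case root
        then obtain M where M: "tight_set k V E en M \<and> M \<noteq> V" "A \<subseteq> M"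
          "\<forall>B. (tight_set k V E en B \<and> B \<noteq> V) \<and> M \<subseteq> B \<longrightarrow> B = M"
          using ex_maximal_set[OF fin(1), of "\<lambda>B. tight_set k V E en B \<and> B \<noteq> V" A]
          by (auto simp: tight_set_def)
        have "v \<in> M" "M \<noteq> {v}" using M(2) root(2,3) by auto
        then show ?thesis
          using root_tight_linked[OF kt k _ _ _ _ _ IH ab F, of M] M by blast
      next
        case none
        \<comment> \<open>Otherwise all k(n - 1) edges would lie in \<open>V - {v}\<close>, which
          admits only k(n - 2).\<close>
        have "card (star E en v) > 0"
        proof (rule ccontr)
          assume "\<not> ?thesis"
          then have "star E en v = {}" using fin by (simp add: star_def)
          then have "induced E en (V - {v}) = E" using g by (auto simp: induced_def star_def graph_on_def)
          then have "card E + k \<le> k * card (V - {v})" using sparseD[OF sp, of "V - {v}"] ab(1) by auto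
          moreover have "card (V - {v}) < card V" using fin(1) v by (rule card_Diff1_less)
          ultimately show False using tot k by simp
        qed
        then obtain w where w: "w \<in> V - {v}" "card (star E en w) < 2 * k"
          using ex_low_degree(2)[OF g tot _ v] k by auto
        show ?thesis
        \<comment> \<open>\<open>no_tight_linked\<close> admits \<open>w = a\<close> but not
          \<open>w = b\<close>; the claim is symmetric in \<open>a\<close> and
          \<open>b\<close>.\<close>
        proof (cases "w = b")
          case False
          show ?thesis by (rule no_tight_linked[OF kt k none IH v ab(1,2) anb ab(3) F w False])
        next
          case True
          then have "w \<noteq> a" using anb by auto
          then obtain c where "linked_packing k V E en v b a (Fb \<union> Fa) c"
            using no_tight_linked[OF kt k none IH v ab(2,1) not_sym[OF anb] adj_reach_sym[OF ab(3)] F(2,1) w]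
            by blast
          then have "linked_packing k V E en v a b (Fa \<union> Fb) c" by (rule linked_packing_swap)
          then show ?thesis by blast
        qed
      qed
    qed
  qed
qed

section \<open>Passing from the multigraph to a tight edge set\<close>

text \<open>Take a maximal sparse set \<open>E'\<close> over \<open>P\<close>. Its maximal tight
  sets \<open>M\<close> partition \<open>V\<close> and induce k(|M| - 1) edges each, and all edges
  of \<open>E\<close> inside no such set belong to \<open>E'\<close>. With the partition condition
  this adds up to k(n - 1) edges.\<close>

lemma ex_ktight_subgraph:
  assumes g: "graph_on V E en" and V: "V \<noteq> {}" and P: "P \<subseteq> E" "sparse k V P en"
    and part: "\<And>\<X>. \<lbrakk>\<Union>\<X> = V; {} \<notin> \<X>; \<forall>X\<in>\<X>. \<forall>Y\<in>\<X>. X \<noteq> Y \<longrightarrow> X \<inter> Y = {}\<rbrakk> \<Longrightarrow>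
        k * card \<X> \<le> card {e \<in> E. \<forall>X\<in>\<X>. \<not> en e \<subseteq> X} + k"
  shows "\<exists>E'. P \<subseteq> E' \<and> E' \<subseteq> E \<and> ktight k V E' en"
proof -
  have fin: "finite V" "finite E" and ge: "\<And>e. e \<in> E \<Longrightarrow> en e \<subseteq> V \<and> card (en e) = 2"
    using g by (auto simp: graph_on_def)
  obtain E' where E': "E' \<subseteq> E" "sparse k V E' en" "P \<subseteq> E'"
    and max: "\<And>B. B \<subseteq> E \<Longrightarrow> sparse k V B en \<Longrightarrow> E' \<subseteq> B \<Longrightarrow> B = E'"
    using ex_maximal_set[OF fin(2), of "\<lambda>B. B \<subseteq> E \<and> sparse k V B en" P] P by auto
  have fE': "finite E'" using E'(1) fin(2) finite_subset by blast
  let ?t = "tight_set k V E' en"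
  have single: "?t {x}" if "x \<in> V" for x
  proof -
    have "induced E' en {x} = {}"
    proof (rule ccontr)
      assume "induced E' en {x} \<noteq> {}"
      then obtain e where "e \<in> E" "en e \<subseteq> {x}" using E'(1) by (auto simp: induced_def)
      then show False using ge[of e] card_mono[of "{x}" "en e"] by simp
    qed
    then show ?thesis using that by (simp add: tight_set_def)
  qed
  define \<X> where "\<X> = {M. ?t M \<and> (\<forall>B. ?t B \<longrightarrow> M \<subseteq> B \<longrightarrow> B = M)}"
  have ext: "\<exists>M\<in>\<X>. A \<subseteq> M" if tA: "?t A" for A
  proof -
    have subV: "\<And>B. ?t B \<Longrightarrow> B \<subseteq> V" by (simp add: tight_set_def)
    obtain M where M: "?t M" "A \<subseteq> M" "\<forall>B. ?t B \<and> M \<subseteq> B \<longrightarrow> B = M"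
      using ex_maximal_set[OF fin(1), of ?t, OF tA subV] by blast
    then have "M \<in> \<X>" unfolding \<X>_def by blast
    with M(2) show ?thesis by blast
  qed
  have X: "M \<subseteq> V" "M \<noteq> {}" "card (induced E' en M) + k = k * card M" if "M \<in> \<X>" for M
    using that by (auto simp: \<X>_def tight_set_def)
  \<comment> \<open>Singletons are tight, so every vertex lies in a maximal tight set.\<close>
  have UX: "\<Union>\<X> = V"
  proof
    show "V \<subseteq> \<Union>\<X>" using ext[OF single] by blast
  qed (use X(1) in blast)
  have dis: "M = M'" if "M \<in> \<X>" "M' \<in> \<X>" "M \<inter> M' \<noteq> {}" for M M'
  proof -
    have "?t (M \<union> M')"
      by (rule tight_set_Un[OF fin(1) fE' E'(2) _ _ that(3)]) (use that in \<open>auto simp: \<X>_def\<close>)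
    then have "M \<union> M' = M" "M \<union> M' = M'" using that unfolding \<X>_def by blast+
    then show ?thesis by simp
  qed
  have finX: "finite \<X>" "\<And>M. M \<in> \<X> \<Longrightarrow> finite M"
    using UX fin(1) finite_UnionD by (auto intro: finite_subset)
  let ?C = "{e \<in> E. \<forall>X\<in>\<X>. \<not> en e \<subseteq> X}"
  \<comment> \<open>Adding an edge outside \<open>E'\<close> violates sparsity on some
    \<open>B\<close>. Then \<open>B\<close> is tight, so a member of the partition contains both
    ends of the edge.\<close>
  have CE: "?C \<subseteq> E'"
  proof (rule ccontr)
    assume "\<not> ?C \<subseteq> E'"
    then obtain e where e: "e \<in> E" "\<forall>X\<in>\<X>. \<not> en e \<subseteq> X" "e \<notin> E'" by blast
    have "\<not> sparse k V (insert e E') en" using max[of "insert e E'"] e E'(1) by auto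
    then obtain B where B: "B \<subseteq> V" "B \<noteq> {}" "\<not> card (induced (insert e E') en B) + k \<le> k * card B"
      unfolding sparse_def by blast
    have sB: "card (induced E' en B) + k \<le> k * card B" by (rule sparseD[OF E'(2) B(1,2)])
    have "en e \<subseteq> B"
    proof (rule ccontr)
      assume "\<not> en e \<subseteq> B"
      then have "induced (insert e E') en B = induced E' en B" by (auto simp: induced_def)
      then show False using B(3) sB by simp
    qed
    then have "induced (insert e E') en B = insert e (induced E' en B)" by (auto simp: induced_def)
    then have "card (induced (insert e E') en B) \<le> Suc (card (induced E' en B))"
      using fE' by (simp add: card_insert_if)
    then have "?t B" using B sB unfolding tight_set_def by auto
    then show False using ext[of B] e(2) \<open>en e \<subseteq> B\<close> by blast
  qed
  have "E' = (\<Union>M\<in>\<X>. induced E' en M) \<union> ?C" using CE E'(1) by (auto simp: induced_def)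
  moreover have "(\<Union>M\<in>\<X>. induced E' en M) \<inter> ?C = {}" by (auto simp: induced_def)
  ultimately have "card E' = card (\<Union>M\<in>\<X>. induced E' en M) + card ?C"
    using fE' finX(1) fin(2) card_Un_disjoint[of "\<Union>M\<in>\<X>. induced E' en M" ?C] by simp
  also have "card (\<Union>M\<in>\<X>. induced E' en M) = (\<Sum>M\<in>\<X>. card (induced E' en M))"
  proof (rule card_UN_disjoint[OF finX(1)])
    show "\<forall>M\<in>\<X>. \<forall>M'\<in>\<X>. M \<noteq> M' \<longrightarrow> induced E' en M \<inter> induced E' en M' = {}"
    proof (intro ballI impI)
      fix M M' assume M: "M \<in> \<X>" "M' \<in> \<X>" "M \<noteq> M'"
      show "induced E' en M \<inter> induced E' en M' = {}"
      proof (rule ccontr)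
        assume "\<not> ?thesis"
        then obtain e where e: "e \<in> E" "en e \<subseteq> M \<inter> M'" using E'(1) by (auto simp: induced_def)
        then have "en e = {}" using dis[OF M(1,2)] M(3) by blast
        then show False using ge[OF e(1)] by simp
      qed
    qed
  qed (use fE' in auto)
  finally have cE: "card E' = (\<Sum>M\<in>\<X>. card (induced E' en M)) + card ?C" .
  have "(\<Sum>M\<in>\<X>. card (induced E' en M)) + k * card \<X> = (\<Sum>M\<in>\<X>. card (induced E' en M) + k)"
    by (subst sum.distrib) (simp add: mult.commute)
  also have "\<dots> = (\<Sum>M\<in>\<X>. k * card M)" by (rule sum.cong) (use X(3) in auto)
  also have "\<dots> = k * card (\<Union>\<X>)"
    using card_Union_disjoint[of \<X>] dis finX unfolding pairwise_def disjnt_def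
    by (metis sum_distrib_left)
  finally have "(\<Sum>M\<in>\<X>. card (induced E' en M)) + k * card \<X> = k * card V" using UX by simp
  moreover have "k * card \<X> \<le> card ?C + k" by (rule part[OF UX]) (use X(2) dis in blast)+
  ultimately have "k * card V \<le> card E' + k" using cE by linarith
  moreover have "card E' + k \<le> k * card V"
  proof -
    have "induced E' en V = E'" using E'(1) ge by (auto simp: induced_def)
    then show ?thesis using sparseD[OF E'(2) _ V] by (metis order_refl)
  qed
  moreover have "graph_on V E' en" using fin fE' E'(1) ge by (auto simp: graph_on_def)
  ultimately have "ktight k V E' en" using V E'(2) by (simp add: ktight_def)
  then show ?thesis using E' by blast
qed

section \<open>Edge counts of connected graphs\<close>

text \<open>Every vertex added to \<open>S\<close> comes with an edge that crossed the boundary of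
  \<open>S\<close>, so the induced set grows as well. At \<open>S = V\<close> this yields the n - 1
  edges of a connected graph.\<close>

lemma cut_connected_grow:
  assumes cc: "cut_connected F en V" and F: "finite F" "\<And>e. e \<in> F \<Longrightarrow> en e \<subseteq> V \<and> card (en e) = 2"
    and V: "finite V" "V \<noteq> {}"
  shows "n < card V \<Longrightarrow> \<exists>S \<subseteq> V. card S = Suc n \<and> n \<le> card (induced F en S)"
proof (induction n)
  case 0
  obtain x where "x \<in> V" using V by blast
  then show ?case by (intro exI[of _ "{x}"]) auto
next
  case (Suc n)
  then obtain S where S: "S \<subseteq> V" "card S = Suc n" "n \<le> card (induced F en S)" by auto
  have "S \<noteq> V" "S \<noteq> {}" using S Suc.prems by auto
  then obtain e where e: "e \<in> F" "en e \<inter> S \<noteq> {}" "en e \<inter> (V - S) \<noteq> {}"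
    using cut_connectedD[OF cc S(1)] by blast
  then obtain p q where pq: "p \<in> en e" "p \<in> S" "q \<in> en e" "q \<in> V" "q \<notin> S" by blast
  then have en: "en e = {p, q}" using card2_eq[of "en e" p q] F(2)[OF e(1)] by blast
  have finS: "finite S" using S(1) V(1) finite_subset by blast
  have "e \<notin> induced F en S" using pq by (auto simp: induced_def)
  then have "Suc (card (induced F en S)) = card (insert e (induced F en S))" using F(1) by simp
  also have "\<dots> \<le> card (induced F en (insert q S))"
    by (rule card_mono) (use F(1) e(1) en pq in \<open>auto simp: induced_def\<close>)
  finally show ?case using S pq finS by (intro exI[of _ "insert q S"]) auto
qed

lemma cut_connected_card:
  assumes "cut_connected F en V" "finite F" "\<And>e. e \<in> F \<Longrightarrow> en e \<subseteq> V \<and> card (en e) = 2"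
    and "finite V" "V \<noteq> {}"
  shows "card V \<le> card F + 1"
proof -
  have "card V - 1 < card V" using assms(4,5) by (simp add: card_gt_0_iff)
  then obtain S where "card V - 1 \<le> card (induced F en S)" using cut_connected_grow[OF assms] by blast
  also have "\<dots> \<le> card F" by (rule card_mono) (use assms(2) in \<open>auto simp: induced_def\<close>)
  finally show ?thesis by simp
qed

section \<open>Paths and components as reachability\<close>

lemma mg_path_reach:
  assumes "mg_path H x y xs es"
  shows "x \<in> mverts H" "y \<in> mverts H" "(x, y) \<in> (adj (set es) (mends H) (mverts H))\<^sup>*"
proof -
  have w: "length xs = Suc (length es)" "set xs \<subseteq> mverts H"
    "\<And>i. i < length es \<Longrightarrow> mends H (es ! i) = {xs ! i, xs ! Suc i}" "hd xs = x" "last xs = y"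
    using assms by (auto simp: mg_path_def mg_walk_def)
  have xs: "xs ! i \<in> mverts H" if "i \<le> length es" for i using w(1,2) that by (auto intro: nth_mem)
  have "xs \<noteq> []" using w(1) by auto
  then have hl: "x = xs ! 0" "y = xs ! length es" using w by (auto simp: hd_conv_nth last_conv_nth)
  then show "x \<in> mverts H" "y \<in> mverts H" using xs by auto
  have "i \<le> length es \<Longrightarrow> (xs ! 0, xs ! i) \<in> (adj (set es) (mends H) (mverts H))\<^sup>*" for i
  proof (induction i)
    case (Suc i)
    have "(xs ! i, xs ! Suc i) \<in> (adj (set es) (mends H) (mverts H))\<^sup>*"
      using Suc.prems w(3)[of i] xs[of i] xs[of "Suc i"] by (intro adjI[of "es ! i"]) auto
    then show ?case using Suc by (meson Suc_leD rtrancl_trans)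
  qed simp
  then show "(x, y) \<in> (adj (set es) (mends H) (mverts H))\<^sup>*" using hl by simp
qed

lemma reach_mg_path:
  assumes "(x, y) \<in> (adj (medges H) (mends H) (mverts H))\<^sup>*" "x \<in> mverts H"
  shows "\<exists>xs es. mg_path H x y xs es"
  using assms(1)
proof (induction rule: rtrancl_induct)
  case base
  show ?case using assms(2) by (intro exI[of _ "[x]"] exI[of _ "[]"]) (simp add: mg_path_def mg_walk_def)
next
  case (step y z)
  then obtain xs es where p: "mg_path H x y xs es" by blast
  obtain e where e: "e \<in> medges H" "mends H e = {y, z}" "z \<in> mverts H" using step(2) by (auto simp: adj_def)
  have w: "length xs = Suc (length es)" "set xs \<subseteq> mverts H" "set es \<subseteq> medges H"
    "\<And>i. i < length es \<Longrightarrow> mends H (es ! i) = {xs ! i, xs ! Suc i}" "hd xs = x" "last xs = y" "distinct xs"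
    using p by (auto simp: mg_path_def mg_walk_def)
  have ne: "xs \<noteq> []" using w(1) by auto
  show ?case
  \<comment> \<open>A path must not repeat vertices: if \<open>z\<close> already occurs, the path is
    cut off there.\<close>
  proof (cases "z \<in> set xs")
    case True
    then obtain i where i: "i < length xs" "xs ! i = z" by (auto simp: in_set_conv_nth)
    have "mg_path H x z (take (Suc i) xs) (take i es)"
      unfolding mg_path_def mg_walk_def
    proof (intro conjI allI impI)
      show "set (take (Suc i) xs) \<subseteq> mverts H" using w(2) set_take_subset by fast
      show "set (take i es) \<subseteq> medges H" using w(3) set_take_subset by fast
      show "last (take (Suc i) xs) = z" using i by (simp add: take_Suc_conv_app_nth)
      show "hd (take (Suc i) xs) = x" using w(5) by (simp add: hd_take)
    qed (use w(1,4,7) i in auto)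
    then show ?thesis by blast
  next
    case False
    have lst: "xs ! length es = y" using w(1,6) ne by (simp add: last_conv_nth)
    have "mg_path H x z (xs @ [z]) (es @ [e])"
      unfolding mg_path_def mg_walk_def
    proof (intro conjI allI impI)
      fix i assume "i < length (es @ [e])"
      then consider "i < length es" | "i = length es" by fastforce
      then show "mends H ((es @ [e]) ! i) = {(xs @ [z]) ! i, (xs @ [z]) ! Suc i}"
      proof cases
        case 1 then show ?thesis using w(1,4) by (simp add: nth_append)
      next
        case 2 then show ?thesis using w(1) e(2) lst by (simp add: nth_append)
      qed
    qed (use w ne e False in auto)
    then show ?thesis by blast
  qed
qed

lemma mg_connected_iff:
  "mg_connected H \<longleftrightarrow> mverts H \<noteq> {} \<and>
    (\<forall>x\<in>mverts H. \<forall>y\<in>mverts H. (x, y) \<in> (adj (medges H) (mends H) (mverts H))\<^sup>*)"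
proof -
  have "(x, y) \<in> (adj (medges H) (mends H) (mverts H))\<^sup>*" if "mg_path H x y xs es" for x y xs es
  proof (rule adj_reach_mono[OF mg_path_reach(3)[OF that]])
    show "\<And>e. e \<in> set es \<Longrightarrow> e \<in> medges H \<and> mends H e = mends H e"
      using that by (auto simp: mg_path_def mg_walk_def)
  qed simp
  then show ?thesis unfolding mg_connected_def using reach_mg_path by metis
qed

text \<open>The witness for a component is the subgraph induced by the vertices reachable from
  \<open>a\<close>. A connected subgraph containing it has no further vertices, and no further edges
  because the witness is induced.\<close>

lemma in_same_component_iff:
  assumes "multigraph H"
  shows "in_same_component H a b \<longleftrightarrow>
    a \<in> mverts H \<and> (a, b) \<in> (adj (medges H) (mends H) (mverts H))\<^sup>*"
proof
  assume "in_same_component H a b"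
  then obtain C where C: "mg_subgraph C H" "mg_connected C" "a \<in> mverts C" "b \<in> mverts C"
    by (auto simp: in_same_component_def mg_component_def)
  have "(a, b) \<in> (adj (medges C) (mends C) (mverts C))\<^sup>*" using C by (simp add: mg_connected_iff)
  then have "(a, b) \<in> (adj (medges H) (mends H) (mverts H))\<^sup>*"
    by (rule adj_reach_mono) (use C(1) in \<open>auto simp: mg_subgraph_def\<close>)
  then show "a \<in> mverts H \<and> (a, b) \<in> (adj (medges H) (mends H) (mverts H))\<^sup>*"
    using C by (auto simp: mg_subgraph_def)
next
  let ?R = "(adj (medges H) (mends H) (mverts H))\<^sup>*"
  assume ab: "a \<in> mverts H \<and> (a, b) \<in> ?R"
  define Q where "Q = {z. (a, z) \<in> ?R}"
  define C where "C = H\<lparr>mverts := Q, medges := induced (medges H) (mends H) Q\<rparr>"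
  have C: "mverts C = Q" "medges C = induced (medges H) (mends H) Q" "mends C = mends H"
    by (auto simp: C_def)
  have QH: "Q \<subseteq> mverts H" unfolding Q_def using adj_reach_in ab by fast
  have sub: "mg_subgraph C H"
    using assms QH unfolding mg_subgraph_def multigraph_def C by (auto simp: induced_def)
  have aQ: "(a, z) \<in> (adj (medges C) (mends C) (mverts C))\<^sup>*" if "z \<in> Q" for z
    unfolding C
    by (rule adj_reach_mono[OF reach_restrict[folded Q_def]]) (use that in \<open>auto simp: Q_def induced_def\<close>)
  have con: "mg_connected C" unfolding mg_connected_iff
  proof (intro conjI ballI)
    show "mverts C \<noteq> {}" using C(1) by (auto simp: Q_def)
    fix x y assume "x \<in> mverts C" "y \<in> mverts C"
    then show "(x, y) \<in> (adj (medges C) (mends C) (mverts C))\<^sup>*"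
      using rtrancl_trans[OF adj_reach_sym[OF aQ] aQ] C(1) by simp
  qed
  have "H' = C" if H': "mg_subgraph H' H" "mg_connected H'" "mg_subgraph C H'" for H'
  proof -
    have s: "mverts H' \<subseteq> mverts H" "medges H' \<subseteq> medges H" "mends H' = mends H" "multigraph H'"
      "Q \<subseteq> mverts H'" "induced (medges H) (mends H) Q \<subseteq> medges H'"
      using H' by (auto simp: mg_subgraph_def C)
    have "a \<in> mverts H'" using s(5) by (auto simp: Q_def)
    then have "mverts H' \<subseteq> Q"
    proof (intro subsetI)
      fix z assume "z \<in> mverts H'"
      then have "(a, z) \<in> (adj (medges H') (mends H') (mverts H'))\<^sup>*"
        using H'(2) \<open>a \<in> mverts H'\<close> by (simp add: mg_connected_iff)
      then have "(a, z) \<in> ?R" by (rule adj_reach_mono) (use s in auto)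
      then show "z \<in> Q" by (simp add: Q_def)
    qed
    then have v: "mverts H' = Q" using s(5) by blast
    have "medges H' \<subseteq> induced (medges H) (mends H) Q"
      using s(2,3,4) v by (auto simp: induced_def multigraph_def)
    then have "medges H' = induced (medges H) (mends H) Q" using s(6) by blast
    then show ?thesis using v s(3) C by (intro mgraph.equality) auto
  qed
  then have "mg_component C H" unfolding mg_component_def using sub con by blast
  moreover have "a \<in> mverts C" "b \<in> mverts C" using ab C(1) by (auto simp: Q_def)
  ultimately show "in_same_component H a b" unfolding in_same_component_def by blast
qed

section \<open>Paths are sparse, colour classes are trees\<close>

text \<open>Map each edge inside \<open>B\<close> to its later end on the path. This is injective
  and misses a vertex of \<open>B\<close>, which gives the bound for one tree and hence for every
  \<open>k \<ge> 1\<close>.\<close>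

lemma path_sparse:
  assumes p: "mg_path H x y xs es" and k: "k \<ge> 1" and V: "mverts H \<subseteq> V" "finite V"
    and H: "multigraph H"
  shows "sparse k V (set es) (mends H)"
  unfolding sparse_def
proof (intro allI impI)
  fix B assume B: "B \<subseteq> V" "B \<noteq> {}"
  have w: "length xs = Suc (length es)" "set es \<subseteq> medges H"
    "\<And>i. i < length es \<Longrightarrow> mends H (es ! i) = {xs ! i, xs ! Suc i}" "distinct xs"
    using p by (auto simp: mg_path_def mg_walk_def)
  have finB: "finite B" using B(1) V(2) finite_subset by blast
  define I where "I = {i. i < length es \<and> xs ! i \<in> B \<and> xs ! Suc i \<in> B}"
  have finI: "finite I" by (simp add: I_def)
  have "induced (set es) (mends H) B \<subseteq> (\<lambda>i. es ! i) ` I"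
  proof
    fix e assume "e \<in> induced (set es) (mends H) B"
    then obtain i where "i < length es" "e = es ! i" "mends H e \<subseteq> B"
      by (auto simp: induced_def in_set_conv_nth)
    then show "e \<in> (\<lambda>i. es ! i) ` I" using w(3)[of i] by (auto simp: I_def)
  qed
  then have c1: "card (induced (set es) (mends H) B) \<le> card I" using finI surj_card_le by blast
  have "card I \<le> card B - 1"
  proof (cases "I = {}")
    case False
    \<comment> \<open>The earlier end of the first edge inside \<open>B\<close> is the later end of
      no edge inside \<open>B\<close>.\<close>
    define m where "m = Min I"
    have m: "m \<in> I" "\<And>i. i \<in> I \<Longrightarrow> m \<le> i" using False finI by (auto simp: m_def)
    have inj: "inj_on (\<lambda>i. xs ! Suc i) I"
      using w(1,4) by (auto simp: inj_on_def I_def nth_eq_iff_index_eq)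
    have "xs ! Suc i \<noteq> xs ! m" if "i \<in> I" for i
    proof -
      have "Suc i \<noteq> m" using m(2)[OF that] by simp
      then show ?thesis using w(1,4) that m(1) by (simp add: I_def nth_eq_iff_index_eq)
    qed
    then have "(\<lambda>i. xs ! Suc i) ` I \<subseteq> B - {xs ! m}" by (auto simp: I_def)
    then have "card I \<le> card (B - {xs ! m})" using card_inj_on_le[OF inj] finB by blast
    then show ?thesis using m(1) by (simp add: I_def)
  qed simp
  then have "card (induced (set es) (mends H) B) + 1 \<le> card B"
    using c1 B(2) finB by (metis Suc_eq_plus1 Suc_pred' add_le_mono1 card_gt_0_iff le_trans)
  then obtain d where d: "card B = card (induced (set es) (mends H) B) + 1 + d" using le_Suc_ex by blast
  have "card (induced (set es) (mends H) B) \<le> k * card (induced (set es) (mends H) B)" using k by simp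
  moreover have "k * card B = k * card (induced (set es) (mends H) B) + k + k * d"
    unfolding d by (simp only: distrib_left mult_1_right)
  ultimately show "card (induced (set es) (mends H) B) + k \<le> k * card B" by linarith
qed

text \<open>With a single colour, the argument with two low colours does not apply. If no edge
  crossed \<open>B\<close>, sparsity of \<open>B\<close> and \<open>V - B\<close> would allow at
  most n - 2 edges in total.\<close>

lemma ktight_1_packing:
  assumes kt: "ktight 1 V E en"
  shows "packing 1 V E en (\<lambda>_. 0)"
proof -
  have fin: "finite V" "finite E" and g: "\<And>e. e \<in> E \<Longrightarrow> en e \<subseteq> V \<and> card (en e) = 2"
    and sp: "sparse 1 V E en" and tot: "card E + 1 = card V"
    using kt by (auto simp: ktight_def graph_on_def)
  have "cut_connected E en V" unfolding cut_connected_def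
  proof (intro allI impI, rule ccontr)
    fix B assume B: "B \<subseteq> V" "B \<noteq> {}" "B \<noteq> V"
      and no: "\<not> (\<exists>e\<in>E. en e \<inter> B \<noteq> {} \<and> en e \<inter> (V - B) \<noteq> {})"
    have "E \<subseteq> induced E en B \<union> induced E en (V - B)" using g no by (auto simp: induced_def)
    then have "card E \<le> card (induced E en B \<union> induced E en (V - B))"
      using fin by (intro card_mono) auto
    also have "\<dots> \<le> card (induced E en B) + card (induced E en (V - B))" by (rule card_Un_le)
    finally have "card E \<le> card (induced E en B) + card (induced E en (V - B))" .
    moreover have "card (induced E en B) + 1 \<le> 1 * card B" by (rule sparseD[OF sp B(1,2)])
    moreover have "card (induced E en (V - B)) + 1 \<le> 1 * card (V - B)"
      by (rule sparseD[OF sp]) (use B in auto)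
    moreover have "card V = card B + card (V - B)"
      using fin(1) B(1) by (metis card_Diff_subset card_mono finite_subset le_add_diff_inverse)
    ultimately show False using tot by linarith
  qed
  then show ?thesis by (simp add: packing_def)
qed

text \<open>Every class has at least n - 1 edges, and the total is k(n - 1).\<close>

lemma class_card:
  assumes kt: "ktight k V E en" and c: "packing k V E en c" and i: "i < k"
  shows "card {e \<in> E. c e = i} + 1 = card V"
proof -
  have fin: "finite V" "finite E" and g: "\<And>e. e \<in> E \<Longrightarrow> en e \<subseteq> V \<and> card (en e) = 2"
    and V: "V \<noteq> {}" and tot: "card E + k = k * card V"
    using kt by (auto simp: ktight_def graph_on_def)
  let ?f = "\<lambda>i. card {e \<in> E. c e = i}"
  have ge: "card V \<le> ?f j + 1" if "j < k" for j
    by (rule cut_connected_card) (use c that fin g V in \<open>auto simp: packing_def\<close>)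
  have "E = (\<Union>j\<in>{..<k}. {e \<in> E. c e = j})" using c by (auto simp: packing_def)
  then have cE: "card E = (\<Sum>j\<in>{..<k}. ?f j)"
    using fin(2) by (subst card_UN_disjoint[symmetric]) auto
  show ?thesis
  proof (rule ccontr)
    assume "?f i + 1 \<noteq> card V"
    then have lt: "card V < ?f i + 1" using ge[OF i] by simp
    have "(\<Sum>j\<in>{..<k}. card V) < (\<Sum>j\<in>{..<k}. ?f j + 1)"
      by (rule sum_strict_mono_ex1) (use ge lt i in auto)
    also have "\<dots> = card E + k" unfolding cE by (subst sum.distrib) simp
    finally show False using tot by simp
  qed
qed

text \<open>Deleting an edge of a cycle would keep the graph connected with only n - 2
  edges.\<close>

lemma tree_of_count:
  assumes cc: "cut_connected (medges T) (mends T) (mverts T)" and m: "multigraph T"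
    and fin: "finite (mverts T)" "finite (medges T)" and V: "mverts T \<noteq> {}"
    and card: "card (medges T) + 1 = card (mverts T)"
  shows "mg_tree T"
proof -
  have g: "\<And>e. e \<in> medges T \<Longrightarrow> mends T e \<subseteq> mverts T \<and> card (mends T e) = 2"
    using m by (simp add: multigraph_def)
  have "mg_connected T"
    unfolding mg_connected_iff using V cut_connected_reach[OF cc] g by blast
  moreover have False if "mg_cycle T xs es" for xs es
  proof -
    have w: "length xs = Suc (length es)" "set es \<subseteq> medges T" "set xs \<subseteq> mverts T"
      "\<And>i. i < length es \<Longrightarrow> mends T (es ! i) = {xs ! i, xs ! Suc i}"
      "es \<noteq> []" "hd xs = last xs" "distinct es"
      using that by (auto simp: mg_cycle_def mg_walk_def)
    have "xs \<noteq> []" using w(1) by auto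
    then have hl: "xs ! 0 = xs ! length es" using w(1,6) by (simp add: hd_conv_nth last_conv_nth)
    let ?F = "medges T - {es ! 0}"
    have l0: "0 < length es" using w(5) by simp
    then have e0: "es ! 0 \<in> medges T" using w(2) by auto
    have "cut_connected ?F (mends T) (mverts T)" unfolding cut_connected_def
    proof (intro allI impI, rule ccontr)
      fix B assume B: "B \<subseteq> mverts T" "B \<noteq> {}" "B \<noteq> mverts T"
        and no: "\<not> (\<exists>e\<in>?F. mends T e \<inter> B \<noteq> {} \<and> mends T e \<inter> (mverts T - B) \<noteq> {})"
      \<comment> \<open>The rest of the cycle joins the ends of its first edge, so a set crossed by
        no other edge is not crossed by this one either.\<close>
      have "1 \<le> i \<Longrightarrow> i \<le> length es \<Longrightarrow> xs ! i \<in> B \<longleftrightarrow> xs ! 1 \<in> B" for i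
      proof (induction i)
        case (Suc i)
        show ?case
        proof (cases "i = 0")
          case False
          have "es ! i \<noteq> es ! 0" using w(7) Suc.prems l0 False by (simp add: nth_eq_iff_index_eq)
          then have "es ! i \<in> ?F" using w(2) Suc.prems by auto
          then have "xs ! i \<in> B \<longleftrightarrow> xs ! Suc i \<in> B"
            using no w(4)[of i] g[of "es ! i"] Suc.prems by auto
          then show ?thesis using Suc False by simp
        qed simp
      qed simp
      then have "xs ! 0 \<in> B \<longleftrightarrow> xs ! 1 \<in> B" using hl l0 by (metis One_nat_def Suc_leI order_refl)
      moreover have "mends T (es ! 0) = {xs ! 0, xs ! 1}" using w(4)[of 0] l0 by simp
      ultimately have "\<not> (mends T (es ! 0) \<inter> B \<noteq> {} \<and> mends T (es ! 0) \<inter> (mverts T - B) \<noteq> {})" by auto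
      then show False using no cut_connectedD[OF cc B] by blast
    qed
    then have "card (mverts T) \<le> card ?F + 1"
      by (rule cut_connected_card) (use g fin V in auto)
    moreover have "card ?F < card (medges T)" using fin(2) e0 by (rule card_Diff1_less)
    ultimately show False using card by simp
  qed
  ultimately show ?thesis using m unfolding mg_tree_def by blast
qed

section \<open>The partition condition for \<open>G - u\<close>\<close>

definition cut_edges :: "('v, 'e) mgraph \<Rightarrow> 'v set \<Rightarrow> 'e set" where
  "cut_edges G X = {e \<in> medges G. mends G e \<inter> X \<noteq> {} \<and> mends G e \<inter> (mverts G - X) \<noteq> {}}"

lemma no_path_across_cut:
  assumes "x \<in> X \<longleftrightarrow> y \<notin> X"
  shows "\<not> mg_path (delete_edges G (cut_edges G X)) x y xs es"
proof
  assume p: "mg_path (delete_edges G (cut_edges G X)) x y xs es"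
  let ?H = "delete_edges G (cut_edges G X)"
  have r: "(x, y) \<in> (adj (set es) (mends ?H) (mverts ?H))\<^sup>*" by (rule mg_path_reach(3)[OF p])
  have "set es \<subseteq> medges ?H" using p by (auto simp: mg_path_def mg_walk_def)
  then have step: "s \<in> X \<longleftrightarrow> t \<in> X" if "(s, t) \<in> adj (set es) (mends ?H) (mverts ?H)" for s t
    using that unfolding adj_def by (fastforce simp: delete_edges_def cut_edges_def)
  show False
  proof (cases "x \<in> X")
    case True
    then show False using rtrancl_leave[OF r, of X] assms step by blast
  next
    case False
    then show False using rtrancl_leave[OF r, of "- X"] assms step by blast
  qed
qed

text \<open>Every class of a partition of \<open>G - u\<close> sends out at least \<open>2k\<close> edges in \<open>G\<close>, and the one
  containing \<open>v\<close> at least \<open>deg u\<close> edges. The edges at \<open>u\<close> are counted at most once, the edges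
  between the classes twice.\<close>

lemma partition_condition:
  assumes G: "finite_multigraph G" and con: "mg_edge_connected (2 * k) G"
    and uv: "u \<in> mverts G" "v \<in> mverts G" "u \<noteq> v"
    and cut: "minimum_cut G u v (incident_edges G u)"
    and X: "\<Union>\<X> = mverts G - {u}" "{} \<notin> \<X>" "\<forall>X\<in>\<X>. \<forall>Y\<in>\<X>. X \<noteq> Y \<longrightarrow> X \<inter> Y = {}"
  shows "k * card \<X> \<le> card {e \<in> {e \<in> medges G. u \<notin> mends G e}. \<forall>X\<in>\<X>. \<not> mends G e \<subseteq> X} + k"
proof -
  have fin: "finite (mverts G)" "finite (medges G)"
    and g: "\<And>e. e \<in> medges G \<Longrightarrow> mends G e \<subseteq> mverts G \<and> card (mends G e) = 2"
    using G by (auto simp: finite_multigraph_def multigraph_def)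
  have finX: "finite \<X>" using X(1) fin(1) by (metis finite_Diff finite_UnionD)
  let ?C = "{e \<in> {e \<in> medges G. u \<notin> mends G e}. \<forall>X\<in>\<X>. \<not> mends G e \<subseteq> X}"
  let ?I = "incident_edges G u" and ?\<delta> = "cut_edges G"
  have fin\<delta>: "finite (?\<delta> X)" for X using fin(2) by (simp add: cut_edges_def)
  have ge: "2 * k \<le> card (?\<delta> X)" if XX: "X \<in> \<X>" for X
  proof (rule ccontr)
    assume "\<not> ?thesis"
    then have c: "mg_connected (delete_edges G (?\<delta> X))"
      using con fin\<delta> unfolding mg_edge_connected_def by (auto simp: cut_edges_def)
    obtain x where x: "x \<in> X" using XX X(2) by (metis all_not_in_conv)
    then have "x \<in> mverts G" "u \<notin> X" using XX X(1) by auto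
    then have "\<exists>xs es. mg_path (delete_edges G (?\<delta> X)) x u xs es"
      using c uv(1) unfolding mg_connected_def by (simp add: delete_edges_def)
    then show False using x \<open>u \<notin> X\<close> no_path_across_cut[of x X u G] by blast
  qed
  have gev: "card ?I \<le> card (?\<delta> X)" if "X \<in> \<X>" "v \<in> X" for X
  proof -
    have "u \<notin> X" using that X(1) by auto
    then have "separating_cut G u v (?\<delta> X)"
      using no_path_across_cut[of u X v G] that(2) by (auto simp: separating_cut_def cut_edges_def)
    then show ?thesis using cut by (auto simp: minimum_cut_def)
  qed
  obtain Xv where Xv: "Xv \<in> \<X>" "v \<in> Xv" using X(1) uv by auto
  have count: "card {X \<in> \<X>. e \<in> ?\<delta> X} \<le> (if e \<in> ?I then 1 else 0) + (if e \<in> ?C then 2 else 0)"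
    if e: "e \<in> medges G" for e
  proof -
    obtain x y where xy: "mends G e = {x, y}" "x \<noteq> y" using g[OF e] by (auto simp: card_2_iff)
    have at: "card {X \<in> \<X>. z \<in> X} \<le> 1" "finite {X \<in> \<X>. z \<in> X}" for z
    proof -
      show "finite {X \<in> \<X>. z \<in> X}" using finX by simp
      have "X = Y" if "X \<in> \<X>" "z \<in> X" "Y \<in> \<X>" "z \<in> Y" for X Y using X(3) that by blast
      then show "card {X \<in> \<X>. z \<in> X} \<le> 1" by (auto intro!: card_le_Suc0_iff_eq[THEN iffD2] simp: finX)
    qed
    have sub: "{X \<in> \<X>. e \<in> ?\<delta> X} \<subseteq> {X \<in> \<X>. x \<in> X} \<union> {X \<in> \<X>. y \<in> X}"
      using xy by (auto simp: cut_edges_def)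
    have "{X \<in> \<X>. u \<in> X} = {}" using X(1) by auto
    then have un: "card {X \<in> \<X>. u \<in> X} = 0" by (simp only: card.empty)
    have "card {X \<in> \<X>. e \<in> ?\<delta> X} \<le> card ({X \<in> \<X>. x \<in> X} \<union> {X \<in> \<X>. y \<in> X})"
      by (rule card_mono) (use at sub in auto)
    also have "\<dots> \<le> card {X \<in> \<X>. x \<in> X} + card {X \<in> \<X>. y \<in> X}" by (rule card_Un_le)
    finally have le: "card {X \<in> \<X>. e \<in> ?\<delta> X} \<le> card {X \<in> \<X>. x \<in> X} + card {X \<in> \<X>. y \<in> X}" .
    consider "e \<in> ?I" | "e \<notin> ?I" "e \<in> ?C" | "e \<notin> ?I" "e \<notin> ?C" by blast
    then show ?thesis
    proof cases
      case 1
      then have "u = x \<or> u = y" using xy by (auto simp: incident_edges_def)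
      then have "card {X \<in> \<X>. x \<in> X} = 0 \<or> card {X \<in> \<X>. y \<in> X} = 0"
        by (elim disjE) (use un in simp_all)
      then have "card {X \<in> \<X>. e \<in> ?\<delta> X} \<le> 1" using le at(1)[of x] at(1)[of y] by linarith
      then show ?thesis using 1 by simp
    next
      case 2
      then show ?thesis using le at(1)[of x] at(1)[of y] by simp
    next
      case 3
      then have "u \<notin> mends G e" using e by (auto simp: incident_edges_def)
      then obtain X0 where X0: "X0 \<in> \<X>" "mends G e \<subseteq> X0" using 3 e by blast
      have "{X \<in> \<X>. e \<in> ?\<delta> X} = {}"
      proof (rule ccontr)
        assume "\<not> ?thesis"
        then obtain Y where Y: "Y \<in> \<X>" "mends G e \<inter> Y \<noteq> {}" "mends G e \<inter> (mverts G - Y) \<noteq> {}"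
          by (auto simp: cut_edges_def)
        then have "X0 \<inter> Y \<noteq> {}" using X0(2) by blast
        then have "X0 = Y" using X(3) X0(1) Y(1) by blast
        then show False using Y(3) X0(2) by blast
      qed
      then have "card {X \<in> \<X>. e \<in> ?\<delta> X} = 0" by (simp only: card.empty)
      then show ?thesis by (simp only: le0)
    qed
  qed
  have "(\<Sum>X\<in>\<X>. card (?\<delta> X)) = (\<Sum>X\<in>\<X>. \<Sum>e\<in>medges G. if e \<in> ?\<delta> X then 1 else 0)"
  proof (rule sum.cong[OF refl])
    fix X
    have "?\<delta> X = {e \<in> medges G. e \<in> ?\<delta> X}" by (auto simp: cut_edges_def)
    then have "card (?\<delta> X) = (\<Sum>e\<in>{e \<in> medges G. e \<in> ?\<delta> X}. 1)" by simp
    also have "\<dots> = (\<Sum>e\<in>medges G. if e \<in> ?\<delta> X then 1 else 0)" by (rule sum.inter_filter[OF fin(2)])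
    finally show "card (?\<delta> X) = (\<Sum>e\<in>medges G. if e \<in> ?\<delta> X then 1 else 0)" .
  qed
  also have "\<dots> = (\<Sum>e\<in>medges G. \<Sum>X\<in>\<X>. if e \<in> ?\<delta> X then 1 else 0)" by (rule sum.swap)
  also have "\<dots> = (\<Sum>e\<in>medges G. card {X \<in> \<X>. e \<in> ?\<delta> X})"
    unfolding card_eq_sum by (intro sum.cong refl sum.inter_filter[symmetric] finX)
  also have "\<dots> \<le> (\<Sum>e\<in>medges G. (if e \<in> ?I then 1 else 0) + (if e \<in> ?C then 2 else 0))"
    by (rule sum_mono) (use count in blast)
  also have "\<dots> = (\<Sum>e\<in>medges G. if e \<in> ?I then 1 else 0) + (\<Sum>e\<in>medges G. if e \<in> ?C then 2 else 0)"
    by (rule sum.distrib)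
  also have "(\<Sum>e\<in>medges G. if e \<in> ?I then 1 else 0) = (\<Sum>e\<in>{e \<in> medges G. e \<in> ?I}. 1::nat)"
    by (rule sum.inter_filter[OF fin(2), symmetric])
  also have "{e \<in> medges G. e \<in> ?I} = ?I" by (auto simp: incident_edges_def)
  also have "(\<Sum>e\<in>medges G. if e \<in> ?C then 2 else 0) = (\<Sum>e\<in>{e \<in> medges G. e \<in> ?C}. 2::nat)"
    by (rule sum.inter_filter[OF fin(2), symmetric])
  also have "{e \<in> medges G. e \<in> ?C} = ?C" by auto
  finally have up: "(\<Sum>X\<in>\<X>. card (?\<delta> X)) \<le> card ?I + 2 * card ?C" by simp
  have "(\<Sum>X\<in>\<X>. card (?\<delta> X)) = card (?\<delta> Xv) + (\<Sum>X\<in>\<X> - {Xv}. card (?\<delta> X))"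
    by (rule sum.remove[OF finX Xv(1)])
  moreover have "card (\<X> - {Xv}) * (2 * k) \<le> (\<Sum>X\<in>\<X> - {Xv}. card (?\<delta> X))"
    using sum_bounded_below[of "\<X> - {Xv}" "2 * k" "\<lambda>X. card (?\<delta> X)"] ge by simp
  \<comment> \<open>The degree of \<open>u\<close> bounds the class of \<open>v\<close> from below
    and enters the upper bound once, so it cancels. This is where minimality of the cut is
    used.\<close>
  ultimately have "card (\<X> - {Xv}) * k \<le> card ?C" using up gev[OF Xv] by linarith
  moreover have "card \<X> = Suc (card (\<X> - {Xv}))" using card_Suc_Diff1[OF finX Xv(1)] by simp
  then have "k * card \<X> = k + card (\<X> - {Xv}) * k" by (metis mult.commute mult_Suc_right)
  ultimately show ?thesis by linarith
qed

theorem theorem1p6: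
  fixes G :: "('v, 'e) mgraph" and k :: nat and u v a b :: 'v
  assumes "k \<ge> 1"
    and "finite_multigraph G"
    and "mg_edge_connected (2 * k) G"
    and "u \<in> mverts G" and "v \<in> mverts G" and "u \<noteq> v"
    and "minimum_cut G u v (incident_edges G u)"
    and "in_same_component (delete_vertices G {u, v}) a b"
  shows "\<exists>\<T>. spanning_tree_packing \<T> (delete_vertices G {u}) \<and> card \<T> = k \<and>
    (\<exists>T \<in> \<T>. \<exists>T' \<in> \<T>. in_same_component (delete_vertices (mg_union T T') {v}) a b)"
proof -
  define V where "V = mverts G - {u}"
  define E where "E = {e \<in> medges G. u \<notin> mends G e}"
  define en where "en = mends G"
  let ?Guv = "delete_vertices G {u, v}"
  have fin: "finite (mverts G)" "finite (medges G)"
    and gG: "\<And>e. e \<in> medges G \<Longrightarrow> mends G e \<subseteq> mverts G \<and> card (mends G e) = 2"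
    using assms(2) by (auto simp: finite_multigraph_def multigraph_def)
  have g: "graph_on V E en" using fin gG unfolding graph_on_def V_def E_def en_def by auto
  have V: "V \<noteq> {}" "v \<in> V" "finite V" using assms(5,6) fin by (auto simp: V_def)
  have Guv: "mverts ?Guv = V - {v}" "medges ?Guv \<subseteq> E" "mends ?Guv = en"
    by (auto simp: delete_vertices_def V_def E_def en_def)
  have mGuv: "multigraph ?Guv"
    using gG by (auto simp: multigraph_def delete_vertices_def)
  have aV: "a \<in> V - {v}" and "(a, b) \<in> (adj (medges ?Guv) (mends ?Guv) (mverts ?Guv))\<^sup>*"
    using assms(8) unfolding in_same_component_iff[OF mGuv] Guv(1) by auto
  then obtain xs es where p: "mg_path ?Guv a b xs es"
    using reach_mg_path[of a b ?Guv] Guv(1) by auto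
  have bV: "b \<in> V - {v}" using mg_path_reach(2)[OF p] Guv(1) by simp
  have "set es \<subseteq> E" using p Guv(2) by (auto simp: mg_path_def mg_walk_def)
  moreover have "sparse k V (set es) en"
    using path_sparse[OF p assms(1) _ V(3) mGuv] Guv by auto
  ultimately obtain E' where E': "set es \<subseteq> E'" "E' \<subseteq> E" "ktight k V E' en"
    using ex_ktight_subgraph[OF g V(1), of "set es" k]
      partition_condition[OF assms(2-7), folded V_def E_def en_def] by blast
  have fE': "finite E'" and gE': "\<And>e. e \<in> E' \<Longrightarrow> en e \<subseteq> V \<and> card (en e) = 2"
    using E'(3) by (auto simp: ktight_def graph_on_def)
  have ab: "(a, b) \<in> (adj E' en (V - {v}))\<^sup>*"
    by (rule adj_reach_mono[OF mg_path_reach(3)[OF p]]) (use Guv E'(1) in auto)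
  have "\<exists>c. packing k V E' en c \<and> (a, b) \<in> (adj (low E' c) en (V - {v}))\<^sup>*"
  \<comment> \<open>For \<open>k = 1\<close> the single class is all of \<open>E'\<close>, which
    contains the path.\<close>
  proof (cases "k = 1")
    case True
    then show ?thesis using ktight_1_packing E'(3) ab by (intro exI[of _ "\<lambda>_. 0"]) simp
  next
    case False
    then have "k \<ge> 2" using assms(1) by simp
    then have "linkable k V E' en" by (rule ktight_linkable[OF E'(3)])
    then have "\<exists>c. linked_packing k V E' en v a b ({} \<union> {}) c"
      by (rule linkableD) (use V aV bV ab in \<open>auto simp: root_edge_def\<close>)
    then show ?thesis by (auto simp: linked_packing_def)
  qed
  then obtain c where c: "packing k V E' en c" "(a, b) \<in> (adj (low E' c) en (V - {v}))\<^sup>*" by blast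
  define T where "T i = G\<lparr>mverts := V, medges := {e \<in> E'. c e = i}\<rparr>" for i
  have T: "mverts (T i) = V" "medges (T i) = {e \<in> E'. c e = i}" "mends (T i) = en" for i
    by (auto simp: T_def en_def)
  have cc: "cut_connected {e \<in> E'. c e = i} en V" if "i < k" for i using c(1) that by (simp add: packing_def)
  have mT: "multigraph (T i)" for i using gE' by (simp add: multigraph_def T)
  have span: "mg_spanning_tree (T i) (delete_vertices G {u})" if i: "i < k" for i
  proof -
    have "mg_tree (T i)"
      by (rule tree_of_count) (use T mT cc[OF i] V fE' class_card[OF E'(3) c(1) i] in simp_all)
    then show ?thesis
      using mT[of i] E'(2) unfolding mg_spanning_tree_def mg_subgraph_def T
      by (auto simp: delete_vertices_def V_def E_def en_def)
  qed
  \<comment> \<open>\<open>V\<close> contains the distinct vertices \<open>a\<close> and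
    \<open>v\<close>, so the disjoint classes are nonempty and there are really \<open>k\<close>
    trees.\<close>
  have "inj_on T {..<k}"
  proof (rule inj_onI)
    fix i j assume ij: "i \<in> {..<k}" "j \<in> {..<k}" "T i = T j"
    have "{a} \<noteq> V" using V(2) aV by blast
    then obtain e where "e \<in> {e \<in> E'. c e = i}"
      using cut_connectedD[OF cc, of i "{a}"] ij(1) aV by auto
    moreover have "{e \<in> E'. c e = i} = {e \<in> E'. c e = j}" using ij(3) T(2) by metis
    ultimately show "i = j" by auto
  qed
  then have "card (T ` {..<k}) = k" by (simp add: card_image)
  moreover have "spanning_tree_packing (T ` {..<k}) (delete_vertices G {u})"
    unfolding spanning_tree_packing_def using span by (auto simp: T)
  \<comment> \<open>\<open>min 1 (k - 1)\<close> is colour 1, or colour 0 again for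
    \<open>k = 1\<close>, so that both trees belong to the packing.\<close>
  moreover have "in_same_component (delete_vertices (mg_union (T 0) (T (min 1 (k - 1)))) {v}) a b"
  proof -
    let ?H = "delete_vertices (mg_union (T 0) (T (min 1 (k - 1)))) {v}"
    have H: "mverts ?H = V - {v}" "mends ?H = en"
      "medges ?H = {e \<in> E'. (c e = 0 \<or> c e = min 1 (k - 1)) \<and> v \<notin> en e}"
      by (auto simp: delete_vertices_def mg_union_def T)
    have "multigraph ?H" using gE' unfolding multigraph_def H by auto
    moreover have "(a, b) \<in> (adj (medges ?H) (mends ?H) (mverts ?H))\<^sup>*" unfolding H
    proof (rule adj_reach_mono[OF c(2)])
      fix e assume e: "e \<in> low E' c" "en e \<subseteq> V - {v}"
      then have "c e < k" "c e < 2" using c(1) by (auto simp: packing_def)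
      then have "c e = 0 \<or> c e = min 1 (k - 1)" by linarith
      then show "e \<in> {e \<in> E'. (c e = 0 \<or> c e = min 1 (k - 1)) \<and> v \<notin> en e} \<and> en e = en e"
        using e by auto
    qed simp
    ultimately show ?thesis using aV H(1) by (simp add: in_same_component_iff)
  qed
  moreover have "T 0 \<in> T ` {..<k}" "T (min 1 (k - 1)) \<in> T ` {..<k}" using assms(1) by auto
  ultimately show ?thesis by blast
qed

end
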